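(* Let $\boldsymbol f$ be a Rademacher random completely multiplicative function. There is a constant $\beta>0$ such that if $x$ is sufficiently large then $$\mathbb{P}\Big(\sum_{n\le x}\frac{\boldsymbol f(n)}{n}<0\Big)\ll\exp(-x^{\beta}).$$
   Context: A Rademacher random completely multiplicative function is defined by taking $(\boldsymbol f(p))_p$ over primes $p$ to be i.i.d. random variables uniform on $\{-1,+1\}$, and setting $\boldsymbol f(p_1^{a_1}\cdots p_k^{a_k}):=\prod_j\boldsymbol f(p_j)^{a_j}$ (and $\boldsymbol f(1)=1$). *)

theory Defs
  imports "HOL-Probability.Probability" "HOL-Computational_Algebra.Primes"
begin

definition rademacher :: "real measure" where
  "rademacher = measure_pmf (pmf_of_set {-1, 1})"

definition rad_space :: "(nat \<Rightarrow> real) measure" where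
  "rad_space = (\<Pi>\<^sub>M p\<in>{p. prime p}. rademacher)"

definition rcmf :: "(nat \<Rightarrow> real) \<Rightarrow> nat \<Rightarrow> real" where
  "rcmf w n = (\<Prod>p\<in>prime_factors n. w p ^ multiplicity p n)"

end

theory Submission
  imports Defs "HOL-Number_Theory.Prime_Powers" "HOL-Computational_Algebra.Squarefree"
    "HOL-Real_Asymp.Real_Asymp"
begin

text \<open>
  Let \<open>y = x\<^bsup>1/U\<^esup>\<close> for a large constant \<open>U\<close>. Splitting off the largest prime factor (Buchstab's identity)
  writes the sum over \<open>n \<le> x\<close> as the sum over the \<open>y\<close>-smooth \<open>n \<le> x\<close>, plus a martingale in the signs of the
  primes in \<open>(y, x]\<close>, plus a negligible error. The increments of the martingale at \<open>q\<close> are \<open>O(ln x / q)\<close>, so it is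
  smaller than \<open>c / ln x\<close> outside an event of probability \<open>exp (- x\<^bsup>\<beta>\<^esup>)\<close>. The point is therefore to bound the smooth sum
  from below by \<open>c / ln x\<close> for every choice \<open>f\<close> of signs, and for this it is compared with the Euler product
  \<open>F(y) = \<Prod>\<^bsub>p \<le> y\<^esub> (1 - f(p)/p)\<^bsup>-1\<^esup>\<close>, which may be as small as \<open>1 / ln y\<close>.

  Extend \<open>f\<close> by \<open>0\<close> to primes above \<open>y\<close> and let \<open>g = 1 * f\<close>, which is nonnegative. The sum of \<open>g(s)/s\<close> over a dyadic
  block near \<open>t\<close> is \<open>O(F(y))\<close> by Mertens' estimates, and \<open>f = g * \<mu>\<close> where \<open>\<Sum>\<^bsub>n \<le> t\<^esub> \<mu>(n)/n = O((ln t)\<^bsup>-3/2\<^esup>)\<close>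
  is summable over dyadic blocks; hence smooth sums are \<open>O(F(y))\<close>. Feeding this into Buchstab's identity
  improves it to \<open>F(y) (1 + O((ln y / ln t)\<^sup>k))\<close>.

  The estimate for \<open>\<mu>\<close> uses that the second derivative of \<open>1 / (s \<zeta>(1 + s))\<close> is the Laplace transform of
  \<open>v\<^sup>2 \<Sum>\<^bsub>n \<le> exp v\<^esub> \<mu>(n)/n\<close>. It decays like \<open>|Im s|\<^bsup>-3/4\<^esup>\<close> for \<open>Re s > 0\<close> by the quantitative non-vanishing
  of \<open>\<zeta>\<close> near the line \<open>Re = 1\<close>, and testing against a narrow Gaussian recovers pointwise bounds.
\<close>

section \<open>Euler products and Dirichlet convolution\<close>

text \<open>The target c / ln x is forced by the worst case: if every sign up to y is -1, then F(y)
  has order 1 / ln y. The deterministic part must therefore be controlled relative to F(y); an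
  absolute error of fixed size would be useless. The squares of the martingale increments add up to
  at most (1 + ln x)^2 / y, so it reaches the target only with probability about exp(-y / (ln x)^4),
  which leaves room for any \<beta> < 1/U. The obstacle is the number of dyadic blocks, about ln t:
  a bound o(1) for the sums of \<mu>(n)/n, as in the bare prime number theorem, cannot be summed
  over them, and a power of ln t with exponent below -1 is required. This is why the second
  derivative is taken: it supplies the weight v^2. A Gaussian window of width \<delta> costs a
  factor \<delta>^(-1/4) and a fluctuation of size \<delta>, and \<delta> = v^(-3/2) still leaves
  v^(-3/2). The weight v of the first derivative would gain at most v^(-1), just short of
  summability. All bounds for \<zeta> hold for 0 < Re s \<le> 1 with constants independent of Re s,
  so that \<sigma> can be taken as small as 1/v.\<close>

lemma norm_summable_Times:
  fixes x :: "'i \<Rightarrow> 'a::{real_normed_field,banach}" and y :: "'j \<Rightarrow> 'a"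
  assumes "(\<lambda>i. norm (x i)) summable_on A" "(\<lambda>j. norm (y j)) summable_on B"
  shows "(\<lambda>(i,j). norm (x i * y j)) summable_on A \<times> B"
    and "((\<lambda>(i,j). x i * y j) has_sum (infsum x A * infsum y B)) (A \<times> B)"
proof -
  have "((\<lambda>j. norm (x i * y j)) has_sum (norm (x i) * infsum (\<lambda>j. norm (y j)) B)) B" for i
    unfolding norm_mult by (intro has_sum_cmult_right has_sum_infsum assms)
  then show 1: "(\<lambda>(i,j). norm (x i * y j)) summable_on A \<times> B"
    by (intro summable_on_SigmaI[where g = "\<lambda>i. norm (x i) * infsum (\<lambda>j. norm (y j)) B"]
          summable_on_cmult_left assms) auto
  have "(\<lambda>(i,j). x i * y j) summable_on A \<times> B"
    using 1 by (rule_tac abs_summable_summable) (simp add: case_prod_unfold)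
  then show "((\<lambda>(i,j). x i * y j) has_sum (infsum x A * infsum y B)) (A \<times> B)"
  proof (rule has_sum_SigmaI[rotated 2])
    have x: "x summable_on A" and y: "y summable_on B"
      by (rule assms[THEN abs_summable_summable])+
    show "((\<lambda>i. x i * infsum y B) has_sum (infsum x A * infsum y B)) A"
      using x by (intro has_sum_cmult_left) simp
    show "((\<lambda>j. case (i, j) of (i, j) \<Rightarrow> x i * y j) has_sum (x i * infsum y B)) B" for i
      using y by (auto intro!: has_sum_cmult_right)
  qed
qed

text \<open>Pairs (i, j) are regrouped by their product n = i j, a pair being remembered as (n, i)
  with i a divisor of n. Absolute convergence of both series permits the regrouping.\<close>

lemma has_sum_dirichlet_prod:
  fixes a b :: "nat \<Rightarrow> 'a::{real_normed_field,banach}"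
  assumes "(\<lambda>n. norm (a n)) summable_on {1..}" "(\<lambda>n. norm (b n)) summable_on {1..}"
  shows "((\<lambda>n. \<Sum>d | d dvd n. a d * b (n div d)) has_sum (infsum a {1..} * infsum b {1..})) {1..}"
proof -
  have "((\<lambda>(i,j). a i * b j) has_sum (infsum a {1..} * infsum b {1..})) ({1..} \<times> {1..})"
    by (rule norm_summable_Times(2)[OF assms])
  also have "?this \<longleftrightarrow> ((\<lambda>(n,d). a d * b (n div d)) has_sum (infsum a {1..} * infsum b {1..}))
      (SIGMA n:{1..}. {d. d dvd n})"
    by (intro has_sum_reindex_bij_witness[where i = "\<lambda>(n,d). (d, n div d)" and j = "\<lambda>(i,j). (i*j, i)"])
       (auto simp: Suc_le_eq intro: Nat.gr0I)
  finally have *: "((\<lambda>(n,d). a d * b (n div d)) has_sum (infsum a {1..} * infsum b {1..}))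
      (SIGMA n:{1..}. {d. d dvd n})" .
  show ?thesis
    by (rule has_sum_SigmaD[OF *]) (auto intro!: has_sum_finiteI)
qed

section \<open>Smooth numbers and finite Euler products\<close>

definition smooth :: "nat \<Rightarrow> nat set" where
  "smooth N = {n. 0 < n \<and> (\<forall>p. prime p \<longrightarrow> p dvd n \<longrightarrow> p \<le> N)}"

lemma smooth_0: "smooth 0 = {1}"
proof -
  have "n = 1" if "n \<in> smooth 0" for n
  proof (rule ccontr)
    assume "n \<noteq> 1"
    then obtain p where "prime p" "p dvd n" using prime_factor_nat by blast
    with that show False unfolding smooth_def using prime_gt_0_nat by force
  qed
  then show ?thesis by (auto simp: smooth_def)
qed

lemma smooth_Suc_not_prime: "\<not> prime (Suc N) \<Longrightarrow> smooth (Suc N) = smooth N"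
  unfolding smooth_def using le_Suc_eq by auto

text \<open>Passing from N to a prime q = N + 1 only frees the exponent of q: the inverse map reads
  off the multiplicity of q and divides it out. This is the inductive step of the Euler product
  below.\<close>

lemma bij_betw_smooth_Suc:
  assumes q: "prime (Suc N)"
  shows "bij_betw (\<lambda>(k,m). Suc N ^ k * m) (UNIV \<times> smooth N) (smooth (Suc N))"
proof (rule bij_betw_byWitness[where f' = "\<lambda>n. (multiplicity (Suc N) n, n div Suc N ^ multiplicity (Suc N) n)"])
  let ?q = "Suc N"
  have nd: "\<not> ?q dvd m" if "m \<in> smooth N" for m
  proof
    assume "?q dvd m"
    with q that have "?q \<le> N" unfolding smooth_def by blast
    then show False by simp
  qed
  have mult: "multiplicity ?q (?q ^ k * m) = k" if "m \<in> smooth N" for k m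
    using nd[OF that] that q 
    by (subst prime_elem_multiplicity_mult_distrib) 
      (auto simp: smooth_def not_dvd_imp_multiplicity_0 multiplicity_prime_power)
  show "\<forall>a\<in>UNIV \<times> smooth N. (\<lambda>n. (multiplicity ?q n, n div ?q ^ multiplicity ?q n)) (case a of (k, m) \<Rightarrow> ?q ^ k * m) = a"
    using mult by (auto simp del: power_Suc mult_Suc)
  show "\<forall>a'\<in>smooth ?q. (case (multiplicity ?q a', a' div ?q ^ multiplicity ?q a') of (k, m) \<Rightarrow> ?q ^ k * m) = a'"
    by (auto simp: multiplicity_dvd)
  show "(\<lambda>(k, m). ?q ^ k * m) ` (UNIV \<times> smooth N) \<subseteq> smooth ?q"
  proof safe
    fix k m assume m: "m \<in> smooth N"
    have "p \<le> ?q" if "prime p" "p dvd ?q ^ k * m" for p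
    proof (cases "p dvd m")
      case True then show ?thesis using m that by (auto simp: smooth_def le_Suc_eq)
    next
      case False
      then have "p dvd ?q" using that by (metis prime_dvd_mult_iff prime_dvd_power)
      then show ?thesis by (simp add: dvd_imp_le)
    qed
    then show "?q ^ k * m \<in> smooth ?q" using m by (auto simp: smooth_def)
  qed
  show "(\<lambda>n. (multiplicity ?q n, n div ?q ^ multiplicity ?q n)) ` smooth ?q \<subseteq> UNIV \<times> smooth N"
  proof (rule image_subsetI)
    fix n assume n: "n \<in> smooth ?q"
    let ?m = "n div ?q ^ multiplicity ?q n"
    have eq: "n = ?q ^ multiplicity ?q n * ?m" by (simp add: multiplicity_dvd)
    have pos: "n > 0" using n by (auto simp: smooth_def)
    then have mpos: "?m > 0" using eq by (metis gr0I mult_0_right)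
    have "\<not> ?q dvd ?m"
      using pos q by (intro multiplicity_decompose) (auto simp: prime_nat_iff)
    then have "p \<le> N" if "prime p" "p dvd ?m" for p
    proof -
      have "p dvd n" using that eq by (metis dvd_mult)
      then have "p \<le> ?q" using n that by (auto simp: smooth_def)
      then show ?thesis using that \<open>\<not> ?q dvd ?m\<close> le_Suc_eq by blast
    qed
    then show "(multiplicity ?q n, ?m) \<in> UNIV \<times> smooth N" using mpos by (auto simp: smooth_def)
  qed
qed

text \<open>Finitely many primes are involved and each contributes an independent geometric series,
  so |a p| < 1 at the primes suffices even when the series over all n diverges. The general field
  serves the complex terms n^(-1-s), the real terms u(n)/n and the weights n^(-1/2) alike.\<close>

lemma has_sum_smooth:
  fixes a :: "nat \<Rightarrow> 'a::{real_normed_field,banach}"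
  assumes a1: "a 1 = 1" and am: "\<And>m n. m > 0 \<Longrightarrow> n > 0 \<Longrightarrow> a (m * n) = a m * a n"
    and ap: "\<And>p. prime p \<Longrightarrow> norm (a p) < 1"
  shows "(\<lambda>n. norm (a n)) summable_on smooth N
     \<and> (a has_sum (\<Prod>p | prime p \<and> p \<le> N. 1 / (1 - a p))) (smooth N)"
proof (induction N)
  case 0
  have *: "{p::nat. prime p \<and> p \<le> 0} = {}" by auto
  show ?case unfolding * smooth_0 using a1 has_sum_finite[of "{1}" a] by simp
next
  case (Suc N)
  show ?case
  proof (cases "prime (Suc N)")
    case False
    then have "{p. prime p \<and> p \<le> Suc N} = {p. prime p \<and> p \<le> N}"
      using le_Suc_eq by auto
    with False Suc show ?thesis by (simp add: smooth_Suc_not_prime)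
  next
    case q: True
    let ?q = "Suc N"
    have pw: "a (?q ^ k) = a ?q ^ k" for k
      by (induction k) (use a1 am[of ?q] in \<open>auto simp del: mult_Suc\<close>)
    have geo: "summable (\<lambda>k. norm (a ?q ^ k))"
      using ap[OF q] by (simp add: norm_power summable_geometric)
    have geo': "(\<lambda>k. norm (a ?q ^ k)) summable_on UNIV"
      by (rule summable_nonneg_imp_summable_on[OF geo]) auto
    have "((\<lambda>k. a ?q ^ k) has_sum (1 / (1 - a ?q))) UNIV"
      using geo geometric_sums[OF ap[OF q]] by (intro norm_summable_imp_has_sum) auto
    then have inf1: "infsum (\<lambda>k. a ?q ^ k) UNIV = 1 / (1 - a ?q)" by (rule infsumI)
    have inf2: "infsum a (smooth N) = (\<Prod>p | prime p \<and> p \<le> N. 1 / (1 - a p))"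
      using Suc by (intro infsumI) auto
    have eq: "a (case z of (k, m) \<Rightarrow> ?q ^ k * m) = (\<lambda>(k,m). a ?q ^ k * a m) z" 
      if "z \<in> UNIV \<times> smooth N" for z
      using that am pw by (auto simp: smooth_def simp del: power_Suc mult_Suc)
    note bij = bij_betw_smooth_Suc[OF q]
    have sN: "(\<lambda>n. norm (a n)) summable_on smooth N" using Suc by simp
    have "(\<lambda>n. norm (a n)) summable_on smooth ?q \<longleftrightarrow> (\<lambda>(k,m). norm (a ?q ^ k * a m)) summable_on UNIV \<times> smooth N"
      by (subst summable_on_reindex_bij_betw[OF bij, symmetric], intro summable_on_cong)
         (use eq in auto)
    then have 1: "(\<lambda>n. norm (a n)) summable_on smooth ?q"
      using norm_summable_Times(1)[OF geo' sN] by simp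
    have "(a has_sum S) (smooth ?q) \<longleftrightarrow> ((\<lambda>(k,m). a ?q ^ k * a m) has_sum S) (UNIV \<times> smooth N)" for S
      by (subst has_sum_reindex_bij_betw[OF bij, symmetric], intro has_sum_cong) (use eq in auto)
    then have "(a has_sum (1 / (1 - a ?q) * (\<Prod>p | prime p \<and> p \<le> N. 1 / (1 - a p)))) (smooth ?q)"
      using norm_summable_Times(2)[OF geo' sN] inf1 inf2 by simp
    moreover have "{p. prime p \<and> p \<le> ?q} = insert ?q {p. prime p \<and> p \<le> N}"
      using q le_Suc_eq by auto
    ultimately show ?thesis using 1 by simp
  qed
qed

section \<open>The Moebius function\<close>

definition moebius :: "nat \<Rightarrow> real" where
  "moebius n = (if squarefree n then (- 1) ^ card (prime_factors n) else 0)"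

lemma abs_moebius_le: "\<bar>moebius n\<bar> \<le> 1"
  by (simp add: moebius_def power_abs)

lemma moebius_prime_mult:
  assumes p: "prime p" and n: "\<not> p dvd n" "squarefree n"
  shows "moebius (p * n) = - moebius n"
proof -
  have c: "coprime p n" using p n by (simp add: prime_imp_coprime)
  have n0: "n \<noteq> 0" using n(1) by (metis dvd_0_right)
  have "squarefree (p * n)"
    using c p n by (intro squarefree_mult_coprime) (auto intro: squarefree_prime)
  moreover have "prime_factors (p * n) = insert p (prime_factors n)"
    using p n0 by (subst prime_factors_product) (auto simp: prime_prime_factors)
  moreover have "p \<notin> prime_factors n" using n by auto
  ultimately show ?thesis using n by (simp add: moebius_def)
qed

text \<open>For a fixed prime p dividing n, the squarefree divisors fall into pairs d, p d with p
  not dividing d, and the two terms of a pair cancel.\<close>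

lemma sum_moebius_dvd:
  assumes "n > 0"
  shows "(\<Sum>d | d dvd n. moebius d) = (if n = 1 then 1 else 0)"
proof (cases "n = 1")
  case True
  then show ?thesis by (simp add: moebius_def)
next
  case False
  then obtain p where p: "prime p" "p dvd n" using prime_factor_nat by blast
  define A where "A = {d. d dvd n \<and> squarefree d \<and> \<not> p dvd d}"
  have fin: "finite {d. d dvd n}" using assms by simp
  have A: "finite A" unfolding A_def by (rule finite_subset[OF _ fin]) auto
  have sub: "p * d dvd n" if "d \<in> A" for d
    using that p prime_imp_coprime[of p d] by (auto simp: A_def intro: divides_mult)
  have sq: "squarefree (p * d)" if "d \<in> A" for d
    using that p prime_imp_coprime[of p d]
    by (intro squarefree_mult_coprime) (auto simp: A_def intro: squarefree_prime)
  have B: "{d. d dvd n \<and> squarefree d \<and> p dvd d} = (*) p ` A" (is "?B = _")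
  proof (intro set_eqI iffI)
    fix d assume d: "d \<in> ?B"
    then obtain e where e: "d = p * e" by (auto elim: dvdE)
    have "squarefree e" using d e by (auto dest: squarefree_multD)
    moreover have "\<not> p dvd e"
      using d e p squarefreeD[of d p] by (auto simp: power2_eq_square)
    moreover have "e dvd n" using d e by (metis dvd_mult_right mem_Collect_eq)
    ultimately show "d \<in> (*) p ` A" using e by (auto simp: A_def)
  qed (use sub sq in auto)
  have "(\<Sum>d | d dvd n. moebius d) = (\<Sum>d\<in>A \<union> ?B. moebius d)"
    using fin by (intro sum.mono_neutral_right) (auto simp: A_def moebius_def)
  also have "\<dots> = (\<Sum>d\<in>A. moebius d) + (\<Sum>d\<in>?B. moebius d)"
    using A by (intro sum.union_disjoint) (auto simp: A_def B)
  also have "(\<Sum>d\<in>?B. moebius d) = (\<Sum>d\<in>A. moebius (p * d))"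
    unfolding B using p by (subst sum.reindex) (auto simp: inj_on_def)
  also have "\<dots> = - (\<Sum>d\<in>A. moebius d)"
    unfolding sum_negf[symmetric] by (intro sum.cong refl moebius_prime_mult) (use p in \<open>auto simp: A_def\<close>)
  finally show ?thesis using False by simp
qed

section \<open>Mertens' estimates\<close>

text \<open>Both sides run over the pairs (d, m) with d m \<le> N; F sees a divisor and its
  cofactor. This is the exchange behind the partial sums of convolutions below.\<close>

lemma sum_divisors_swap:
  fixes F :: "nat \<Rightarrow> nat \<Rightarrow> 'a::comm_monoid_add"
  shows "(\<Sum>k=1..N. \<Sum>d | d dvd k. F d (k div d)) = (\<Sum>d=1..N. \<Sum>m=1..N div d. F d m)"
proof -
  have "(\<Sum>k=1..N. \<Sum>d | d dvd k. F d (k div d)) = (\<Sum>(k,d)\<in>(SIGMA k:{1..N}. {d. d dvd k}). F d (k div d))"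
    by (subst sum.Sigma) auto
  also have "\<dots> = (\<Sum>(d,m)\<in>(SIGMA d:{1..N}. {1..N div d}). F d m)"
  proof (rule sum.reindex_bij_witness[where i = "\<lambda>(d,m). (d*m, d)" and j = "\<lambda>(k,d). (d, k div d)"], goal_cases)
    case (1 a)
    then show ?case by auto
  next
    case (2 a)
    then obtain k d where a: "a = (k,d)" "1 \<le> k" "k \<le> N" "d dvd k" by auto
    then have "0 < d" "d \<le> k" by (auto intro!: Nat.gr0I dvd_imp_le)
    with a show ?case using div_le_mono[of k N d] by (auto simp: Suc_le_eq div_greater_zero_iff)
  next
    case (3 b)
    then show ?case by auto
  next
    case (4 b)
    then obtain d m where b: "b = (d,m)" "1 \<le> d" "d \<le> N" "1 \<le> m" "m \<le> N div d" by auto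
    then have "d * m \<le> N" using less_eq_div_iff_mult_less_eq[of d m N] by (simp add: mult.commute)
    with b show ?case by auto
  next
    case (5 a)
    then show ?case by auto
  qed
  also have "\<dots> = (\<Sum>d=1..N. \<Sum>m=1..N div d. F d m)"
    by (subst sum.Sigma) auto
  finally show ?thesis .
qed

lemma real_div_bounds:
  assumes "n > 0"
  shows "real (N div n) \<le> real N / real n" "real N / real n \<le> real (N div n) + 1"
proof -
  have "real N = real n * real (N div n) + real (N mod n)"
    by (metis mult_div_mod_eq of_nat_add of_nat_mult)
  moreover have "real (N mod n) \<le> real n" using assms by simp
  ultimately show "real (N div n) \<le> real N / real n" "real N / real n \<le> real (N div n) + 1"
    using assms by (simp_all add: field_simps)
qed

text \<open>Legendre's formula for N!, obtained by summing ln k as the sum of \<Lambda> over the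
  divisors of k.\<close>

lemma sum_mangoldt_div: "(\<Sum>n=1..N. mangoldt n * real (N div n)) = ln (fact N)"
proof -
  have "ln (fact N) = (\<Sum>k=1..N. ln (real k))"
    by (induction N) (auto simp: ln_mult)
  also have "\<dots> = (\<Sum>k=1..N. \<Sum>d | d dvd k. mangoldt d)"
    by (intro sum.cong refl) (simp add: mangoldt_sum)
  also have "\<dots> = (\<Sum>d=1..N. \<Sum>m=1..N div d. mangoldt d)"
    by (rule sum_divisors_swap[where F = "\<lambda>d m. mangoldt d"])
  finally show ?thesis by (simp add: mult.commute)
qed

text \<open>Chebyshev's argument: 2N div n - 2 (N div n) is never negative and equals 1 for n in (N,
  2N], so the sum is at most the logarithm of the central binomial coefficient, hence at most 2N ln
  2.\<close>

lemma psi_double: "(\<Sum>n=Suc N..2*N. mangoldt n :: real) \<le> 2 * real N * ln 2"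
proof -
  have "(\<Sum>n=Suc N..2*N. mangoldt n :: real) \<le> (\<Sum>n=1..2*N. mangoldt n * (real (2*N div n) - 2 * real (N div n)))"
  proof -
    have nn: "real (2*N div n) - 2 * real (N div n) \<ge> 0" for n
    proof -
      have "2 * (N div n) \<le> 2 * N div n" 
        by (cases "n = 0") (auto simp: less_eq_div_iff_mult_less_eq algebra_simps)
      then show ?thesis by linarith
    qed
    have "real (2*N div n) - 2 * real (N div n) = 1" if "n \<in> {Suc N..2*N}" for n
    proof -
      have "N div n = 0" "2*N div n = 1" using that by (auto simp: div_nat_eqI)
      then show ?thesis by simp
    qed
    then have "(\<Sum>n=Suc N..2*N. mangoldt n :: real) = (\<Sum>n=Suc N..2*N. mangoldt n * (real (2*N div n) - 2 * real (N div n)))"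
      by (intro sum.cong) auto
    also have "\<dots> \<le> (\<Sum>n=1..2*N. mangoldt n * (real (2*N div n) - 2 * real (N div n)))"
      using nn by (intro sum_mono2) (auto simp: mangoldt_nonneg)
    finally show ?thesis .
  qed
  also have "\<dots> = ln (fact (2*N)) - 2 * (\<Sum>n=1..2*N. mangoldt n * real (N div n))"
    unfolding sum_mangoldt_div[symmetric] by (simp add: algebra_simps sum_subtractf sum_distrib_left)
  also have "(\<Sum>n=1..2*N. mangoldt n * real (N div n)) = (\<Sum>n=1..N. mangoldt n * real (N div n))"
    by (intro sum.mono_neutral_right) auto
  also have "\<dots> = ln (fact N)" by (rule sum_mangoldt_div)
  also have "ln (fact (2*N)) - 2 * ln (fact N) = ln (real (2*N choose N))"
    by (simp add: binomial_fact ln_div ln_mult)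
  also have "\<dots> \<le> ln (2 ^ (2*N))"
  proof -
    have "2*N choose N \<le> 2 ^ (2*N)" by (rule binomial_le_pow2)
    then have "real (2*N choose N) \<le> 2 ^ (2*N)" by (metis of_nat_le_iff of_nat_numeral of_nat_power)
    moreover have "2*N choose N > 0" by simp
    ultimately show ?thesis by simp
  qed
  also have "\<dots> = 2 * real N * ln 2" by (simp add: ln_realpow)
  finally show ?thesis .
qed

lemma psi_le: "(\<Sum>n=1..N. mangoldt n :: real) \<le> 3 * real N"
proof (induction N rule: less_induct)
  case (less N)
  show ?case
  proof (cases "N \<le> 1")
    case True
    then have "N = 0 \<or> N = 1" by auto
    then show ?thesis by auto
  next
    case False
    \<comment> \<open>Half of N rounded up, so that 2M reaches N. Since 3M \<le> 2N, the bound 3M +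
      (3/2)M coming from the induction hypothesis and ln 2 \<le> 3/4 is at most 3N.\<close>
    define M where "M = (N + 1) div 2"
    have M: "M < N" "N \<le> 2 * M" "3 * M \<le> 2 * N" using False unfolding M_def by presburger+
    have "(\<Sum>n=1..N. mangoldt n :: real) \<le> (\<Sum>n=1..2*M. mangoldt n)"
      using M by (intro sum_mono2) (auto simp: mangoldt_nonneg)
    also have "\<dots> = (\<Sum>n=1..M. mangoldt n) + (\<Sum>n=Suc M..2*M. mangoldt n)"
      by (subst sum.union_disjoint[symmetric]) (auto intro!: sum.cong)
    also have "\<dots> \<le> 3 * real M + 2 * real M * ln 2"
      using less[OF M(1)] psi_double[of M] by simp
    also have "\<dots> \<le> 3 * real M + 2 * real M * (3/4)"
      using ln_2_less_1 ln2_le_25_over_36 by (intro add_left_mono mult_left_mono) auto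
    also have "\<dots> \<le> 3 * real N" using M(3) by linarith
    finally show ?thesis .
  qed
qed

lemma ln_fact_ge: "ln (fact N) \<ge> real N * ln (real N) - real N"
proof (induction N)
  case (Suc N)
  show ?case
  proof (cases "N = 0")
    case False
    have "ln (1 + 1 / real N) \<le> 1 / real N" by (rule ln_add_one_self_le_self) simp
    moreover have "1 + 1 / real N = real (Suc N) / real N" using False by (simp add: field_simps)
    ultimately have "ln (real (Suc N)) - ln (real N) \<le> 1 / real N" using False by (simp add: ln_div)
    then have "real N * (ln (real (Suc N)) - ln (real N)) \<le> 1" using False by (simp add: field_simps)
    then show ?thesis using Suc by (simp add: ln_mult algebra_simps del: of_nat_Suc) (simp add: algebra_simps)
  qed auto
qed auto

lemma ln_fact_le: "ln (fact N) \<le> real N * ln (real N)"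
proof (cases "N = 0")
  case False
  have "fact N \<le> real (N ^ N)" using fact_le_power[of N, where ?'a = real] by simp
  then have "ln (fact N) \<le> ln (real N ^ N)" using False by (subst ln_le_cancel_iff) auto
  then show ?thesis using False by (simp add: ln_realpow)
qed auto

text \<open>N times the sum is compared with ln N!. Replacing N div n by N / n changes the weighted
  sum of \<Lambda> by at most \<psi>(N) \<le> 3N, and ln N! equals N ln N up to an error of
  N.\<close>

lemma mertens_first:
  assumes "N \<ge> 1"
  shows "ln (real N) - 1 \<le> (\<Sum>n=1..N. mangoldt n / real n)"
    and "(\<Sum>n=1..N. mangoldt n / real n) \<le> ln (real N) + 3"
proof -
  let ?A = "\<Sum>n=1..N. mangoldt n / real n"
  have "ln (fact N) \<le> (\<Sum>n=1..N. mangoldt n * (real N / real n))"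
    unfolding sum_mangoldt_div[symmetric]
    by (intro sum_mono mult_left_mono mangoldt_nonneg real_div_bounds) auto
  also have "\<dots> = real N * ?A" by (simp add: sum_distrib_left mult_ac)
  finally have "real N * (ln (real N) - 1) \<le> real N * ?A"
    using ln_fact_ge[of N] by (simp add: algebra_simps)
  then show "ln (real N) - 1 \<le> ?A" using assms by simp
  have "real N * ?A = (\<Sum>n=1..N. mangoldt n * (real N / real n))" by (simp add: sum_distrib_left mult_ac)
  also have "\<dots> \<le> (\<Sum>n=1..N. mangoldt n * (real (N div n) + 1))"
    by (intro sum_mono mult_left_mono mangoldt_nonneg) (use real_div_bounds(2) in auto)
  also have "\<dots> = ln (fact N) + (\<Sum>n=1..N. mangoldt n)"
    unfolding sum_mangoldt_div[symmetric] by (simp add: algebra_simps sum.distrib)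
  also have "\<dots> \<le> real N * (ln (real N) + 3)"
    using ln_fact_le[of N] psi_le[of N] by (simp add: algebra_simps)
  finally show "?A \<le> ln (real N) + 3" using assms by simp
qed

lemma sum_mangoldt_interval_le:
  assumes "1 \<le> z" "z \<le> y"
  shows "(\<Sum>n\<in>{z<..y}. mangoldt n / real n) \<le> ln (real y) - ln (real z) + 4"
proof -
  have "{1..y} = {1..z} \<union> {z<..y}" using assms by auto
  then have "(\<Sum>n=1..y. mangoldt n / real n) = (\<Sum>n=1..z. mangoldt n / real n) + (\<Sum>n\<in>{z<..y}. mangoldt n / real n)"
    by (simp only:) (rule sum.union_disjoint, auto)
  then show ?thesis using mertens_first[of y] mertens_first[of z] assms by simp
qed

lemma sum_mangoldt_over_ln_le:
  assumes "2 \<le> z" "z \<le> y"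
  shows "(\<Sum>n\<in>{z<..y}. mangoldt n / (real n * ln (real n))) \<le> ln (ln (real y)) - ln (ln (real z)) + 4 / ln (real z)"
proof -
  define A where "A y = (\<Sum>n\<in>{z<..y}. mangoldt n / real n)" for y
  define B where "B y = (\<Sum>n\<in>{z<..y}. mangoldt n / (real n * ln (real n)))" for y
  have aux: "1 - a / b \<le> ln b - ln a" if "0 < a" "a < b" for a b :: real
    using ln_le_minus_one[of "a / b"] that by (simp add: ln_div)
  text \<open>Abel summation in the form of a monotone quantity: compare the discrete increments with those of the primitive
    of \<open>(ln w - ln z + 4) / (w (ln w)\<^sup>2)\<close>.\<close>
  have "B y - A y / ln (real y) \<le> ln (ln (real y)) - ln (ln (real z)) + (4 - ln (real z)) * (1 / ln (real z) - 1 / ln (real y))"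
    using assms(2)
  proof (induction y rule: dec_induct)
    case base
    then show ?case by (simp add: A_def B_def)
  next
    case (step y)
    let ?l = "ln (real y)" and ?l' = "ln (real (Suc y))"
    have l: "0 < ?l" "?l < ?l'" using assms step by auto
    have ins: "{z<..Suc y} = insert (Suc y) {z<..y}" using step by auto
    have AB: "A (Suc y) = A y + mangoldt (Suc y) / real (Suc y)" 
      "B (Suc y) = B y + mangoldt (Suc y) / (real (Suc y) * ?l')"
      unfolding A_def B_def ins by (simp_all add: add.commute)
    have "A y \<le> ?l - ln (real z) + 4"
      unfolding A_def using assms step by (intro sum_mangoldt_interval_le) auto
    then have "A y * (1 / ?l - 1 / ?l') \<le> (?l - ln (real z) + 4) * (1 / ?l - 1 / ?l')"
    proof (rule mult_right_mono)
      have "0 < ?l'" using l by linarith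
      then show "0 \<le> 1 / ?l - 1 / ?l'" using l by (simp add: frac_le)
    qed
    also have "\<dots> = ?l * (1 / ?l - 1 / ?l') + (4 - ln (real z)) * (1 / ?l - 1 / ?l')" by (simp add: algebra_simps)
    also have "?l * (1 / ?l - 1 / ?l') = 1 - ?l / ?l'" using l by (simp add: field_simps)
    also have "\<dots> \<le> ln ?l' - ln ?l"
      by (rule aux[OF l])
    finally have "A y * (1 / ?l - 1 / ?l') \<le> ln ?l' - ln ?l + (4 - ln (real z)) * (1 / ?l - 1 / ?l')" by simp
    moreover have "B (Suc y) - A (Suc y) / ?l' - (B y - A y / ?l) = A y * (1 / ?l - 1 / ?l')"
      unfolding AB by (simp add: add_divide_distrib right_diff_distrib)
    ultimately show ?case using step.IH by (simp add: algebra_simps)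
  qed
  moreover have "A y / ln (real y) \<le> (ln (real y) - ln (real z) + 4) / ln (real y)"
    unfolding A_def using assms by (intro divide_right_mono sum_mangoldt_interval_le) auto
  moreover have "(4 - ln (real z)) * (1 / ln (real z) - 1 / ln (real y)) + (ln (real y) - ln (real z) + 4) / ln (real y)
      = 4 / ln (real z)"
    using assms by (simp add: field_simps)
  ultimately show ?thesis unfolding B_def by linarith
qed

lemma sum_inverse_primes_le:
  assumes "2 \<le> z" "z \<le> y"
  shows "(\<Sum>p | prime p \<and> z < p \<and> p \<le> y. 1 / real p) \<le> ln (ln (real y)) - ln (ln (real z)) + 4 / ln (real z)"
proof -
  have "(\<Sum>p | prime p \<and> z < p \<and> p \<le> y. 1 / real p) = (\<Sum>p | prime p \<and> z < p \<and> p \<le> y. mangoldt p / (real p * ln (real p)))"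
    using prime_gt_1_nat by (intro sum.cong) (auto simp: field_simps)
  also have "\<dots> \<le> (\<Sum>n\<in>{z<..y}. mangoldt n / (real n * ln (real n)))"
    by (intro sum_mono2) (auto simp: mangoldt_nonneg)
  finally show ?thesis using sum_mangoldt_over_ln_le[OF assms] by linarith
qed

lemma sum_ln_primes_le:
  assumes "1 \<le> z" "z \<le> y"
  shows "(\<Sum>p | prime p \<and> z < p \<and> p \<le> y. ln (real p) / real p) \<le> ln (real y) - ln (real z) + 4"
proof -
  have "(\<Sum>p | prime p \<and> z < p \<and> p \<le> y. ln (real p) / real p) = (\<Sum>p | prime p \<and> z < p \<and> p \<le> y. mangoldt p / real p)"
    by (intro sum.cong) auto
  also have "\<dots> \<le> (\<Sum>n\<in>{z<..y}. mangoldt n / real n)"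
    by (intro sum_mono2) (auto simp: mangoldt_nonneg)
  finally show ?thesis using sum_mangoldt_interval_le[OF assms] by linarith
qed

lemma prod_primes_interval_le:
  obtains C :: real where "C \<ge> 1" 
    "\<And>z y. 2 \<le> z \<Longrightarrow> z \<le> y \<Longrightarrow> (\<Prod>p | prime p \<and> z < p \<and> p \<le> y. 1 + 1 / real p) \<le> C * (ln (real y) / ln (real z))"
proof
  show "exp (4 / ln 2) \<ge> (1::real)" by simp
  fix z y :: nat assume zy: "2 \<le> z" "z \<le> y"
  have "(\<Prod>p | prime p \<and> z < p \<and> p \<le> y. 1 + 1 / real p) \<le> (\<Prod>p | prime p \<and> z < p \<and> p \<le> y. exp (1 / real p))"
    by (intro prod_mono) auto
  also have "\<dots> = exp (\<Sum>p | prime p \<and> z < p \<and> p \<le> y. 1 / real p)"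
    by (rule exp_sum[symmetric]) auto
  also have "\<dots> \<le> exp (ln (ln (real y)) - ln (ln (real z)) + 4 / ln 2)"
  proof -
    have "4 / ln (real z) \<le> 4 / ln 2" using zy by (intro divide_left_mono) auto
    then show ?thesis using sum_inverse_primes_le[OF zy] by simp
  qed
  also have "\<dots> = exp (4 / ln 2) * (ln (real y) / ln (real z))"
    using zy by (simp add: exp_add exp_diff)
  finally show "(\<Prod>p | prime p \<and> z < p \<and> p \<le> y. 1 + 1 / real p) \<le> exp (4 / ln 2) * (ln (real y) / ln (real z))" .
qed

text \<open>1/(1 - 1/p) = (1 + 1/p) / (1 - 1/p^2). The factors 1 + 1/p are covered by the previous
  estimate with z = 2, once the prime 2 is split off with its factor 3/2. The others are compared
  with the product over all integers from 2 to y, which telescopes to 2y / (y + 1).\<close>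

lemma prod_primes_le:
  obtains C :: real where "C \<ge> 1" 
    "\<And>y. 2 \<le> y \<Longrightarrow> (\<Prod>p | prime p \<and> p \<le> y. 1 / (1 - 1 / real p)) \<le> C * ln (real y)"
proof -
  obtain C :: real where C: "C \<ge> 1" 
    "\<And>z y. 2 \<le> z \<Longrightarrow> z \<le> y \<Longrightarrow> (\<Prod>p | prime p \<and> z < p \<and> p \<le> y. 1 + 1 / real p) \<le> C * (ln (real y) / ln (real z))"
    using prod_primes_interval_le by metis
  have "(\<Prod>p | prime p \<and> p \<le> y. 1 / (1 - 1 / real p)) \<le> (4 * C / ln 2) * ln (real y)" if y: "2 \<le> y" for y
  proof -
    have aux: "(2 * t / (t + 1)) * ((t + 1) ^ 2 / (t * (t + 2))) = 2 * (t + 1) / (t + 2)" if "t > 0" for t :: real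
      using that by (simp add: divide_simps) (simp add: power2_eq_square algebra_simps)
    let ?P = "{p. prime p \<and> p \<le> y}" and ?Q = "{p. prime p \<and> 2 < p \<and> p \<le> y}"
    have fin: "finite ?P" by simp
    have "(\<Prod>p\<in>?P. 1 / (1 - 1 / real p)) = (\<Prod>p\<in>?P. (1 + 1 / real p) * (1 / (1 - 1 / real p ^ 2)))"
    proof (intro prod.cong refl)
      fix p assume "p \<in> ?P"
      then have "real p > 1" using prime_gt_1_nat by auto
      moreover have "1 - 1 / real p ^ 2 = (1 + 1 / real p) * (1 - 1 / real p)" by (simp add: power2_eq_square algebra_simps)
      moreover have "1 + 1 / real p \<noteq> 0" using calculation(1) by (simp add: field_simps)
      ultimately show "1 / (1 - 1 / real p) = (1 + 1 / real p) * (1 / (1 - 1 / real p ^ 2))" by simp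
    qed
    also have "\<dots> = (\<Prod>p\<in>?P. 1 + 1 / real p) * (\<Prod>p\<in>?P. 1 / (1 - 1 / real p ^ 2))" by (rule prod.distrib)
    finally have e1: "(\<Prod>p\<in>?P. 1 / (1 - 1 / real p)) = (\<Prod>p\<in>?P. 1 + 1 / real p) * (\<Prod>p\<in>?P. 1 / (1 - 1 / real p ^ 2))" .
    have "?P = insert 2 ?Q"
    proof (intro set_eqI iffI)
      fix p assume "p \<in> ?P"
      then show "p \<in> insert 2 ?Q" using prime_ge_2_nat[of p] by (cases "p = 2") auto
    qed (use y in auto)
    then have e2: "(\<Prod>p\<in>?P. 1 + 1 / real p) = (3/2) * (\<Prod>p\<in>?Q. 1 + 1 / real p)" by simp
    have "(\<Prod>p\<in>?P. 1 / (1 - 1 / real p ^ 2)) \<le> (\<Prod>n\<in>{2..y}. 1 / (1 - 1 / real n ^ 2))"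
    proof (rule prod_mono2)
      show "?P \<subseteq> {2..y}" using prime_ge_2_nat by auto
      have *: "1 / real n ^ 2 < 1 " if "n \<ge> 2" for n
        using that by (simp add: power2_eq_square less_1_mult)
      show "1 \<le> 1 / (1 - 1 / real n ^ 2)" if "n \<in> {2..y} - ?P" for n
        using *[of n] that by simp
      show "0 \<le> 1 / (1 - 1 / real n ^ 2)" if "n \<in> ?P" for n
        using *[of n] that prime_ge_2_nat[of n] by simp
    qed auto
    also have "(\<Prod>n\<in>{2..y}. 1 / (1 - 1 / real n ^ 2)) = 2 * real y / (real y + 1)"
      using y
    proof (induction y rule: dec_induct)
      case (step n)
      have "(\<Prod>n\<in>{2..Suc n}. 1 / (1 - 1 / real n ^ 2)) = (2 * real n / (real n + 1)) * (1 / (1 - 1 / (real n + 1) ^ 2))"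
        using step by (simp add: add.commute)
      also have "1 / (1 - 1 / (real n + 1) ^ 2) = (real n + 1) ^ 2 / (real n * (real n + 2))"
      proof -
        have "1 - 1 / (real n + 1) ^ 2 = (real n * (real n + 2)) / (real n + 1) ^ 2"
          by (simp add: diff_divide_eq_iff) (simp add: power2_eq_square algebra_simps)
        then show ?thesis by simp
      qed
      also have "(2 * real n / (real n + 1)) * \<dots> = 2 * (real n + 1) / (real n + 2)"
        using aux[of "real n"] step by simp
      finally show ?case by (simp add: add.commute)
    qed (simp add: power2_eq_square)
    also have "\<dots> \<le> 2" by (simp add: field_simps)
    finally have e3: "(\<Prod>p\<in>?P. 1 / (1 - 1 / real p ^ 2)) \<le> 2" .
    have e4: "(\<Prod>p\<in>?Q. 1 + 1 / real p) \<le> C * (ln (real y) / ln 2)" using C(2)[of 2 y] y by simp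
    have "(\<Prod>p\<in>?P. 1 / (1 - 1 / real p)) \<le> (3/2 * (C * (ln (real y) / ln 2))) * 2"
      unfolding e1 e2
      by (rule order.trans[OF mult_left_mono[OF e3] mult_right_mono[OF mult_left_mono[OF e4]]])
         (auto intro!: mult_nonneg_nonneg prod_nonneg)
    also have "\<dots> \<le> 4 * C / ln 2 * ln (real y)" using C y by (simp add: field_simps)
    finally show ?thesis .
  qed
  moreover have "4 * C / ln 2 \<ge> 1" using C(1) ln_2_less_1 by (simp add: field_simps)
  ultimately show ?thesis using that by blast
qed

section \<open>The zeta function to the right of its line of convergence\<close>

text \<open>Up to the sign \<open>(-1)\<^sup>j\<close>, \<open>zser j s\<close> below is the \<open>j\<close>-th derivative of \<open>\<zeta>\<close> at \<open>1 + s\<close>. For \<open>j \<le> 2\<close>, \<open>zprim j s\<close>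
  is the primitive of \<open>zfun j s\<close> vanishing at infinity, so that \<open>zdiff\<close> compares the sum with the integral. The
  exponent \<open>1/56\<close> in \<open>zweight\<close> and in the estimates based on it is a small number chosen so that the accumulated
  losses in \<open>norm_mtrans_le\<close> amount to the exponent \<open>14/56 = 1/4\<close>.\<close>
definition zfun :: "nat \<Rightarrow> complex \<Rightarrow> real \<Rightarrow> complex" where
  "zfun j s x = of_real (ln x) ^ j * exp (- ((1 + s) * of_real (ln x)))"

definition zprim :: "nat \<Rightarrow> complex \<Rightarrow> real \<Rightarrow> complex" where
  "zprim j s x = - exp (- (s * of_real (ln x))) *
     (if j = 0 then 1 / s else if j = 1 then of_real (ln x) / s + 1 / s\<^sup>2
      else of_real (ln x) ^ 2 / s + 2 * of_real (ln x) / s\<^sup>2 + 2 / s ^ 3)"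

definition zdiff :: "nat \<Rightarrow> complex \<Rightarrow> nat \<Rightarrow> complex" where
  "zdiff j s n = zfun j s n - (zprim j s (real n + 1) - zprim j s n)"

definition zweight :: "nat \<Rightarrow> real" where
  "zweight n = 2 * (1 + ln (real n + 1))\<^sup>2 * real n powr (- (57/56))"

lemma norm_zfun: "x > 0 \<Longrightarrow> norm (zfun j s x) = \<bar>ln x\<bar> ^ j * x powr (- (1 + Re s))"
  by (simp add: zfun_def norm_mult norm_power powr_def algebra_simps)

lemma zprim_has_vector_derivative:
  assumes "s \<noteq> 0" "x > 0" "j \<le> 2"
  shows "(zprim j s has_vector_derivative zfun j s x) (at x within S)"
proof -
  define G where "G l = - exp (- (s * l)) * (if j = 0 then 1 / s else if j = 1 then l / s + 1 / s\<^sup>2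
      else l ^ 2 / s + 2 * l / s\<^sup>2 + 2 / s ^ 3)" for l :: complex
  have j: "j = 0 \<or> j = 1 \<or> j = 2" using assms by auto
  have G: "(G has_field_derivative l ^ j * exp (- (s * l))) (at l)" for l
  proof -
    have aux: "((\<lambda>l. - exp (- (s * l)) * q l) has_field_derivative l ^ j * exp (- (s * l))) (at l)"
      if "(q has_field_derivative q') (at l)" "s * q l - q' = l ^ j" for q q'
      unfolding that(2)[symmetric]
      by (auto intro!: derivative_eq_intros that(1) simp: algebra_simps)
    have "((\<lambda>l. - exp (- (s * l)) * (1 / s)) has_field_derivative l ^ j * exp (- (s * l))) (at l)" if "j = 0"
      by (rule aux[of _ 0]) (use that assms in \<open>auto intro!: derivative_eq_intros\<close>)
    moreover have "((\<lambda>l. - exp (- (s * l)) * (l / s + 1 / s\<^sup>2)) has_field_derivative l ^ j * exp (- (s * l))) (at l)" if "j = 1"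
      by (rule aux[of _ "1 / s"]) (use that assms in \<open>auto intro!: derivative_eq_intros simp: field_simps power2_eq_square\<close>)
    moreover have "((\<lambda>l. - exp (- (s * l)) * (l ^ 2 / s + 2 * l / s\<^sup>2 + 2 / s ^ 3)) has_field_derivative l ^ j * exp (- (s * l))) (at l)" if "j = 2"
    proof (rule aux[of _ "2 * l / s + 2 / s\<^sup>2"])
      show "((\<lambda>l. l\<^sup>2 / s + 2 * l / s\<^sup>2 + 2 / s ^ 3) has_field_derivative 2 * l / s + 2 / s\<^sup>2) (at l)"
        using assms(1) by (auto intro!: derivative_eq_intros simp: field_simps power2_eq_square)
      show "s * (l\<^sup>2 / s + 2 * l / s\<^sup>2 + 2 / s ^ 3) - (2 * l / s + 2 / s\<^sup>2) = l ^ j"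
        using that assms(1) by (simp add: field_simps power2_eq_square power3_eq_cube)
    qed
    ultimately show ?thesis using j unfolding G_def by auto
  qed
  have "((\<lambda>x. of_real (ln x)) has_vector_derivative of_real (1 / x)) (at x within S)"
    using assms by (intro has_vector_derivative_of_real) 
      (auto intro!: derivative_eq_intros simp: has_real_derivative_iff_has_vector_derivative[symmetric])
  then have "(G \<circ> (\<lambda>x. of_real (ln x)) has_vector_derivative of_real (1 / x) * (of_real (ln x) ^ j * exp (- (s * of_real (ln x))))) (at x within S)"
    by (rule field_vector_diff_chain_within) (intro has_field_derivative_at_within[OF G])
  moreover have "exp (- ((1 + s) * of_real (ln x))) = of_real (1 / x) * exp (- (s * of_real (ln x)))"
  proof -
    have "exp (- ((1 + s) * of_real (ln x))) = exp (- of_real (ln x)) * exp (- (s * of_real (ln x)))"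
      by (simp add: exp_add[symmetric] algebra_simps)
    also have "exp (- of_real (ln x) :: complex) = of_real (1 / x)"
      using assms by (simp add: exp_minus exp_of_real inverse_eq_divide)
    finally show ?thesis .
  qed
  moreover have "G \<circ> (\<lambda>x. of_real (ln x)) = zprim j s"
    by (simp add: fun_eq_iff zprim_def G_def)
  ultimately show ?thesis by (simp add: zfun_def mult_ac)
qed

lemma norm_zfun_le:
  assumes "0 < Re s" "1 \<le> n" "real n \<le> x" "x \<le> real n + 1" "j \<le> 2"
  shows "norm (zfun j s x) \<le> (1 + ln (real n + 1))\<^sup>2 / real n"
proof -
  have x: "1 \<le> x" using assms by linarith
  have "\<bar>ln x\<bar> ^ j \<le> (1 + ln (real n + 1)) ^ j"
  proof (rule power_mono)
    have "ln x \<le> ln (real n + 1)" using x assms by simp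
    moreover have "0 \<le> ln x" using x by simp
    ultimately show "\<bar>ln x\<bar> \<le> 1 + ln (real n + 1)" by linarith
  qed simp
  also have "\<dots> \<le> (1 + ln (real n + 1)) ^ 2"
    using assms by (intro power_increasing) auto
  finally have 1: "\<bar>ln x\<bar> ^ j \<le> (1 + ln (real n + 1))\<^sup>2" .
  have "x powr (- (1 + Re s)) \<le> x powr (-1)" using x assms by (intro powr_mono) auto
  also have "\<dots> \<le> 1 / real n" using x assms by (simp add: powr_minus_divide frac_le)
  finally have "\<bar>ln x\<bar> ^ j * x powr (- (1 + Re s)) \<le> (1 + ln (real n + 1))\<^sup>2 * (1 / real n)"
    using 1 by (intro mult_mono) auto
  then show ?thesis using x by (simp add: norm_zfun)
qed

text \<open>The mean value theorem is applied in the variable l = ln x: there the step has length at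
  most 1/n, and the derivative of l^j e^(-(1+s)l) is at most (2 + |1 + s|) L^2 / n with L = 1 + ln
  (n + 1).\<close>

lemma zfun_diff_le:
  assumes "0 < Re s" "1 \<le> n" "real n \<le> x" "x \<le> real n + 1" "j \<le> 2"
  shows "norm (zfun j s x - zfun j s n) \<le> (3 + norm s) * (1 + ln (real n + 1))\<^sup>2 / (real n)\<^sup>2"
proof -
  let ?L = "1 + ln (real n + 1)"
  define F where "F l = l ^ j * exp (- ((1 + s) * l))" for l :: complex
  define F' where "F' l = (of_nat j * l ^ (j - 1) - (1 + s) * l ^ j) * exp (- ((1 + s) * l))" for l :: complex
  have x: "1 \<le> x" using assms by linarith
  have e1: "norm (F (of_real (ln x)) - F (of_real (ln n))) \<le> ((3 + norm s) * ?L\<^sup>2 / real n) * norm (of_real (ln x) - of_real (ln n) :: complex)"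
  proof (rule field_differentiable_bound)
    show "convex (of_real ` {ln (real n)..ln x} :: complex set)"
      by (intro convex_linear_image) (auto simp: linear_iff scaleR_conv_of_real)
    show "(F has_field_derivative F' z) (at z within of_real ` {ln (real n)..ln x})" for z
      unfolding F_def F'_def by (auto intro!: derivative_eq_intros simp: algebra_simps)
    show "norm (F' z) \<le> (3 + norm s) * ?L\<^sup>2 / real n" if z: "z \<in> of_real ` {ln (real n)..ln x}" for z
    proof -
      obtain l where l: "z = of_real l" "ln (real n) \<le> l" "l \<le> ln x" using z by auto
      have "0 \<le> ln (real n)" using assms by simp
      then have l0: "0 \<le> l" using l by linarith
      have "ln x \<le> ln (real n + 1)" using x assms by simp
      then have lL: "l \<le> ?L" using l by linarith
      have L1: "?L \<ge> 1" using assms by simp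
      have pw: "l ^ i \<le> ?L\<^sup>2" if "i \<le> 2" for i
      proof -
        have "l ^ i \<le> ?L ^ i" using l0 lL by (intro power_mono) auto
        also have "\<dots> \<le> ?L ^ 2" using that L1 by (intro power_increasing) auto
        finally show ?thesis .
      qed
      have "norm (of_nat j * z ^ (j - 1) - (1 + s) * z ^ j) \<le> real j * l ^ (j - 1) + norm (1 + s) * l ^ j"
        unfolding l(1) by (rule order.trans[OF norm_triangle_ineq4]) (use l0 in \<open>simp add: norm_mult norm_power\<close>)
      also have "\<dots> \<le> 2 * ?L\<^sup>2 + (1 + norm s) * ?L\<^sup>2"
        using assms l0 pw[of j] pw[of "j - 1"] norm_triangle_ineq[of 1 s]
        by (intro add_mono mult_mono) auto
      finally have a: "norm (of_nat j * z ^ (j - 1) - (1 + s) * z ^ j) \<le> (3 + norm s) * ?L\<^sup>2" by (simp add: algebra_simps)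
      have "(1 + Re s) * l \<ge> 1 * l" using assms l0 by (intro mult_right_mono) auto
      then have "exp (- ((1 + Re s) * l)) \<le> exp (- l)" by simp
      also have "\<dots> \<le> exp (- ln (real n))" using l by simp
      also have "\<dots> = 1 / real n" using assms by (simp add: exp_minus inverse_eq_divide)
      finally have b: "norm (exp (- ((1 + s) * z))) \<le> 1 / real n" unfolding l(1) by simp
      show ?thesis unfolding F'_def norm_mult using mult_mono[OF a b] by simp
    qed
  qed (use x assms in auto)
  have e2: "norm (of_real (ln x) - of_real (ln n) :: complex) \<le> 1 / real n"
  proof -
    have "ln x - ln n \<le> (x - n) / n" using x assms by (intro ln_diff_le) auto
    also have "\<dots> \<le> 1 / real n" using assms by (intro divide_right_mono) auto
    finally have "ln x - ln n \<le> 1 / real n" .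
    moreover have "ln x \<ge> ln n" using x assms by simp
    ultimately show ?thesis unfolding of_real_diff[symmetric] norm_of_real by simp
  qed
  have "norm (F (of_real (ln x)) - F (of_real (ln n))) \<le> ((3 + norm s) * ?L\<^sup>2 / real n) * (1 / real n)"
    by (rule order.trans[OF e1 mult_left_mono[OF e2]]) (auto intro!: divide_nonneg_nonneg mult_nonneg_nonneg)
  then show ?thesis by (simp add: zfun_def F_def power2_eq_square)
qed

text \<open>Interpolation between two bounds, with T = 3 + |s| and L as before: the triangle
  inequality gives 2 L^2 / n, the mean value theorem T L^2 / n^2. Since min(1, T/n) \<le>
  (T/n)^(1/56), both are at most a summable weight times T^(1/56). The small exponent buys
  convergence in n and keeps the growth in s negligible.\<close>

lemma zdiff_le:
  assumes "0 < Re s" "1 \<le> n" "j \<le> 2"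
  shows "norm (zdiff j s n) \<le> zweight n * (3 + norm s) powr (1/56)"
proof -
  let ?L = "1 + ln (real n + 1)" and ?T = "3 + norm s"
  have s: "s \<noteq> 0" using assms by auto
  \<comment> \<open>The increment of \<open>zprim\<close> over a unit step is the integral of
    \<open>zfun\<close>, so \<open>zdiff\<close> is at most the oscillation of \<open>zfun\<close>
    over that step.\<close>
  have lin: "norm (zdiff j s n) \<le> B" 
    if B: "\<And>x. x \<in> {real n..real n + 1} \<Longrightarrow> norm (zfun j s x - zfun j s n) \<le> B" for B
  proof -
    have "norm (zprim j s (real n + 1) - zprim j s n - (real n + 1 - real n) *\<^sub>R zfun j s n) \<le> norm (real n + 1 - real n) * B"
    proof (rule vector_differentiable_bound_linearization[where S = "{real n..real n + 1}"])
      show "(zprim j s has_vector_derivative zfun j s x) (at x within {real n..real n + 1})"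
        if "x \<in> {real n..real n + 1}" for x
        using that assms s by (intro zprim_has_vector_derivative) auto
    qed (use B in \<open>auto simp: closed_segment_eq_real_ivl\<close>)
    then show ?thesis unfolding zdiff_def by (simp add: norm_minus_commute)
  qed
  have w: "zweight n * ?T powr (1/56) = 2 * ?L\<^sup>2 / real n * (?T powr (1/56) / real n powr (1/56))"
  proof -
    have "real n powr (- (57/56)) = real n powr (-1 + - (1/56))" by simp
    also have "\<dots> = 1 / real n * (1 / real n powr (1/56))"
      unfolding powr_add using assms by (simp add: powr_minus_divide)
    finally show ?thesis by (simp add: zweight_def)
  qed
  show ?thesis
  proof (cases "real n \<le> ?T")
    case True
    have "norm (zdiff j s n) \<le> 2 * ?L\<^sup>2 / real n"
    proof (rule lin)
      fix x assume x: "x \<in> {real n..real n + 1}"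
      have "norm (zfun j s x - zfun j s n) \<le> norm (zfun j s x) + norm (zfun j s n)" by (rule norm_triangle_ineq4)
      also have "\<dots> \<le> ?L\<^sup>2 / real n + ?L\<^sup>2 / real n"
        using x assms by (intro add_mono norm_zfun_le) auto
      finally show "norm (zfun j s x - zfun j s n) \<le> 2 * ?L\<^sup>2 / real n" by simp
    qed
    also have "\<dots> * 1 \<le> 2 * ?L\<^sup>2 / real n * (?T powr (1/56) / real n powr (1/56))"
      using True assms by (intro mult_left_mono) (auto intro!: powr_mono2)
    finally show ?thesis unfolding w by simp
  next
    case False
    have T: "?T > 0" by (simp add: add_pos_nonneg)
    have "norm (zdiff j s n) \<le> ?T * ?L\<^sup>2 / (real n)\<^sup>2"
      by (rule lin) (use assms in \<open>auto intro!: zfun_diff_le\<close>)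
    also have "\<dots> = ?L\<^sup>2 / real n * (?T / real n)" by (simp add: power2_eq_square)
    also have "\<dots> \<le> 2 * ?L\<^sup>2 / real n * (?T powr (1/56) / real n powr (1/56))"
    proof (rule mult_mono)
      have "(?T / real n) powr 1 \<le> (?T / real n) powr (1/56)"
        using False assms T by (intro powr_mono') auto
      then show "?T / real n \<le> ?T powr (1/56) / real n powr (1/56)" 
        using T assms by (simp add: powr_divide)
    qed (use T in \<open>auto intro!: divide_right_mono\<close>)
    finally show ?thesis unfolding w by simp
  qed
qed

lemma summable_on_from_1I:
  fixes f :: "nat \<Rightarrow> real"
  assumes "summable f" "\<And>n. f n \<ge> 0"
  shows "f summable_on {1..}"
  by (rule summable_on_subset_banach[OF summable_nonneg_imp_summable_on[OF assms]]) auto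

lemma summable_zweight: "summable zweight"
proof (rule summable_comparison_test_bigo)
  show "zweight \<in> O(\<lambda>n. real n powr (- (113/112)))"
    unfolding zweight_def by real_asymp
  show "summable (\<lambda>n. norm (real n powr (- (113/112))))"
    using summable_real_powr_iff[of "- (113/112)"] by simp
qed

lemma zweight_nonneg: "zweight n \<ge> 0" by (simp add: zweight_def)

lemma summable_zfun: 
  assumes "0 < Re s"
  shows "summable (\<lambda>n. norm (zfun j s (real n)))"
proof -
  define a where "a = Re s / 2"
  have a: "a > 0" using assms by (simp add: a_def)
  have "summable (\<lambda>n. ln (real n) ^ j * real n powr (- (1 + 2 * a)))"
  proof (rule summable_comparison_test_bigo)
    show "(\<lambda>n. ln (real n) ^ j * real n powr (- (1 + 2 * a))) \<in> O(\<lambda>n. real n powr (- (1 + a)))"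
      using a by real_asymp
    show "summable (\<lambda>n. norm (real n powr (- (1 + a))))"
      using summable_real_powr_iff[of "- (1 + a)"] a by simp
  qed
  moreover have "norm (zfun j s (real n)) = ln (real n) ^ j * real n powr (- (1 + 2 * a))" if "n \<ge> 1" for n
    using that by (simp add: norm_zfun a_def)
  ultimately show ?thesis
    by (subst summable_cong[OF eventually_sequentiallyI[of 1]]) auto
qed

definition zser :: "nat \<Rightarrow> complex \<Rightarrow> complex" where
  "zser j s = infsum (\<lambda>n. zfun j s (real n)) {1..}"

definition zerr :: "nat \<Rightarrow> complex \<Rightarrow> complex" where
  "zerr j s = infsum (zdiff j s) {1..}"

definition zbound :: real where
  "zbound = infsum zweight {1..}"

lemma zfun_summable_on: "0 < Re s \<Longrightarrow> (\<lambda>n. norm (zfun j s (real n))) summable_on {1..}"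
  using summable_zfun by (intro summable_on_from_1I) auto

lemma zdiff_summable_on:
  assumes "0 < Re s" "j \<le> 2"
  shows "(\<lambda>n. norm (zdiff j s n)) summable_on {1..}"
proof (rule Infinite_Sum.abs_summable_on_comparison_test')
  show "(\<lambda>n. zweight n * (3 + norm s) powr (1/56)) summable_on {1..}"
    using summable_zweight zweight_nonneg by (intro summable_on_cmult_left summable_on_from_1I) auto
qed (use assms zdiff_le in auto)

lemma norm_zerr_le:
  assumes "0 < Re s" "j \<le> 2"
  shows "norm (zerr j s) \<le> zbound * (3 + norm s) powr (1/56)"
proof (rule norm_infsum_le)
  show "(zdiff j s has_sum zerr j s) {1..}"
    unfolding zerr_def by (rule has_sum_infsum[OF abs_summable_summable[OF zdiff_summable_on[OF assms]]])
  show "((\<lambda>n. zweight n * (3 + norm s) powr (1/56)) has_sum zbound * (3 + norm s) powr (1/56)) {1..}"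
    unfolding zbound_def using summable_zweight zweight_nonneg 
    by (intro has_sum_cmult_left has_sum_infsum summable_on_from_1I) auto
qed (use assms zdiff_le in auto)

lemma zbound_ge_1: "zbound \<ge> 1"
proof -
  have "1 \<le> (1 + ln (2::real))\<^sup>2" by (rule one_le_power) simp
  moreover have "sum zweight {1} = 2 * (1 + ln 2)\<^sup>2" by (simp add: zweight_def)
  ultimately have "1 \<le> sum zweight {1}" by linarith
  also have "\<dots> \<le> zbound" unfolding zbound_def
    using summable_zweight zweight_nonneg by (intro finite_sum_le_infsum summable_on_from_1I) auto
  finally show ?thesis .
qed

text \<open>The increments of \<open>zprim\<close> telescope and \<open>zprim\<close> vanishes at
  infinity, so the integral part collapses to \<open>- zprim j s 1\<close>. This is the pole: 1/s,
  1/s^2 and 2/s^3 for j = 0, 1, 2. The remainder \<open>zerr\<close> is bounded uniformly as Re s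
  tends to 0.\<close>

lemma zser_eq:
  assumes s: "0 < Re s" and j: "j \<le> 2"
  shows "zser j s = - zprim j s 1 + zerr j s"
proof -
  have sn0: "s \<noteq> 0" using s by auto
  let ?p = "\<lambda>n::nat. zprim j s (real n + 1)"
  have "(zprim j s \<longlongrightarrow> 0) at_top"
  proof -
    define h where "h = (\<lambda>l. exp (- (Re s * l)) * (if j = 0 then 1 / norm s else if j = 1 then l / norm s + 1 / norm s ^ 2
      else l ^ 2 / norm s + 2 * l / norm s ^ 2 + 2 / norm s ^ 3))"
    have "((\<lambda>l. exp (- (a * l)) * (if j = 0 then 1 / b else if j = 1 then l / b + 1 / b ^ 2
      else l ^ 2 / b + 2 * l / b ^ 2 + 2 / b ^ 3)) \<longlongrightarrow> 0) at_top" if ab: "a > 0" "b > 0" for a b :: real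
    proof -
      have "((\<lambda>l. exp (- (a * l)) * (1 / b)) \<longlongrightarrow> 0) at_top" using ab by real_asymp
      moreover have "((\<lambda>l. exp (- (a * l)) * (l / b + 1 / b ^ 2)) \<longlongrightarrow> 0) at_top" using ab by real_asymp
      moreover have "((\<lambda>l. exp (- (a * l)) * (l ^ 2 / b + 2 * l / b ^ 2 + 2 / b ^ 3)) \<longlongrightarrow> 0) at_top" using ab by real_asymp
      ultimately show ?thesis by (cases "j = 0"; cases "j = 1"; simp)
    qed
    from this[of "Re s" "norm s"] s sn0 have "(h \<longlongrightarrow> 0) at_top" unfolding h_def by simp
    then have h: "((\<lambda>x. h (ln x)) \<longlongrightarrow> 0) at_top" using ln_at_top by (rule filterlim_compose)
    have "norm (zprim j s x) \<le> h (ln x)" if "x \<ge> 1" for x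
    proof -
      have l: "ln x \<ge> 0" using that by simp
      have "norm (if j = 0 then 1 / s else if j = 1 then of_real (ln x) / s + 1 / s\<^sup>2
        else of_real (ln x) ^ 2 / s + 2 * of_real (ln x) / s\<^sup>2 + 2 / s ^ 3) \<le> 
        (if j = 0 then 1 / norm s else if j = 1 then ln x / norm s + 1 / norm s ^ 2
        else ln x ^ 2 / norm s + 2 * ln x / norm s ^ 2 + 2 / norm s ^ 3)"
        using l by (auto intro!: norm_triangle_le add_mono simp: norm_divide norm_power norm_mult)
      then show ?thesis unfolding zprim_def h_def norm_mult norm_minus_cancel
        by (intro mult_mono) (auto simp: )
    qed
    then show ?thesis
      by (intro Lim_null_comparison[OF _ h] eventually_at_top_linorderI[of 1]) auto
  qed
  then have lim: "?p \<longlonglongrightarrow> 0"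
    by (rule filterlim_compose) real_asymp
  have "(\<lambda>n. ?p (Suc n) - ?p n) sums (0 - ?p 0)"
    by (rule telescope_sums[OF lim])
  then have tel: "(\<lambda>n. zprim j s (real (Suc n) + 1) - zprim j s (real (Suc n))) sums (- zprim j s 1)"
    by (simp add: add_ac)
  have zf: "((\<lambda>n. zfun j s (real n)) has_sum zser j s) {1..}"
    unfolding zser_def by (rule has_sum_infsum[OF abs_summable_summable[OF zfun_summable_on[OF s]]])
  have zd: "(zdiff j s has_sum zerr j s) {1..}"
    unfolding zerr_def by (rule has_sum_infsum[OF abs_summable_summable[OF zdiff_summable_on[OF s j]]])
  have "((\<lambda>n. zfun j s (real n) + - zdiff j s n) has_sum (zser j s + - zerr j s)) {1..}"
    by (intro has_sum_add zf) (use zd in \<open>simp add: has_sum_uminus\<close>)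
  then have "((\<lambda>n. zprim j s (real n + 1) - zprim j s (real n)) has_sum (zser j s - zerr j s)) {1..}"
    by (simp add: zdiff_def)
  then have "((\<lambda>n. zprim j s (real (Suc n) + 1) - zprim j s (real (Suc n))) has_sum (zser j s - zerr j s)) UNIV"
    by (subst has_sum_reindex_bij_betw[of Suc UNIV "{1..}", where f = "\<lambda>n. zprim j s (real n + 1) - zprim j s (real n)"])
       (auto simp: bij_betw_def image_iff Suc_le_eq gr0_conv_Suc)
  then have "(\<lambda>n. zprim j s (real (Suc n) + 1) - zprim j s (real (Suc n))) sums (zser j s - zerr j s)"
    by (rule has_sum_imp_sums)
  with tel have "zser j s - zerr j s = - zprim j s 1" by (rule sums_unique2[symmetric])
  then show ?thesis by (simp add: algebra_simps)
qed

section \<open>The Euler product and lower bounds for \<zeta> to the right of its line\<close>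

lemma tendsto_infsum_smooth:
  fixes f :: "nat \<Rightarrow> 'a::banach"
  assumes "(\<lambda>n. norm (f n)) summable_on {1..}"
  shows "(\<lambda>N. infsum f (smooth N)) \<longlonglongrightarrow> infsum f {1..}"
proof -
  let ?g = "\<lambda>n. norm (f n)"
  have f: "f summable_on {1..}" by (rule abs_summable_summable[OF assms])
  \<comment> \<open>\<open>smooth N\<close> contains {1..N}, so what it misses is at most a tail of
    the absolutely convergent series.\<close>
  have bound: "norm (infsum f (smooth N) - infsum f {1..}) \<le> infsum ?g {1..} - (\<Sum>n=1..N. ?g n)" for N
  proof -
    have sub: "smooth N \<subseteq> {1..}" "{1..N} \<subseteq> smooth N"
      by (auto simp: smooth_def Suc_le_eq dest: dvd_imp_le)
    have eq: "infsum f {1..} = infsum f (smooth N) + infsum f ({1..} - smooth N)"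
    proof -
      have "f summable_on smooth N" "f summable_on ({1..} - smooth N)"
        by (rule summable_on_subset_banach[OF f]; use sub in blast)+
      then have "infsum f (smooth N \<union> ({1..} - smooth N)) = infsum f (smooth N) + infsum f ({1..} - smooth N)"
        by (intro infsum_Un_disjoint) auto
      moreover have "smooth N \<union> ({1..} - smooth N) = {1..}" using sub by blast
      ultimately show ?thesis by simp
    qed
    have s2: "?g summable_on ({1..} - smooth N)" "?g summable_on ({1..} - {1..N})" "?g summable_on {1..N}"
      using sub by (auto intro: summable_on_subset_banach[OF assms])
    have "norm (infsum f ({1..} - smooth N)) \<le> infsum ?g ({1..} - smooth N)"
      by (rule norm_infsum_bound) (use s2 in simp)
    also have "\<dots> \<le> infsum ?g ({1..} - {1..N})"
      using sub s2 by (intro infsum_mono_neutral) auto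
    also have "\<dots> = infsum ?g {1..} - infsum ?g {1..N}"
      using s2 assms by (subst infsum_Diff) auto
    finally show ?thesis unfolding eq by simp
  qed
  have "((\<lambda>N. \<Sum>n=1..N. ?g n) \<longlonglongrightarrow> infsum ?g {1..})"
  proof -
    have "((\<lambda>n. ?g (Suc n)) has_sum infsum ?g {1..}) UNIV"
      by (subst has_sum_reindex_bij_betw[of Suc UNIV "{1..}", where f = ?g])
         (use assms in \<open>auto simp: bij_betw_def image_iff Suc_le_eq gr0_conv_Suc\<close>)
    then have "(\<lambda>n. ?g (Suc n)) sums infsum ?g {1..}" by (rule has_sum_imp_sums)
    then show ?thesis unfolding sums_def
      by (simp add: sum.atLeast1_atMost_eq lessThan_Suc_atMost[symmetric] atLeast0LessThan)
  qed
  then have "(\<lambda>N. infsum ?g {1..} - (\<Sum>n=1..N. ?g n)) \<longlonglongrightarrow> infsum ?g {1..} - infsum ?g {1..}"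
    by (intro tendsto_diff tendsto_const)
  then have lim: "(\<lambda>N. infsum ?g {1..} - (\<Sum>n=1..N. ?g n)) \<longlonglongrightarrow> 0" by (simp only: diff_self)
  have "(\<lambda>N. infsum f (smooth N) - infsum f {1..}) \<longlonglongrightarrow> 0"
    by (rule Lim_null_comparison[OF always_eventually[OF allI] lim]) (rule bound)
  then show ?thesis by (rule LIM_zero_cancel)
qed

text \<open>In logarithms: - ln |1 - r v| is the sum of r^n Re(v^n) / n, and with c = Re(u^n) the
  combination 3 + 4c + Re(u^(2n)) equals 2 (1 + c)^2.\<close>

lemma euler_factor_341:
  fixes r :: real and u :: complex
  assumes "0 \<le> r" "r < 1" "norm u = 1"
  shows "1 \<le> norm (1 / (1 - of_real r :: complex)) ^ 3 * norm (1 / (1 - of_real r * u)) ^ 4 * norm (1 / (1 - of_real r * u\<^sup>2))"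
proof -
  have log: "(\<lambda>n. r ^ n * Re (v ^ n) / n) sums (- ln (norm (1 - of_real r * v)))" if "norm v = 1" for v :: complex
  proof -
    have n: "norm (- (of_real r * v)) < 1" using that assms by (simp add: norm_mult)
    have ne: "1 - of_real r * v \<noteq> 0" using n by auto
    have "(\<lambda>n. - ((of_real r * v) ^ n) / of_nat n) sums ln (1 - of_real r * v)"
      using Ln_series'[OF n] by simp
    then have "(\<lambda>n. Re (- ((of_real r * v) ^ n) / of_nat n)) sums Re (ln (1 - of_real r * v))"
      by (rule sums_Re)
    then have "(\<lambda>n. - Re (- ((of_real r * v) ^ n) / of_nat n)) sums - ln (norm (1 - of_real r * v))"
      using ne by (intro sums_minus) (simp add: Re_Ln)
    then show ?thesis by (simp add: power_mult_distrib Re_divide_of_nat flip: of_real_power)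
  qed
  have sm: "(\<lambda>n. 3 * (r ^ n * Re (1 ^ n) / n) + 4 * (r ^ n * Re (u ^ n) / n) + r ^ n * Re ((u\<^sup>2) ^ n) / n) sums
     (3 * (- ln (norm (1 - of_real r * (1::complex)))) + 4 * (- ln (norm (1 - of_real r * u))) + - ln (norm (1 - of_real r * u\<^sup>2)))"
    using assms by (intro sums_add sums_mult log) (auto simp: norm_power)
  have nn: "0 \<le> 3 * (r ^ n * Re (1 ^ n) / n) + 4 * (r ^ n * Re (u ^ n) / n) + r ^ n * Re ((u\<^sup>2) ^ n) / n" for n
  proof -
    define c where "c = Re (u ^ n)"
    have "norm (u ^ n) = 1" using assms by (simp add: norm_power)
    then have "(Re (u ^ n))\<^sup>2 + (Im (u ^ n))\<^sup>2 = 1" by (metis cmod_power2 one_power2)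
    moreover have "(u\<^sup>2) ^ n = (u ^ n)\<^sup>2" by (simp add: power_mult[symmetric] mult.commute)
    ultimately have R: "Re ((u\<^sup>2) ^ n) = 2 * c\<^sup>2 - 1" unfolding c_def by (simp add: power2_eq_square)
    have "3 * (r ^ n * Re (1 ^ n) / n) + 4 * (r ^ n * Re (u ^ n) / n) + r ^ n * Re ((u\<^sup>2) ^ n) / n = r ^ n / n * (2 * (1 + c)\<^sup>2)"
      unfolding R c_def[symmetric] by (simp add: add_divide_distrib[symmetric] power2_eq_square algebra_simps)
    also have "\<dots> \<ge> 0" using assms by simp
    finally show ?thesis .
  qed
  have ge: "0 \<le> 3 * (- ln (norm (1 - of_real r :: complex))) + 4 * (- ln (norm (1 - of_real r * u))) + - ln (norm (1 - of_real r * u\<^sup>2))"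
    using sums_le[OF nn sums_zero sm] by (simp only: mult_1_right)
  have pos: "norm (1 - of_real r * v) > 0" if "norm v = 1" for v :: complex
  proof -
    have "norm (of_real r * v) < 1" using that assms by (simp add: norm_mult)
    then show ?thesis by auto
  qed
  define A B C where "A = norm (1 - of_real r :: complex)" and "B = norm (1 - of_real r * u)" and "C = norm (1 - of_real r * u\<^sup>2)"
  have p: "A > 0" "B > 0" "C > 0" using pos[of 1] pos[of u] pos[of "u\<^sup>2"] assms by (auto simp: A_def B_def C_def norm_power)
  have "ln (A ^ 3 * B ^ 4 * C) \<le> 0" using ge p unfolding A_def[symmetric] B_def[symmetric] C_def[symmetric]
    by (simp add: ln_mult ln_realpow)
  then have "A ^ 3 * B ^ 4 * C \<le> 1" using p by (simp add: ln_le_zero_iff)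
  then show ?thesis using p unfolding norm_divide A_def[symmetric] B_def[symmetric] C_def[symmetric]
    by (simp add: power_divide)
qed

lemma zser_tendsto:
  assumes "0 < Re s"
  shows "(\<lambda>N. \<Prod>p | prime p \<and> p \<le> N. 1 / (1 - zfun 0 s (real p))) \<longlonglongrightarrow> zser 0 s"
proof -
  have "((\<lambda>n. zfun 0 s (real n)) has_sum (\<Prod>p | prime p \<and> p \<le> N. 1 / (1 - zfun 0 s (real p)))) (smooth N)" for N
  proof (rule has_sum_smooth[THEN conjunct2])
    show "norm (zfun 0 s (real p)) < 1" if "prime p" for p
    proof -
      have "real p > 1" using that prime_gt_1_nat by simp
      then have "real p powr (- (1 + Re s)) < 1" using assms by (intro powr_less_one) auto
      then show ?thesis using that prime_gt_0_nat by (simp add: norm_zfun)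
    qed
  qed (auto simp: zfun_def ln_mult ring_distribs exp_add exp_diff field_simps exp_minus)
  then have "infsum (\<lambda>n. zfun 0 s (real n)) (smooth N) = (\<Prod>p | prime p \<and> p \<le> N. 1 / (1 - zfun 0 s (real p)))" for N
    by (rule infsumI)
  then show ?thesis using tendsto_infsum_smooth[OF zfun_summable_on[OF assms, of 0]] by (simp add: zser_def)
qed

lemma zser_341:
  assumes "0 < \<sigma>"
  shows "1 \<le> norm (zser 0 (of_real \<sigma>)) ^ 3 * norm (zser 0 (Complex \<sigma> \<tau>)) ^ 4 * norm (zser 0 (Complex \<sigma> (2 * \<tau>)))"
proof (rule tendsto_lowerbound)
  let ?P = "\<lambda>s N. \<Prod>p | prime p \<and> p \<le> N. 1 / (1 - zfun 0 s (real p))"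
  show "(\<lambda>N. norm (?P (of_real \<sigma>) N) ^ 3 * norm (?P (Complex \<sigma> \<tau>) N) ^ 4 * norm (?P (Complex \<sigma> (2 * \<tau>)) N)) \<longlonglongrightarrow>
    norm (zser 0 (of_real \<sigma>)) ^ 3 * norm (zser 0 (Complex \<sigma> \<tau>)) ^ 4 * norm (zser 0 (Complex \<sigma> (2 * \<tau>)))"
    using assms by (intro tendsto_intros zser_tendsto) auto
  show "\<forall>\<^sub>F N in sequentially. 1 \<le> norm (?P (of_real \<sigma>) N) ^ 3 * norm (?P (Complex \<sigma> \<tau>) N) ^ 4 * norm (?P (Complex \<sigma> (2 * \<tau>)) N)"
  proof (rule always_eventually, rule allI)
    fix N
    have "1 \<le> (\<Prod>p | prime p \<and> p \<le> N. norm (1 / (1 - zfun 0 (of_real \<sigma>) (real p))) ^ 3 *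
        norm (1 / (1 - zfun 0 (Complex \<sigma> \<tau>) (real p))) ^ 4 * norm (1 / (1 - zfun 0 (Complex \<sigma> (2 * \<tau>)) (real p))))"
    proof (rule prod_ge_1)
      fix p assume "p \<in> {p. prime p \<and> p \<le> N}"
      then have p: "real p > 1" using prime_gt_1_nat by auto
      define r where "r = exp (- ((1 + \<sigma>) * ln (real p)))"
      define u where "u = exp (- (\<i> * of_real (\<tau> * ln (real p))))"
      have 1: "zfun 0 (of_real \<sigma>) (real p) = of_real r" unfolding zfun_def r_def exp_of_real[symmetric] by simp
      have 2: "zfun 0 (Complex \<sigma> \<tau>) (real p) = of_real r * u"
        unfolding zfun_def r_def u_def exp_of_real[symmetric] exp_add[symmetric]
        by (simp add: Complex_eq algebra_simps)
      have 3: "zfun 0 (Complex \<sigma> (2 * \<tau>)) (real p) = of_real r * u\<^sup>2"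
        unfolding zfun_def r_def u_def exp_of_real[symmetric] power2_eq_square exp_add[symmetric]
        by (simp add: Complex_eq algebra_simps)
      show "1 \<le> norm (1 / (1 - zfun 0 (of_real \<sigma>) (real p))) ^ 3 *
        norm (1 / (1 - zfun 0 (Complex \<sigma> \<tau>) (real p))) ^ 4 * norm (1 / (1 - zfun 0 (Complex \<sigma> (2 * \<tau>)) (real p)))"
        unfolding 1 2 3 by (rule euler_factor_341) (use p assms in \<open>auto simp: r_def u_def\<close>)
    qed
    also have "\<dots> = norm (?P (of_real \<sigma>) N) ^ 3 * norm (?P (Complex \<sigma> \<tau>) N) ^ 4 * norm (?P (Complex \<sigma> (2 * \<tau>)) N)"
      by (simp add: prod.distrib prod_power_distrib prod_norm[symmetric])
    finally show "1 \<le> \<dots>" .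
  qed
qed simp

lemma zser_0_eq: "0 < Re s \<Longrightarrow> zser 0 s = 1 / s + zerr 0 s"
  and zser_1_eq: "0 < Re s \<Longrightarrow> zser 1 s = 1 / s\<^sup>2 + zerr 1 s"
  and zser_2_eq: "0 < Re s \<Longrightarrow> zser 2 s = 2 / s ^ 3 + zerr 2 s"
  using zser_eq[of s 0] zser_eq[of s 1] zser_eq[of s 2] by (simp_all add: zprim_def)

text \<open>Since \<open>d/ds\<close> maps \<^term>\<open>zdiff 0 s n\<close> to \<^term>\<open>- zdiff 1 s n\<close>, no derivative of a series is needed here.\<close>
lemma zerr_lipschitz:
  assumes "0 < \<sigma>" "\<sigma> \<le> \<sigma>1" "\<sigma>1 \<le> 1"
  shows "norm (zerr 0 (Complex \<sigma>1 \<tau>) - zerr 0 (Complex \<sigma> \<tau>)) \<le> (\<sigma>1 - \<sigma>) * (zbound * (3 + norm (Complex \<sigma>1 \<tau>)) powr (1/56))"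
proof -
  let ?s = "Complex \<sigma> \<tau>" and ?s1 = "Complex \<sigma>1 \<tau>"
  have s: "0 < Re ?s" "0 < Re ?s1" using assms by auto
  have *: "norm (zdiff 0 ?s1 n - zdiff 0 ?s n) \<le> (zweight n * (3 + norm ?s1) powr (1/56)) * norm (?s1 - ?s)" if n: "n \<ge> 1" for n
  proof (rule field_differentiable_bound)
    show "convex (closed_segment ?s ?s1)" by simp
    show "?s1 \<in> closed_segment ?s ?s1" "?s \<in> closed_segment ?s ?s1" by auto
    fix z assume "z \<in> closed_segment ?s ?s1"
    then obtain u where u: "0 \<le> u" "u \<le> 1" "z = (1 - u) *\<^sub>R ?s + u *\<^sub>R ?s1" by (auto simp: in_segment)
    have "Im z = (1 - u) * \<tau> + u * \<tau>" unfolding u(3) by simp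
    then have Imz: "Im z = \<tau>" by (simp add: algebra_simps)
    have "Re z = \<sigma> + u * (\<sigma>1 - \<sigma>)" unfolding u(3) by (simp add: algebra_simps)
    moreover have "u * (\<sigma>1 - \<sigma>) \<le> 1 * (\<sigma>1 - \<sigma>)" "0 \<le> u * (\<sigma>1 - \<sigma>)" using u(1,2) assms by (intro mult_right_mono mult_nonneg_nonneg; simp)+
    ultimately have Rez: "\<sigma> \<le> Re z" "Re z \<le> \<sigma>1" by auto
    have z0: "z \<noteq> 0" using Rez assms by auto
    have "zdiff 0 s n = exp (- ((1 + s) * of_real (ln n))) + exp (- (s * of_real (ln (real n + 1)))) / s - exp (- (s * of_real (ln n))) / s" for s
      by (simp add: zdiff_def zfun_def zprim_def)
    then have eq: "(\<lambda>s. zdiff 0 s n) = (\<lambda>s. exp (- ((1 + s) * of_real (ln n))) + exp (- (s * of_real (ln (real n + 1)))) / s - exp (- (s * of_real (ln n))) / s)" by auto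
    show "((\<lambda>s. zdiff 0 s n) has_field_derivative (- zdiff 1 z n)) (at z within closed_segment ?s ?s1)"
    proof -
      have e1: "((\<lambda>s. exp (- (s * b)) / s) has_field_derivative - (exp (- (z * b)) * (b / z + 1 / z\<^sup>2))) (at z within S)" for b S
      proof -
        have "((\<lambda>s. exp (- (s * b)) / s) has_field_derivative (- b * exp (- (z * b)) * z - exp (- (z * b)) * 1) / (z * z)) (at z within S)"
          using z0 by (auto intro!: derivative_eq_intros)
        also have "(- b * exp (- (z * b)) * z - exp (- (z * b)) * 1) / (z * z) = - (exp (- (z * b)) * (b / z + 1 / z\<^sup>2))"
          using z0 by (simp add: field_simps power2_eq_square)
        finally show ?thesis .
      qed
      have e2: "((\<lambda>s. exp (- ((1 + s) * a))) has_field_derivative - (a * exp (- ((1 + z) * a)))) (at z within S)" for a S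
        by (auto intro!: derivative_eq_intros)
      have "- zdiff 1 z n = - (of_real (ln n) * exp (- ((1 + z) * of_real (ln n))))
         + - (exp (- (z * of_real (ln (real n + 1)))) * (of_real (ln (real n + 1)) / z + 1 / z\<^sup>2))
         - - (exp (- (z * of_real (ln n))) * (of_real (ln n) / z + 1 / z\<^sup>2))"
        by (simp add: zdiff_def zfun_def zprim_def)
      then show ?thesis
        unfolding eq by (simp only:) (intro DERIV_add DERIV_diff e1 e2)
    qed
    have "norm z \<le> norm ?s1"
      using Rez Imz assms unfolding cmod_def by (intro real_sqrt_le_mono) (auto intro!: power_mono)
    then have "(3 + norm z) powr (1/56) \<le> (3 + norm ?s1) powr (1/56)" by (intro powr_mono2) auto
    then show "norm (- zdiff 1 z n) \<le> zweight n * (3 + norm ?s1) powr (1/56)"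
      using zdiff_le[of z n 1] Rez assms n mult_left_mono[OF _ zweight_nonneg[of n], of "(3 + norm z) powr (1/56)" "(3 + norm ?s1) powr (1/56)"]
      by simp
  qed
  have n: "norm (?s1 - ?s) = \<sigma>1 - \<sigma>" using assms by (simp add: cmod_def)
  show ?thesis
  proof (rule norm_infsum_le)
    show "((\<lambda>n. zdiff 0 ?s1 n - zdiff 0 ?s n) has_sum (zerr 0 ?s1 - zerr 0 ?s)) {1..}"
      unfolding zerr_def diff_conv_add_uminus 
      by (intro has_sum_add has_sum_uminusI has_sum_infsum)
         (rule abs_summable_summable[OF zdiff_summable_on]; use s in simp)+
    show "((\<lambda>n. (\<sigma>1 - \<sigma>) * (zweight n * (3 + norm ?s1) powr (1/56))) has_sum (\<sigma>1 - \<sigma>) * (zbound * (3 + norm ?s1) powr (1/56))) {1..}"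
      unfolding zbound_def using summable_zweight zweight_nonneg 
      by (intro has_sum_cmult_left has_sum_cmult_right has_sum_infsum summable_on_from_1I) auto
    show "norm (zdiff 0 ?s1 m - zdiff 0 ?s m) \<le> (\<sigma>1 - \<sigma>) * (zweight m * (3 + norm ?s1) powr (1/56))" if "m \<in> {1..}" for m
    proof -
      have "m \<ge> 1" using that by simp
      from *[OF this] show ?thesis unfolding n by (simp only: mult.commute)
    qed
  qed
qed

text \<open>Near s = 0 the pole wins: |s| \<le> 1 bounds the remainder by 4 \<open>zbound\<close>,
  and the hypothesis makes this at most half of 1/|s|.\<close>

lemma zser_lower_near:
  assumes "0 < Re s" "norm s \<le> 1 / (8 * zbound)"
  shows "norm (zser 0 s) \<ge> 1 / (2 * norm s)"
proof -
  note B = zbound_ge_1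
  have s0: "norm s > 0" using assms by auto
  have s1: "norm s \<le> 1"
  proof -
    have "1 / (8 * zbound) \<le> 1" using B by simp
    then show ?thesis using assms by linarith
  qed
  have "(3 + norm s) powr (1/56) \<le> (3 + norm s) powr 1" by (intro powr_mono) auto
  then have "(3 + norm s) powr (1/56) \<le> 4" using s1 by simp
  then have "zbound * (3 + norm s) powr (1/56) \<le> zbound * 4" using B by (intro mult_left_mono) auto
  then have "norm (zerr 0 s) \<le> zbound * 4"
    using norm_zerr_le[of s 0] assms by linarith
  moreover have "zbound * 4 \<le> 1 / (2 * norm s)" using assms s0 B by (simp add: field_simps)
  moreover have "norm (1 / s) - norm (zerr 0 s) \<le> norm (zser 0 s)"
    unfolding zser_0_eq[OF assms(1)] by (metis add.commute norm_diff_ineq)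
  ultimately show ?thesis by (simp add: norm_divide)
qed

text \<open>The 3-4-1 inequality yields only a lower bound of order \<sigma>^(3/4), which is lost as
  \<sigma> tends to 0. It is therefore used at a point \<sigma>1 slightly to the right, and the
  value is carried back to \<sigma> by the Lipschitz estimate, whose constant does not depend on
  \<sigma>.\<close>

lemma zser_lower_far:
  obtains c where "c > 0" 
    "\<And>s. 0 < Re s \<Longrightarrow> Re s \<le> 1 \<Longrightarrow> norm s \<ge> 1 / (8 * zbound) \<Longrightarrow> norm (zser 0 s) \<ge> c * (3 + norm s) powr (- (1/14))"
proof -
  define B where "B = zbound"
  \<comment> \<open>1250 B^4 is (5 B)^3 times 10 B, from the upper bounds 5 B / \<sigma> and 10 B
    T^(1/56) for the other two values of \<zeta>.\<close>
  define c1 where "c1 = 1 / (1250 * B ^ 4)"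
  \<comment> \<open>Solves (132 B^2 \<kappa>)^4 = (c1/2) \<kappa>^3, so that the lower bound at
    \<sigma>1 is twice the Lipschitz loss 66 B^2 \<kappa> T^(-1/14).\<close>
  define \<kappa> where "\<kappa> = (c1 / 2) / (132 * B\<^sup>2) ^ 4"
  have B: "B \<ge> 1" unfolding B_def by (rule zbound_ge_1)
  have B4: "B ^ 4 \<ge> 1" and B2: "B\<^sup>2 \<ge> 1" using B by (auto intro: one_le_power)
  have "1250 * B ^ 4 \<ge> 1" using B4 by linarith
  then have c1: "c1 > 0" "c1 \<le> 1" using B by (auto simp: c1_def)
  have "\<kappa> \<le> (1 / 2) / 1 "
    unfolding \<kappa>_def
  proof (rule frac_le)
    show "1 \<le> (132 * B\<^sup>2) ^ 4" by (rule one_le_power) (use B2 in linarith)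
  qed (use c1 in auto)
  then have \<kappa>: "\<kappa> > 0" "\<kappa> \<le> 1" using c1 B by (auto simp: \<kappa>_def)
  text \<open>The lower bound coming from \<open>3 + 4 cos \<theta> + cos 2\<theta> \<ge> 0\<close>.\<close>
  have low: "norm (zser 0 (Complex \<sigma> \<tau>)) ^ 4 \<ge> c1 * \<sigma> ^ 3 * (3 + norm (Complex \<sigma> \<tau>)) powr (- (1/56))"
    if \<sigma>: "0 < \<sigma>" "\<sigma> \<le> 1" and far: "norm (Complex \<sigma> \<tau>) \<ge> 1 / (8 * B)" for \<sigma> \<tau>
  proof -
    define T where "T = 3 + norm (Complex \<sigma> \<tau>)"
    have T: "T \<ge> 3" by (simp add: T_def)
    have T1: "T powr (1/56) \<ge> 1" using T by (intro ge_one_powr_ge_zero) auto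
    have "norm (zser 0 (of_real \<sigma>)) \<le> 1 / \<sigma> + B * (3 + \<sigma>) powr (1/56)"
      unfolding B_def using \<sigma> zser_0_eq[of "of_real \<sigma>"] norm_zerr_le[of "of_real \<sigma>" 0] 
        norm_triangle_ineq[of "1 / of_real \<sigma> :: complex" "zerr 0 (of_real \<sigma>)"]
      by (simp add: norm_divide)
    also have "\<dots> \<le> 1 / \<sigma> + B * 4"
    proof -
      have "(3 + \<sigma>) powr (1/56) \<le> (3 + \<sigma>) powr 1" using \<sigma> by (intro powr_mono) auto
      then show ?thesis using \<sigma> B by (intro add_left_mono mult_left_mono) auto
    qed
    also have "\<dots> \<le> B / \<sigma> + 4 * B / \<sigma>"
    proof (rule add_mono)
      show "1 / \<sigma> \<le> B / \<sigma>" using B \<sigma> by (intro divide_right_mono) auto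
      show "B * 4 \<le> 4 * B / \<sigma>" using B \<sigma> by (simp add: field_simps)
    qed
    finally have z1: "norm (zser 0 (of_real \<sigma>)) \<le> 5 * B / \<sigma>" by simp
    let ?s2 = "Complex \<sigma> (2 * \<tau>)"
    have n2: "norm (Complex \<sigma> \<tau>) \<le> norm ?s2" 
      unfolding cmod_def by (intro real_sqrt_le_mono) (auto simp: power_mult_distrib)
    have n3: "norm ?s2 \<le> 2 * norm (Complex \<sigma> \<tau>)"
    proof -
      have "(norm ?s2)\<^sup>2 \<le> (2 * norm (Complex \<sigma> \<tau>))\<^sup>2" by (simp add: cmod_power2 power_mult_distrib)
      then show ?thesis by (rule power2_le_imp_le) simp
    qed
    have "norm (zser 0 ?s2) \<le> 1 / norm ?s2 + B * (3 + norm ?s2) powr (1/56)"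
      unfolding B_def using \<sigma> zser_0_eq[of ?s2] norm_zerr_le[of ?s2 0] 
        norm_triangle_ineq[of "1 / ?s2" "zerr 0 ?s2"]
      by (simp add: norm_divide)
    also have "\<dots> \<le> 8 * B + B * (2 * T powr (1/56))"
    proof (intro add_mono mult_left_mono)
      have "1 / norm ?s2 \<le> 1 / (1 / (8 * B))" using far n2 B by (intro frac_le) auto
      then show "1 / norm ?s2 \<le> 8 * B" by simp
      have "(3 + norm ?s2) powr (1/56) \<le> (2 * T) powr (1/56)" using n3 unfolding T_def by (intro powr_mono2) auto
      also have "\<dots> = 2 powr (1/56) * T powr (1/56)" using T by (simp add: powr_mult)
      also have "\<dots> \<le> 2 powr 1 * T powr (1/56)" by (intro mult_right_mono powr_mono) auto
      finally show "(3 + norm ?s2) powr (1/56) \<le> 2 * T powr (1/56)" by simp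
    qed (use B in auto)
    also have "\<dots> \<le> 10 * B * T powr (1/56)" using T1 B by (simp add: algebra_simps)
    finally have z2: "norm (zser 0 ?s2) \<le> 10 * B * T powr (1/56)" .
    let ?z = "norm (zser 0 (Complex \<sigma> \<tau>)) ^ 4"
    have "1 \<le> norm (zser 0 (of_real \<sigma>)) ^ 3 * ?z * norm (zser 0 ?s2)" by (rule zser_341[OF \<sigma>(1)])
    also have "\<dots> \<le> (5 * B / \<sigma>) ^ 3 * ?z * (10 * B * T powr (1/56))"
      using z1 z2 B \<sigma> by (intro mult_mono power_mono) auto
    also have "\<dots> = ?z * T powr (1/56) / (c1 * \<sigma> ^ 3)" using B \<sigma>
      by (simp add: c1_def power_divide power_mult_distrib eval_nat_numeral)
    finally have "c1 * \<sigma> ^ 3 \<le> ?z * T powr (1/56)" using c1 \<sigma> by (simp add: field_simps)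
    then show ?thesis unfolding T_def[symmetric] using T by (simp add: powr_minus_divide field_simps)
  qed
  show ?thesis
  proof
    show "66 * B\<^sup>2 * \<kappa> > 0" using B \<kappa> by simp
    fix s :: complex assume s: "0 < Re s" "Re s \<le> 1" "norm s \<ge> 1 / (8 * zbound)"
    define \<sigma> where "\<sigma> = Re s" 
    define \<tau> where "\<tau> = Im s"
    have s_eq: "s = Complex \<sigma> \<tau>" by (simp add: \<sigma>_def \<tau>_def)
    define T where "T = 3 + norm s"
    have T: "T \<ge> 3" by (simp add: T_def)
    \<comment> \<open>The exponent 5/56 balances gain and loss: (\<sigma>1^3 T^(-1/56))^(1/4) and
      \<sigma>1 T^(1/56) both become T^(-1/14) up to constants. The maximum leaves \<sigma> in place
      where it is large enough already.\<close>
    define \<sigma>1 where "\<sigma>1 = max \<sigma> (\<kappa> * T powr (- (5/56)))"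
    have Tp: "T powr (- (5/56)) \<le> T powr 0" using T by (intro powr_mono) auto
    have \<sigma>1: "\<sigma> \<le> \<sigma>1" "\<sigma>1 \<le> 1" "0 < \<sigma>" "0 < \<sigma>1"
      using s \<kappa> T mult_mono[of \<kappa> 1 "T powr (- (5/56))" 1] Tp by (auto simp: \<sigma>1_def \<sigma>_def)
    let ?s1 = "Complex \<sigma>1 \<tau>"
    have n1: "norm s \<le> norm ?s1" unfolding s_eq cmod_def using \<sigma>1 by (intro real_sqrt_le_mono) (auto intro!: power_mono)
    have T1: "3 + norm ?s1 \<le> 2 * T"
    proof -
      have "norm ?s1 \<le> \<bar>\<sigma>1\<bar> + \<bar>\<tau>\<bar>" using cmod_le[of ?s1] by simp
      moreover have "\<bar>\<tau>\<bar> \<le> norm s" unfolding \<tau>_def by (rule abs_Im_le_cmod)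
      ultimately show ?thesis using \<sigma>1 by (simp add: T_def)
    qed
    have far: "1 / (8 * B) \<le> norm s" using s by (simp add: B_def)
    have "(132 * B\<^sup>2 * \<kappa> * T powr (- (1/14))) ^ 4 = (c1 / 2) * (\<kappa> * T powr (- (5/56))) ^ 3 * T powr (- (1/56))"
    proof -
      have "(T powr (- (1/14))) ^ 4 = (T powr (- (5/56))) ^ 3 * T powr (- (1/56))"
        using T by (simp add: powr_power powr_add[symmetric])
      moreover have "(132 * B\<^sup>2 * \<kappa>) ^ 4 = (c1 / 2) * \<kappa> ^ 3"
        using B by (simp add: \<kappa>_def power_mult_distrib power_divide field_simps eval_nat_numeral)
      ultimately show ?thesis by (subst power_mult_distrib) (simp add: power_mult_distrib[of \<kappa>])
    qed
    also have "\<dots> \<le> (c1 / 2) * \<sigma>1 ^ 3 * T powr (- (1/56))"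
      using c1 \<kappa> by (intro mult_right_mono mult_left_mono power_mono) (auto simp: \<sigma>1_def)
    also have "\<dots> \<le> c1 * \<sigma>1 ^ 3 * (3 + norm ?s1) powr (- (1/56))"
    proof -
      have "T powr (- (1/56)) / 2 = 2 powr (-1) * T powr (- (1/56))" by (simp add: powr_minus_divide)
      also have "\<dots> \<le> 2 powr (- (1/56)) * T powr (- (1/56))" by (intro mult_right_mono powr_mono) auto
      also have "\<dots> = (2 * T) powr (- (1/56))" using T by (simp add: powr_mult)
      also have "\<dots> \<le> (3 + norm ?s1) powr (- (1/56))" using T1 by (intro powr_mono2') (auto intro: add_pos_nonneg)
      finally have "c1 * \<sigma>1 ^ 3 * (T powr (- (1/56)) / 2) \<le> c1 * \<sigma>1 ^ 3 * (3 + norm ?s1) powr (- (1/56))"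
        using c1 \<sigma>1 by (intro mult_left_mono) auto
      then show ?thesis by simp
    qed
    also have "\<dots> \<le> norm (zser 0 ?s1) ^ 4"
      using \<sigma>1 far n1 by (intro low) auto
    finally have z1: "132 * B\<^sup>2 * \<kappa> * T powr (- (1/14)) \<le> norm (zser 0 ?s1)"
      by (rule power_le_imp_le_base[of _ 3, simplified]) simp
    have zeq: "zser 0 ?s1 - zser 0 s = (1 / ?s1 - 1 / s) + (zerr 0 ?s1 - zerr 0 s)"
      using s \<sigma>1 by (simp add: zser_0_eq)
    \<comment> \<open>64 B^2 accounts for the change of 1/s, both points having modulus at least 1 /
      (8 B); the other 2 B^2 T^(1/56) accounts for the change of the remainder.\<close>
    have "norm (zser 0 ?s1 - zser 0 s) \<le> (\<sigma>1 - \<sigma>) * (66 * B\<^sup>2 * T powr (1/56))"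
    proof -
      have "norm (1 / ?s1 - 1 / s) \<le> (\<sigma>1 - \<sigma>) * (64 * B\<^sup>2)"
      proof -
        have ne: "s \<noteq> 0" "?s1 \<noteq> 0" using s \<sigma>1 by (auto simp: complex_eq_iff)
        have "1 / ?s1 - 1 / s = (s - ?s1) / (s * ?s1)" using ne by (simp add: field_simps)
        then have "norm (1 / ?s1 - 1 / s) = norm (s - ?s1) / (norm s * norm ?s1)" by (simp add: norm_divide norm_mult)
        also have "norm (s - ?s1) = \<sigma>1 - \<sigma>" unfolding s_eq using \<sigma>1 by (simp add: cmod_def)
        also have "(\<sigma>1 - \<sigma>) / (norm s * norm ?s1) \<le> (\<sigma>1 - \<sigma>) / (1 / (8 * B) * (1 / (8 * B)))"
          using \<sigma>1 far n1 B ne by (intro divide_left_mono mult_mono mult_pos_pos) auto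
        also have "\<dots> = (\<sigma>1 - \<sigma>) * (64 * B\<^sup>2)" using B by (simp add: power2_eq_square)
        finally show ?thesis .
      qed
      moreover have "norm (zerr 0 ?s1 - zerr 0 s) \<le> (\<sigma>1 - \<sigma>) * (2 * B * T powr (1/56))"
      proof -
        have "(3 + norm ?s1) powr (1/56) \<le> (2 * T) powr (1/56)" using T1 by (intro powr_mono2) auto
        also have "\<dots> = 2 powr (1/56) * T powr (1/56)" using T by (simp add: powr_mult)
        also have "\<dots> \<le> 2 powr 1 * T powr (1/56)" by (intro mult_right_mono powr_mono) auto
        finally have "(\<sigma>1 - \<sigma>) * (B * (3 + norm ?s1) powr (1/56)) \<le> (\<sigma>1 - \<sigma>) * (B * (2 * T powr (1/56)))"
          using \<sigma>1 B by (intro mult_left_mono) auto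
        with zerr_lipschitz[OF \<sigma>1(3,1,2), of \<tau>] show ?thesis unfolding s_eq B_def by (simp add: mult_ac)
      qed
      moreover have "(\<sigma>1 - \<sigma>) * (64 * B\<^sup>2) + (\<sigma>1 - \<sigma>) * (2 * B * T powr (1/56)) \<le> (\<sigma>1 - \<sigma>) * (66 * B\<^sup>2 * T powr (1/56))"
      proof -
        have Te: "T powr (1/56) \<ge> 1" using T by (intro ge_one_powr_ge_zero) auto
        have "64 * B\<^sup>2 * 1 \<le> 64 * B\<^sup>2 * T powr (1/56)" using Te by (intro mult_left_mono) auto
        moreover have "2 * B * T powr (1/56) \<le> 2 * B\<^sup>2 * T powr (1/56)" using B by (intro mult_right_mono) (auto simp: power2_eq_square)
        ultimately have "64 * B\<^sup>2 + 2 * B * T powr (1/56) \<le> 66 * B\<^sup>2 * T powr (1/56)" by linarith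
        then show ?thesis using \<sigma>1 unfolding distrib_left[symmetric] by (intro mult_left_mono) auto
      qed
      ultimately show ?thesis unfolding zeq
        using norm_triangle_ineq[of "1 / ?s1 - 1 / s" "zerr 0 ?s1 - zerr 0 s"] by linarith
    qed
    also have "\<dots> \<le> 66 * B\<^sup>2 * \<kappa> * T powr (- (1/14))"
    proof -
      have "\<sigma>1 - \<sigma> \<le> \<kappa> * T powr (- (5/56))" 
      proof -
        have "0 \<le> \<kappa> * T powr (- (5/56))" using \<kappa> by simp
        then show ?thesis using \<sigma>1(3) unfolding \<sigma>1_def by linarith
      qed
      then have "(\<sigma>1 - \<sigma>) * (66 * B\<^sup>2 * T powr (1/56)) \<le> \<kappa> * T powr (- (5/56)) * (66 * B\<^sup>2 * T powr (1/56))"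
        by (intro mult_right_mono) auto
      also have "\<dots> = 66 * B\<^sup>2 * \<kappa> * (T powr (- (5/56)) * T powr (1/56))" by simp
      also have "T powr (- (5/56)) * T powr (1/56) = T powr (- (1/14))" by (simp add: powr_add[symmetric])
      finally show ?thesis .
    qed
    finally show "norm (zser 0 s) \<ge> 66 * B\<^sup>2 * \<kappa> * (3 + norm s) powr (- (1/14))"
      using z1 norm_triangle_ineq2[of "zser 0 ?s1" "zser 0 s"] unfolding T_def[symmetric] by linarith
  qed
qed

text \<open>The factor s cancels the pole, so one bound covers the whole strip. Near 0 the product s
  \<zeta>(1 + s) has modulus at least 1/2 while T \<le> 4, which is where the summand 8 of the
  constant comes from. Elsewhere T \<le> (24 \<open>zbound\<close> + 1) |s|, so 1/|s| is as good as
  1/T.\<close>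

lemma inverse_s_zser_le:
  obtains C where "C > 0" 
    "\<And>s. 0 < Re s \<Longrightarrow> Re s \<le> 1 \<Longrightarrow> zser 0 s \<noteq> 0 \<and> norm (1 / (s * zser 0 s)) \<le> C * (3 + norm s) powr (1/14 - 1)"
proof -
  obtain c where c: "c > 0" 
    "\<And>s. 0 < Re s \<Longrightarrow> Re s \<le> 1 \<Longrightarrow> norm s \<ge> 1 / (8 * zbound) \<Longrightarrow> norm (zser 0 s) \<ge> c * (3 + norm s) powr (- (1/14))"
    using zser_lower_far by metis
  define C where "C = 8 + (24 * zbound + 1) / c"
  have C: "C \<ge> 8" "C \<ge> (24 * zbound + 1) / c" using c zbound_ge_1 by (auto simp: C_def)
  have "zser 0 s \<noteq> 0 \<and> norm (1 / (s * zser 0 s)) \<le> C * (3 + norm s) powr (1/14 - 1)" if s: "0 < Re s" "Re s \<le> 1" for s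
  proof -
    define T where "T = 3 + norm s"
    have T: "T \<ge> 3" by (simp add: T_def)
    have s0: "norm s > 0" using s by auto
    show ?thesis
    proof (cases "norm s \<le> 1 / (8 * zbound)")
      case True
      have z: "norm (zser 0 s) \<ge> 1 / (2 * norm s)" by (rule zser_lower_near[OF s(1) True])
      then have z0: "norm (zser 0 s) > 0" using s0 by (meson less_le_trans zero_less_divide_1_iff mult_pos_pos zero_less_numeral)
      have "norm s * norm (zser 0 s) \<ge> 1/2" using z s0 by (simp add: field_simps)
      then have "norm (1 / (s * zser 0 s)) \<le> 1 / (1/2)" unfolding norm_divide norm_mult using s0 z0
        by (intro frac_le) auto
      also have "1 / (1/2) \<le> C * T powr (1/14 - 1)"
      proof -
        have "1 / (8 * zbound) \<le> 1" using zbound_ge_1 by simp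
        then have "T \<le> 4" using True by (simp add: T_def)
        then have "1 / 4 \<le> T powr (-1)" using T by (simp add: powr_minus_divide frac_le)
        also have "\<dots> \<le> T powr (1/14 - 1)" using T by (intro powr_mono) auto
        finally show ?thesis using C mult_mono[of 8 C "1/4" "T powr (1/14 - 1)"] by simp
      qed
      finally show ?thesis using z0 by (simp add: T_def)
    next
      case False
      have z: "norm (zser 0 s) \<ge> c * T powr (- (1/14))" using c(2)[OF s] False by (simp add: T_def)
      have cT: "c * T powr (- (1/14)) > 0" using c T by simp
      then have z0: "norm (zser 0 s) > 0" using z by linarith
      have "1 \<le> 8 * zbound * norm s" using False zbound_ge_1 by (simp add: field_simps)
      then have Ts: "T \<le> (24 * zbound + 1) * norm s" by (simp add: T_def algebra_simps)
      have "norm (1 / (s * zser 0 s)) = 1 / norm s * (1 / norm (zser 0 s))" by (simp add: norm_divide norm_mult)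
      also have "\<dots> \<le> ((24 * zbound + 1) / T) * (1 / (c * T powr (- (1/14))))"
      proof (rule mult_mono)
        show "1 / norm s \<le> (24 * zbound + 1) / T" using Ts s0 T by (simp add: field_simps)
        show "1 / norm (zser 0 s) \<le> 1 / (c * T powr (- (1/14)))" using z cT by (intro frac_le) auto
        show "0 \<le> (24 * zbound + 1) / T" using T zbound_ge_1 by simp
      qed simp
      also have "\<dots> = (24 * zbound + 1) / c * T powr (1/14 - 1)"
      proof -
        have "T powr (1/14 - 1) = T powr (1/14) / T" using T by (subst powr_diff) simp
        then show ?thesis by (simp only:) (simp add: powr_minus_divide)
      qed
      also have "\<dots> \<le> C * T powr (1/14 - 1)" using C by (intro mult_right_mono) auto
      finally show ?thesis using z0 by (simp add: T_def)
    qed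
  qed
  moreover have "C > 0" using C by simp
  ultimately show ?thesis using that by blast
qed

text \<open>Up to the sign (-1)^j, the termwise j-th derivative of 1 / \<zeta>(1 + s).\<close>

definition mser :: "nat \<Rightarrow> complex \<Rightarrow> complex" where
  "mser j s = infsum (\<lambda>n. of_real (moebius n) * zfun j s (real n)) {1..}"

lemma mser_summable_on:
  assumes "0 < Re s"
  shows "(\<lambda>n. norm (of_real (moebius n) * zfun j s (real n))) summable_on {1..}"
proof (rule Infinite_Sum.abs_summable_on_comparison_test'[OF zfun_summable_on[OF assms, of j]])
  fix n :: nat
  show "norm (of_real (moebius n) * zfun j s (real n)) \<le> norm (zfun j s (real n))"
    unfolding norm_mult norm_of_real using abs_moebius_le[of n] mult_right_mono[of "\<bar>moebius n\<bar>" 1 "norm (zfun j s (real n))"] by simp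
qed

text \<open>The weights are kept as powers of ln d and of ln n - ln d = ln (n/d), so that the
  binomial combinations formed next collapse to powers of ln n.\<close>

lemma mser_zser_prod:
  assumes "0 < Re s"
  shows "((\<lambda>n. (\<Sum>d | d dvd n. of_real (moebius d * (ln (real d) ^ i * (ln (real n) - ln (real d)) ^ j))) * zfun 0 s (real n)) has_sum (mser i s * zser j s)) {1..}"
proof -
  have "((\<lambda>n. \<Sum>d | d dvd n. (of_real (moebius d) * zfun i s (real d)) * zfun j s (real (n div d))) has_sum (mser i s * zser j s)) {1..}"
    unfolding mser_def zser_def by (intro has_sum_dirichlet_prod mser_summable_on zfun_summable_on assms)
  also have "?this \<longleftrightarrow> ?thesis"
  proof (rule has_sum_cong)
    fix n :: nat assume n: "n \<in> {1..}"
    show "(\<Sum>d | d dvd n. (of_real (moebius d) * zfun i s (real d)) * zfun j s (real (n div d))) = 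
      (\<Sum>d | d dvd n. of_real (moebius d * (ln (real d) ^ i * (ln (real n) - ln (real d)) ^ j))) * zfun 0 s (real n)"
      unfolding sum_distrib_right
    proof (intro sum.cong refl)
      fix d assume "d \<in> {d. d dvd n}"
      then obtain e where e: "n = d * e" by auto
      then have de: "d > 0" "e > 0" using n by (auto intro!: Nat.gr0I)
      have "exp (- ((1 + s) * of_real (ln (real n)))) = exp (- ((1 + s) * of_real (ln (real d)))) * exp (- ((1 + s) * of_real (ln (real e))))"
        unfolding exp_add[symmetric] e using de by (simp add: ln_mult algebra_simps)
      then show "(of_real (moebius d) * zfun i s (real d)) * zfun j s (real (n div d)) = 
        of_real (moebius d * (ln (real d) ^ i * (ln (real n) - ln (real d)) ^ j)) * zfun 0 s (real n)"
        using e de by (simp add: zfun_def ln_mult)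
    qed
  qed
  finally show ?thesis .
qed

text \<open>The equation (1/\<zeta>) \<zeta> = 1 differentiated k = 0, 1, 2 times. In terms of
  coefficients this is the binomial theorem: the coefficient at n becomes (ln n)^k times the divisor
  sum of \<mu>, which is nonzero only at n = 1, where (ln 1)^k = 0^k.\<close>

lemma mser_relations:
  assumes s: "0 < Re s"
  shows "mser 0 s * zser 0 s = 1"
    and "mser 1 s * zser 0 s + mser 0 s * zser 1 s = 0"
    and "mser 2 s * zser 0 s + 2 * (mser 1 s * zser 1 s) + mser 0 s * zser 2 s = 0"
proof -
  have ind: "((\<lambda>n. (\<Sum>d | d dvd n. of_real (moebius d * ln (real n) ^ k)) * zfun 0 s (real n)) has_sum (if k = 0 then 1 else 0)) {1..}" for k
  proof -
    have "((\<lambda>n::nat. if n = 1 then (0::complex) ^ k else 0) has_sum (if k = 0 then 1 else 0)) {1..}"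
      by (rule has_sum_finite_neutralI[of "{1}"]) auto
    also have "?this \<longleftrightarrow> ?thesis"
    proof (rule has_sum_cong)
      fix n :: nat assume n: "n \<in> {1..}"
      have "(\<Sum>d | d dvd n. of_real (moebius d * ln (real n) ^ k)) = (of_real ((\<Sum>d | d dvd n. moebius d) * ln (real n) ^ k) :: complex)"
        by (simp add: sum_distrib_right)
      also have "\<dots> * zfun 0 s (real n) = (if n = 1 then 0 ^ k else 0)"
        using n sum_moebius_dvd[of n] by (auto simp: zfun_def)
      finally show "(if n = 1 then 0 ^ k else 0) = (\<Sum>d | d dvd n. of_real (moebius d * ln (real n) ^ k)) * zfun 0 s (real n)" by simp
    qed
    finally show ?thesis .
  qed
  note P = mser_zser_prod[OF s]
  show "mser 0 s * zser 0 s = 1"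
    using has_sum_unique[OF P[of 0 0]] ind[of 0] by simp
  have "((\<lambda>n. (\<Sum>d | d dvd n. of_real (moebius d * ln (real n) ^ 1)) * zfun 0 s (real n)) has_sum (mser 1 s * zser 0 s + mser 0 s * zser 1 s)) {1..}"
    using has_sum_add[OF P[of 1 0] P[of 0 1]]
    unfolding distrib_right[symmetric] sum.distrib[symmetric] of_real_add[symmetric] distrib_left[symmetric]
    by simp
  from has_sum_unique[OF this ind[of 1]] show "mser 1 s * zser 0 s + mser 0 s * zser 1 s = 0" by simp
  have "((\<lambda>n. (\<Sum>d | d dvd n. of_real (moebius d * (ln (real d) ^ 2 * (ln (real n) - ln (real d)) ^ 0))) * zfun 0 s (real n) +
      2 * ((\<Sum>d | d dvd n. of_real (moebius d * (ln (real d) ^ 1 * (ln (real n) - ln (real d)) ^ 1))) * zfun 0 s (real n)) + 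
      (\<Sum>d | d dvd n. of_real (moebius d * (ln (real d) ^ 0 * (ln (real n) - ln (real d)) ^ 2))) * zfun 0 s (real n)) has_sum
      (mser 2 s * zser 0 s + 2 * (mser 1 s * zser 1 s) + mser 0 s * zser 2 s)) {1..}"
    by (intro has_sum_add has_sum_cmult_right P)
  also have "(\<lambda>n. (\<Sum>d | d dvd n. of_real (moebius d * (ln (real d) ^ 2 * (ln (real n) - ln (real d)) ^ 0))) * zfun 0 s (real n) +
      2 * ((\<Sum>d | d dvd n. of_real (moebius d * (ln (real d) ^ 1 * (ln (real n) - ln (real d)) ^ 1))) * zfun 0 s (real n)) + 
      (\<Sum>d | d dvd n. of_real (moebius d * (ln (real d) ^ 0 * (ln (real n) - ln (real d)) ^ 2))) * zfun 0 s (real n)) = 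
      (\<lambda>n. (\<Sum>d | d dvd n. of_real (moebius d * ln (real n) ^ 2)) * zfun 0 s (real n))"
    unfolding mult.assoc[symmetric] distrib_right[symmetric] sum_distrib_left sum.distrib[symmetric]
    by (intro ext arg_cong2[where f = "(*)"] sum.cong refl) (simp add: power2_eq_square algebra_simps)
  finally have "((\<lambda>n. (\<Sum>d | d dvd n. of_real (moebius d * ln (real n) ^ 2)) * zfun 0 s (real n)) has_sum (mser 2 s * zser 0 s + 2 * (mser 1 s * zser 1 s) + mser 0 s * zser 2 s)) {1..}" .
  from has_sum_unique[OF this ind[of 2]] show "mser 2 s * zser 0 s + 2 * (mser 1 s * zser 1 s) + mser 0 s * zser 2 s = 0" by simp
qed

text \<open>This combination is the second derivative of \<open>1 / (s \<zeta>(1 + s))\<close>.\<close>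
definition mtrans :: "complex \<Rightarrow> complex" where
  "mtrans s = mser 2 s / s + 2 * mser 1 s / s\<^sup>2 + 2 * mser 0 s / s ^ 3"

text \<open>Put H(s) = s \<zeta>(1 + s), so that h = 1/H. The poles cancel in H' =
  \<open>zerr 0 s - s * zerr 1 s\<close> and in H'' = \<open>s * zerr 2 s - 2 * zerr 1 s\<close>,
  and the formula reads h'' = 2 h^3 (H')^2 - h^2 H''. It is derived here by eliminating the values
  of \<open>mser\<close> and \<open>zser\<close>.\<close>

lemma mtrans_eq:
  assumes s: "0 < Re s" and z: "zser 0 s \<noteq> 0"
  defines "h \<equiv> 1 / (s * zser 0 s)"
  shows "mtrans s = 2 * h ^ 3 * (s * zerr 1 s - zerr 0 s)\<^sup>2 - h\<^sup>2 * (s * zerr 2 s - 2 * zerr 1 s)"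
proof -
  have s0: "s \<noteq> 0" using s by auto
  have h0: "h \<noteq> 0" using s0 z by (simp add: h_def)
  define U where "U = s * zerr 1 s - zerr 0 s"
  define V where "V = s * zerr 2 s - 2 * zerr 1 s"
  have z0: "zser 0 s = 1 / (s * h)" using s0 z by (simp add: h_def)
  have "s * zser 1 s - zser 0 s = U"
    unfolding U_def zser_0_eq[OF s] zser_1_eq[OF s] using s0 by (simp add: field_simps power2_eq_square)
  then have z1: "zser 1 s = U / s + 1 / (s\<^sup>2 * h)"
    using s0 unfolding z0 by (simp add: field_simps power2_eq_square)
  have "s * zser 2 s - 2 * zser 1 s = V"
    unfolding V_def zser_1_eq[OF s] zser_2_eq[OF s] using s0 by (simp add: field_simps power2_eq_square power3_eq_cube)
  then have z2: "zser 2 s = V / s + 2 * U / s\<^sup>2 + 2 / (s ^ 3 * h)"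
    using s0 h0 unfolding z1 by (simp add: field_simps power2_eq_square power3_eq_cube)
  note R = mser_relations[OF s]
  have m0: "mser 0 s = s * h" using R(1) s0 h0 unfolding z0 by (simp add: field_simps)
  have "mser 1 s = - (s * h) * (mser 0 s * zser 1 s)"
    using R(2) s0 h0 unfolding z0 by (simp add: field_simps eq_neg_iff_add_eq_0)
  also have "\<dots> = - (s * h\<^sup>2 * U) - h" 
    unfolding m0 z1 using s0 h0 by (simp add: field_simps power2_eq_square)
  finally have m1: "mser 1 s = - (s * h\<^sup>2 * U) - h" .
  have "mser 2 s = - (s * h) * (2 * (mser 1 s * zser 1 s) + mser 0 s * zser 2 s)"
    using R(3) s0 h0 unfolding z0 by (simp add: field_simps eq_neg_iff_add_eq_0)
  then have "mser 2 s = - (s * h) * (2 * ((- (s * h\<^sup>2 * U) - h) * (U / s + 1 / (s\<^sup>2 * h))) + (s * h) * (V / s + 2 * U / s\<^sup>2 + 2 / (s ^ 3 * h)))"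
    unfolding m0 m1 z1 z2 .
  also have "\<dots> = 2 * s * h ^ 3 * U\<^sup>2 + 2 * h\<^sup>2 * U - s * h\<^sup>2 * V"
    using s0 h0 by (simp add: field_simps power2_eq_square power3_eq_cube)
  finally have m2: "mser 2 s = 2 * s * h ^ 3 * U\<^sup>2 + 2 * h\<^sup>2 * U - s * h\<^sup>2 * V" .
  show ?thesis unfolding mtrans_def m0 m1 m2 U_def[symmetric] V_def[symmetric]
    using s0 h0 by (simp add: field_simps power2_eq_square power3_eq_cube)
qed

text \<open>Powers of T: h has exponent -52/56, and U and V have 57/56. Hence h^3 U^2 gets (-156 +
  114)/56 = -3/4, and h^2 V gets -47/56, which is smaller.\<close>

lemma norm_mtrans_le:
  obtains C where "C > 0" "\<And>s. 0 < Re s \<Longrightarrow> Re s \<le> 1 \<Longrightarrow> norm (mtrans s) \<le> C * (3 + norm s) powr (- (3/4))"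
proof -
  obtain C where C: "C > 0" 
    "\<And>s. 0 < Re s \<Longrightarrow> Re s \<le> 1 \<Longrightarrow> zser 0 s \<noteq> 0 \<and> norm (1 / (s * zser 0 s)) \<le> C * (3 + norm s) powr (1/14 - 1)"
    using inverse_s_zser_le by metis
  define B where "B = zbound"
  have B: "B \<ge> 1" unfolding B_def by (rule zbound_ge_1)
  have "norm (mtrans s) \<le> (8 * C ^ 3 * B\<^sup>2 + 3 * C\<^sup>2 * B) * (3 + norm s) powr (- (3/4))" if s: "0 < Re s" "Re s \<le> 1" for s
  proof -
    define T where "T = 3 + norm s"
    have T: "T \<ge> 3" "norm s \<le> T" by (auto simp: T_def)
    define h where "h = 1 / (s * zser 0 s)"
    define U where "U = s * zerr 1 s - zerr 0 s"
    define V where "V = s * zerr 2 s - 2 * zerr 1 s"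
    have z: "zser 0 s \<noteq> 0" and h: "norm h \<le> C * T powr (- (13/14))"
      using C(2)[OF s] by (auto simp: T_def h_def)
    have e: "norm (zerr j s) \<le> B * T powr (1/56)" if "j \<le> 2" for j
      using norm_zerr_le[OF s(1) that] by (simp add: B_def T_def)
    have Tp: "T * T powr (1/56) = T powr (57/56)" using T powr_add[of T 1 "1/56"] by simp
    have Tp1: "T powr (1/56) \<le> T powr (57/56)" using T by (intro powr_mono) auto
    have se: "norm (s * zerr j s) \<le> B * T powr (57/56)" if "j \<le> 2" for j
    proof -
      have "norm (s * zerr j s) \<le> T * (B * T powr (1/56))" unfolding norm_mult
        using T e[OF that] by (intro mult_mono) auto
      also have "\<dots> = B * (T * T powr (1/56))" by simp
      finally show ?thesis unfolding Tp .
    qed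
    have e': "norm (zerr j s) \<le> B * T powr (57/56)" if "j \<le> 2" for j
      by (rule order.trans[OF e[OF that] mult_left_mono[OF Tp1]]) (use B in simp)
    have U: "norm U \<le> 2 * B * T powr (57/56)"
      unfolding U_def using norm_triangle_ineq4[of "s * zerr 1 s" "zerr 0 s"] se[of 1] e'[of 0] by simp
    have V: "norm V \<le> 3 * B * T powr (57/56)"
      unfolding V_def using norm_triangle_ineq4[of "s * zerr 2 s" "2 * zerr 1 s"] se[of 2] e'[of 1] by (simp add: norm_mult)
    have "norm (mtrans s) \<le> norm (2 * h ^ 3 * U\<^sup>2) + norm (h\<^sup>2 * V)"
      unfolding mtrans_eq[OF s(1) z, folded h_def U_def V_def] by (rule norm_triangle_ineq4)
    also have "\<dots> = 2 * norm h ^ 3 * (norm U)\<^sup>2 + (norm h)\<^sup>2 * norm V"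
      by (simp add: norm_mult norm_power)
    also have "\<dots> \<le> 2 * (C * T powr (- (13/14))) ^ 3 * (2 * B * T powr (57/56))\<^sup>2 + (C * T powr (- (13/14)))\<^sup>2 * (3 * B * T powr (57/56))"
      using h U V C B by (intro add_mono mult_mono power_mono) auto
    also have "\<dots> = 8 * C ^ 3 * B\<^sup>2 * ((T powr (- (13/14))) ^ 3 * (T powr (57/56))\<^sup>2) + 3 * C\<^sup>2 * B * ((T powr (- (13/14)))\<^sup>2 * T powr (57/56))"
      by (simp add: power_mult_distrib)
    also have "(T powr (- (13/14))) ^ 3 * (T powr (57/56))\<^sup>2 = T powr (- (3/4))"
      using T by (simp add: powr_power powr_add[symmetric])
    also have "(T powr (- (13/14)))\<^sup>2 * T powr (57/56) = T powr (- (47/56))"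
      using T by (simp add: powr_power powr_add[symmetric])
    also have "8 * C ^ 3 * B\<^sup>2 * T powr (- (3/4)) + 3 * C\<^sup>2 * B * T powr (- (47/56)) \<le> 8 * C ^ 3 * B\<^sup>2 * T powr (- (3/4)) + 3 * C\<^sup>2 * B * T powr (- (3/4))"
      using T C B by (intro add_left_mono mult_left_mono powr_mono) auto
    finally show ?thesis by (simp add: T_def algebra_simps)
  qed
  moreover have "8 * C ^ 3 * B\<^sup>2 + 3 * C\<^sup>2 * B > 0" using C B by (intro add_pos_pos mult_pos_pos) auto
  ultimately show ?thesis using that by blast
qed

section \<open>Partial sums of the Moebius function\<close>

definition msum :: "real \<Rightarrow> real" where
  "msum t = (\<Sum>n=1..nat \<lfloor>t\<rfloor>. moebius n / real n)"

text \<open>The integral of w^2 e^(-s w) over w \<ge> v. Real s occurs as well as complex s, for the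
  integrals of absolute values.\<close>

definition lapl :: "'a::{real_normed_field,banach} \<Rightarrow> real \<Rightarrow> 'a" where
  "lapl s v = exp (- (s * of_real v)) * (of_real v ^ 2 / s + 2 * of_real v / s\<^sup>2 + 2 / s ^ 3)"

lemma DERIV_lapl:
  fixes s l :: "'a::{real_normed_field,banach}"
  assumes "s \<noteq> 0"
  shows "((\<lambda>l. - (exp (- (s * l)) * (l ^ 2 / s + 2 * l / s\<^sup>2 + 2 / s ^ 3))) has_field_derivative l ^ 2 * exp (- (s * l))) (at l within S)"
proof -
  have q: "((\<lambda>l. l\<^sup>2 / s + 2 * l / s\<^sup>2 + 2 / s ^ 3) has_field_derivative 2 * l / s + 2 / s\<^sup>2) (at l within S)"
    using assms by (auto intro!: derivative_eq_intros simp: field_simps power2_eq_square)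
  have e: "((\<lambda>l. exp (- (s * l))) has_field_derivative - s * exp (- (s * l))) (at l within S)"
    by (auto intro!: derivative_eq_intros)
  have "((\<lambda>l. - (exp (- (s * l)) * (l\<^sup>2 / s + 2 * l / s\<^sup>2 + 2 / s ^ 3))) has_field_derivative 
     - (- s * exp (- (s * l)) * (l\<^sup>2 / s + 2 * l / s\<^sup>2 + 2 / s ^ 3) + (2 * l / s + 2 / s\<^sup>2) * exp (- (s * l)))) (at l within S)"
    by (rule DERIV_minus[OF DERIV_mult[OF e q]])
  also have "- (- s * exp (- (s * l)) * (l\<^sup>2 / s + 2 * l / s\<^sup>2 + 2 / s ^ 3) + (2 * l / s + 2 / s\<^sup>2) * exp (- (s * l)))
    = exp (- (s * l)) * (s * (l\<^sup>2 / s + 2 * l / s\<^sup>2 + 2 / s ^ 3) - (2 * l / s + 2 / s\<^sup>2))"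
    by (simp add: algebra_simps)
  also have "s * (l\<^sup>2 / s + 2 * l / s\<^sup>2 + 2 / s ^ 3) - (2 * l / s + 2 / s\<^sup>2) = l\<^sup>2"
    using assms by (simp add: field_simps power2_eq_square power3_eq_cube)
  finally show ?thesis by (simp add: mult.commute)
qed

text \<open>The fundamental theorem of calculus delivers integrals over open half-lines, whereas the
  n-th term of the partial sum is present from v = ln n on, endpoint included.\<close>

lemma AE_indicator_Ici:
  "AE v in lborel. indicator {a..} v *\<^sub>R f v = (indicator {a<..} v *\<^sub>R f v :: 'a::real_vector)" for a :: real
  using AE_lborel_singleton[of a] by eventually_elim (auto simp: indicator_def)

lemma lapl_real:
  assumes "\<sigma> > 0"
  shows "integrable lborel (\<lambda>v. indicator {a..} v *\<^sub>R (v\<^sup>2 * exp (- (\<sigma> * v))))"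
    and "(\<integral>v. indicator {a..} v *\<^sub>R (v\<^sup>2 * exp (- (\<sigma> * v))) \<partial>lborel) = lapl \<sigma> a"
proof -
  let ?f = "\<lambda>v::real. v\<^sup>2 * exp (- (\<sigma> * v))"
  have d: "DERIV (\<lambda>v. - lapl \<sigma> v) x :> ?f x" for x
    using DERIV_lapl[of \<sigma> x UNIV] assms by (simp add: lapl_def)
  have l1: "(((\<lambda>v. - lapl \<sigma> v) \<circ> real_of_ereal) \<longlongrightarrow> - lapl \<sigma> a) (at_right (ereal a))"
    unfolding ereal_tendsto_simps using DERIV_isCont[OF d[of a]] 
    by (auto simp: isCont_def intro: filterlim_mono[OF _ order_refl] at_le)
  have l2: "(((\<lambda>v. - lapl \<sigma> v) \<circ> real_of_ereal) \<longlongrightarrow> 0) (at_left \<infinity>)"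
    unfolding ereal_tendsto_simps lapl_def using assms by (simp, real_asymp)
  have e: "einterval (ereal a) \<infinity> = {a<..}" by (auto simp: einterval_def)
  have "set_integrable lborel (einterval a \<infinity>) ?f" "(LBINT x=a..\<infinity>. ?f x) = 0 - (- lapl \<sigma> a)"
    by (rule interval_integral_FTC_nonneg[OF _ d _ _ l1 l2]; simp)+
  then have i: "integrable lborel (\<lambda>v. indicator {a<..} v *\<^sub>R ?f v)" "(\<integral>v. indicator {a<..} v *\<^sub>R ?f v \<partial>lborel) = lapl \<sigma> a"
    by (simp_all add: e set_integrable_def interval_lebesgue_integral_def set_lebesgue_integral_def)
  have "integrable lborel (\<lambda>v. indicator {a..} v *\<^sub>R ?f v) \<longleftrightarrow> integrable lborel (\<lambda>v. indicator {a<..} v *\<^sub>R ?f v)"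
    by (rule integrable_cong_AE[OF _ _ AE_indicator_Ici]) auto
  then show "integrable lborel (\<lambda>v. indicator {a..} v *\<^sub>R ?f v)" using i by simp
  have "(\<integral>v. indicator {a..} v *\<^sub>R ?f v \<partial>lborel) = (\<integral>v. indicator {a<..} v *\<^sub>R ?f v \<partial>lborel)"
    by (rule integral_cong_AE[OF _ _ AE_indicator_Ici]) auto
  then show "(\<integral>v. indicator {a..} v *\<^sub>R ?f v \<partial>lborel) = lapl \<sigma> a" using i by simp
qed

text \<open>Integrability is inherited from the real case by taking norms. The exact integral of the
  norm is what later justifies integrating a series term by term.\<close>

lemma lapl_complex:
  fixes s :: complex
  assumes "Re s > 0"
  shows "integrable lborel (\<lambda>v. indicator {a..} v *\<^sub>R (of_real v ^ 2 * exp (- (s * of_real v))))"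
    and "(\<integral>v. indicator {a..} v *\<^sub>R (of_real v ^ 2 * exp (- (s * of_real v))) \<partial>lborel) = lapl s a"
    and "(\<integral>v. norm (indicator {a..} v *\<^sub>R (of_real v ^ 2 * exp (- (s * of_real v)))) \<partial>lborel) = lapl (Re s) a"
proof -
  let ?f = "\<lambda>v::real. of_real v ^ 2 * exp (- (s * of_real v)) :: complex"
  have s0: "s \<noteq> 0" using assms by auto
  have norm: "norm (indicator A v *\<^sub>R ?f v) = indicator A v *\<^sub>R (v\<^sup>2 * exp (- (Re s * v)))" for v A
    by (simp add: norm_mult norm_power indicator_def)
  show int: "integrable lborel (\<lambda>v. indicator {a..} v *\<^sub>R ?f v)"
    by (rule Bochner_Integration.integrable_bound[OF lapl_real(1)[OF assms, of a]])
       (auto simp: norm_mult norm_power indicator_def)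
  show "(\<integral>v. norm (indicator {a..} v *\<^sub>R ?f v) \<partial>lborel) = lapl (Re s) a"
    unfolding norm by (rule lapl_real(2)[OF assms])
  have d: "((\<lambda>v. - lapl s v) has_vector_derivative ?f x) (at x)" for x
    unfolding lapl_def by (rule has_vector_derivative_real_field[OF DERIV_lapl[OF s0]])
  have c: "isCont (\<lambda>v. - lapl s v) x" for x
    using d[of x] by (rule has_vector_derivative_continuous)
  have l1: "(((\<lambda>v. - lapl s v) \<circ> real_of_ereal) \<longlongrightarrow> - lapl s a) (at_right (ereal a))"
    unfolding ereal_tendsto_simps using c[of a]
    by (auto simp: isCont_def intro: filterlim_mono[OF _ order_refl] at_le)
  have "((\<lambda>v. exp (- (Re s * v)) * (v\<^sup>2 / norm s + 2 * v / (norm s)\<^sup>2 + 2 / norm s ^ 3)) \<longlongrightarrow> 0) at_top"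
  proof -
    have "((\<lambda>v. exp (- (a * v)) * (v\<^sup>2 / b + 2 * v / b\<^sup>2 + 2 / b ^ 3)) \<longlongrightarrow> 0) at_top" if "a > 0" "b > 0" for a b :: real
      using that by real_asymp
    then show ?thesis using assms s0 by simp
  qed
  then have "((\<lambda>v. - lapl s v) \<longlongrightarrow> 0) at_top"
  proof (rule Lim_null_comparison[rotated], intro eventually_at_top_linorderI[of 0])
    fix v :: real assume v: "0 \<le> v"
    have "norm (of_real v ^ 2 / s + 2 * of_real v / s\<^sup>2 + 2 / s ^ 3) \<le> v\<^sup>2 / norm s + 2 * v / (norm s)\<^sup>2 + 2 / norm s ^ 3"
      using v by (auto intro!: norm_triangle_le add_mono simp: norm_divide norm_power norm_mult)
    then show "norm (- lapl s v) \<le> exp (- (Re s * v)) * (v\<^sup>2 / norm s + 2 * v / (norm s)\<^sup>2 + 2 / norm s ^ 3)"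
      unfolding lapl_def norm_minus_cancel norm_mult by (intro mult_mono) auto
  qed
  then have l2: "(((\<lambda>v. - lapl s v) \<circ> real_of_ereal) \<longlongrightarrow> 0) (at_left \<infinity>)"
    unfolding ereal_tendsto_simps .
  have e: "einterval (ereal a) \<infinity> = {a<..}" by (auto simp: einterval_def)
  have "integrable lborel (\<lambda>v. indicator {a..} v *\<^sub>R ?f v) \<longleftrightarrow> integrable lborel (\<lambda>v. indicator {a<..} v *\<^sub>R ?f v)"
    by (rule integrable_cong_AE[OF _ _ AE_indicator_Ici]) auto
  then have si: "set_integrable lborel (einterval a \<infinity>) ?f" using int by (simp add: e set_integrable_def)
  have "(LBINT x=a..\<infinity>. ?f x) = 0 - (- lapl s a)"
    by (rule interval_integral_FTC_integrable[OF _ d _ si l1 l2]) (auto intro!: continuous_intros)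
  then have "(\<integral>v. indicator {a<..} v *\<^sub>R ?f v \<partial>lborel) = lapl s a"
    by (simp add: e interval_lebesgue_integral_def set_lebesgue_integral_def)
  moreover have "(\<integral>v. indicator {a..} v *\<^sub>R ?f v \<partial>lborel) = (\<integral>v. indicator {a<..} v *\<^sub>R ?f v \<partial>lborel)"
    by (rule integral_cong_AE[OF _ _ AE_indicator_Ici]) auto
  ultimately show "(\<integral>v. indicator {a..} v *\<^sub>R ?f v \<partial>lborel) = lapl s a" by simp
qed

text \<open>The damping e^(-\<sigma> v) belongs to the function and only the oscillation e^(-i
  \<tau> v) to the transform, so that Gaussian averaging applies to an integrable real function on
  the line.\<close>

definition mweight :: "real \<Rightarrow> real \<Rightarrow> real" where
  "mweight \<sigma> v = indicator {0..} v * (v\<^sup>2 * exp (- (\<sigma> * v)) * msum (exp v))"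

lemma lapl_ln_div:
  assumes "n \<ge> 1"
  shows "lapl s (ln (real n)) / of_nat n = zfun 2 s n / s + 2 * zfun 1 s n / s\<^sup>2 + 2 * zfun 0 s n / s ^ 3"
proof -
  have "exp (- ((1 + s) * of_real (ln (real n)))) = exp (- of_real (ln (real n))) * exp (- (s * of_real (ln (real n))))"
    by (simp add: exp_add[symmetric] algebra_simps)
  also have "exp (- of_real (ln (real n)) :: complex) = 1 / of_nat n"
    using assms by (simp add: exp_minus exp_of_real inverse_eq_divide)
  finally have e: "exp (- ((1 + s) * of_real (ln (real n)))) = exp (- (s * of_real (ln (real n)))) / of_nat n" by simp
  show ?thesis unfolding lapl_def zfun_def e
    by (simp add: add_divide_distrib distrib_left mult_ac)
qed

lemma mtrans_sums:
  assumes s: "0 < Re s"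
  shows "(\<lambda>i. of_real (moebius (Suc i) / real (Suc i)) * lapl s (ln (real (Suc i)))) sums mtrans s"
proof -
  let ?m = "\<lambda>j n. of_real (moebius n) * zfun j s (real n)"
  have m: "(?m j has_sum mser j s) {1..}" for j
    unfolding mser_def by (rule has_sum_infsum[OF abs_summable_summable[OF mser_summable_on[OF s]]])
  have "((\<lambda>n. ?m 2 n / s + 2 * ?m 1 n / s\<^sup>2 + 2 * ?m 0 n / s ^ 3) has_sum mtrans s) {1..}"
    unfolding mtrans_def by (intro has_sum_add has_sum_divide_const has_sum_cmult_right m)
  then have "((\<lambda>n. ?m 2 (Suc n) / s + 2 * ?m 1 (Suc n) / s\<^sup>2 + 2 * ?m 0 (Suc n) / s ^ 3) has_sum mtrans s) UNIV"
    by (subst has_sum_reindex_bij_betw[of Suc UNIV "{1..}", where f = "\<lambda>n. ?m 2 n / s + 2 * ?m 1 n / s\<^sup>2 + 2 * ?m 0 n / s ^ 3"])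
       (auto simp: bij_betw_def image_iff Suc_le_eq gr0_conv_Suc)
  then have "(\<lambda>n. ?m 2 (Suc n) / s + 2 * ?m 1 (Suc n) / s\<^sup>2 + 2 * ?m 0 (Suc n) / s ^ 3) sums mtrans s"
    by (rule has_sum_imp_sums)
  also have "(\<lambda>n. ?m 2 (Suc n) / s + 2 * ?m 1 (Suc n) / s\<^sup>2 + 2 * ?m 0 (Suc n) / s ^ 3) = 
     (\<lambda>i. of_real (moebius (Suc i) / real (Suc i)) * lapl s (ln (real (Suc i))))"
  proof
    fix i
    have "of_real (moebius (Suc i) / real (Suc i)) * lapl s (ln (real (Suc i))) = of_real (moebius (Suc i)) * (lapl s (ln (real (Suc i))) / of_nat (Suc i))"
      by (simp del: of_nat_Suc)
    also have "\<dots> = ?m 2 (Suc i) / s + 2 * ?m 1 (Suc i) / s\<^sup>2 + 2 * ?m 0 (Suc i) / s ^ 3"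
    proof -
      have "lapl s (ln (real (Suc i))) / of_nat (Suc i) = zfun 2 s (Suc i) / s + 2 * zfun 1 s (Suc i) / s\<^sup>2 + 2 * zfun 0 s (Suc i) / s ^ 3"
        by (rule lapl_ln_div) simp
      then show ?thesis by (simp only:) (simp add: distrib_left mult_ac del: of_nat_Suc)
    qed
    finally show "?m 2 (Suc i) / s + 2 * ?m 1 (Suc i) / s\<^sup>2 + 2 * ?m 0 (Suc i) / s ^ 3 = 
     of_real (moebius (Suc i) / real (Suc i)) * lapl s (ln (real (Suc i)))" by simp
  qed
  finally show ?thesis .
qed

lemma summable_lapl:
  assumes "\<sigma> > 0"
  shows "summable (\<lambda>i. \<bar>moebius (Suc i) / real (Suc i)\<bar> * lapl \<sigma> (ln (real (Suc i))))"
proof (rule summable_comparison_test')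
  have s: "0 < Re (of_real \<sigma>)" using assms by simp
  let ?z = "\<lambda>j i. norm (zfun j (of_real \<sigma>) (real (Suc i)))"
  have "summable (?z j)" for j
    using summable_zfun[OF s, of j] by (subst summable_Suc_iff) 
  then show "summable (\<lambda>i. ?z 2 i / \<sigma> + 2 * ?z 1 i / \<sigma>\<^sup>2 + 2 * ?z 0 i / \<sigma> ^ 3)"
    by (intro summable_add summable_divide summable_mult)
  fix i :: nat
  have l: "lapl \<sigma> (ln (real (Suc i))) / real (Suc i) = ?z 2 i / \<sigma> + 2 * ?z 1 i / \<sigma>\<^sup>2 + 2 * ?z 0 i / \<sigma> ^ 3"
  proof -
    have e: "real (Suc i) powr (- (1 + \<sigma>)) = exp (- (\<sigma> * ln (real (Suc i)))) / real (Suc i)"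
    proof -
      have "real (Suc i) powr (- (1 + \<sigma>)) = exp (- (\<sigma> * ln (real (Suc i))) - ln (real (Suc i)))"
        by (simp add: powr_def algebra_simps del: of_nat_Suc)
      then show ?thesis by (simp add: exp_diff del: of_nat_Suc)
    qed
    show ?thesis unfolding lapl_def using e
      by (simp add: norm_zfun add_divide_distrib distrib_left mult_ac del: of_nat_Suc)
  qed
  have l0: "0 \<le> lapl \<sigma> (ln (real (Suc i)))" unfolding lapl_def using assms by simp
  have "norm (\<bar>moebius (Suc i) / real (Suc i)\<bar> * lapl \<sigma> (ln (real (Suc i)))) = \<bar>moebius (Suc i)\<bar> * (lapl \<sigma> (ln (real (Suc i))) / real (Suc i))"
    using l0 by (simp add: abs_mult del: of_nat_Suc)
  also have "\<dots> \<le> 1 * (lapl \<sigma> (ln (real (Suc i))) / real (Suc i))"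
    using l0 abs_moebius_le by (intro mult_right_mono) auto
  finally show "norm (\<bar>moebius (Suc i) / real (Suc i)\<bar> * lapl \<sigma> (ln (real (Suc i)))) \<le> ?z 2 i / \<sigma> + 2 * ?z 1 i / \<sigma>\<^sup>2 + 2 * ?z 0 i / \<sigma> ^ 3"
    unfolding l by simp
qed

text \<open>The term \<mu>(n)/n enters \<open>msum (exp v)\<close> exactly when v \<ge> ln n, so it
  contributes \<mu>(n)/n times the tail integral \<open>lapl s (ln n)\<close>. At each v the series
  of terms is finite, and the integrated norms are summable, so sum and integral may be
  exchanged.\<close>

lemma mweight_transform:
  assumes \<sigma>: "\<sigma> > 0"
  shows "integrable lborel (\<lambda>v. of_real (mweight \<sigma> v) * exp (- (\<i> * of_real (\<tau> * v))))"
    and "(\<integral>v. of_real (mweight \<sigma> v) * exp (- (\<i> * of_real (\<tau> * v))) \<partial>lborel) = mtrans (Complex \<sigma> \<tau>)"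
proof -
  define s where "s = Complex \<sigma> \<tau>"
  have s: "Re s > 0" "Re s = \<sigma>" using \<sigma> by (auto simp: s_def)
  define f where "f i v = of_real (moebius (Suc i) / real (Suc i)) * (indicator {ln (real (Suc i))..} v *\<^sub>R (of_real v ^ 2 * exp (- (s * of_real v))))" for i v
  have int: "integrable lborel (f i)" for i
    unfolding f_def by (intro integrable_mult_right lapl_complex s)
  have fs: "(\<lambda>i. f i v) sums (of_real (mweight \<sigma> v) * exp (- (\<i> * of_real (\<tau> * v))))" for v
  proof -
    let ?N = "nat \<lfloor>exp v\<rfloor>"
    have iff: "ln (real (Suc i)) \<le> v \<longleftrightarrow> i < ?N" for i
    proof -
      have "ln (real (Suc i)) \<le> v \<longleftrightarrow> real (Suc i) \<le> exp v" 
        by (metis exp_le_cancel_iff exp_ln of_nat_0_less_iff zero_less_Suc)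
      also have "\<dots> \<longleftrightarrow> Suc i \<le> ?N" by linarith
      finally show ?thesis by (simp add: Suc_le_eq)
    qed
    have "(\<lambda>i. f i v) sums (\<Sum>i<?N. f i v)"
      by (rule sums_finite) (use iff in \<open>auto simp: f_def\<close>)
    also have "(\<Sum>i<?N. f i v) = (\<Sum>i<?N. of_real (moebius (Suc i) / real (Suc i)) * (of_real v ^ 2 * exp (- (s * of_real v))))"
      using iff by (intro sum.cong) (auto simp: f_def)
    also have "\<dots> = of_real (\<Sum>i<?N. moebius (Suc i) / real (Suc i)) * (of_real v ^ 2 * exp (- (s * of_real v)))"
      by (simp add: sum_distrib_right)
    also have "(\<Sum>i<?N. moebius (Suc i) / real (Suc i)) = msum (exp v)"
      unfolding msum_def by (simp add: sum.atLeast1_atMost_eq)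
    also have "exp (- (s * of_real v)) = of_real (exp (- (\<sigma> * v))) * exp (- (\<i> * of_real (\<tau> * v)))"
      unfolding exp_of_real[symmetric] exp_add[symmetric] by (simp add: s_def Complex_eq algebra_simps)
    also have "of_real (msum (exp v)) * (of_real v ^ 2 * (of_real (exp (- (\<sigma> * v))) * exp (- (\<i> * of_real (\<tau> * v))))) = 
      of_real (mweight \<sigma> v) * exp (- (\<i> * of_real (\<tau> * v)))"
    proof (cases "v \<ge> 0")
      case False
      then have "exp v < 1" by simp
      then have "\<lfloor>exp v\<rfloor> \<le> 0" by linarith
      then have "msum (exp v) = 0" by (simp add: msum_def)
      then show ?thesis by (simp add: mweight_def)
    qed (simp add: mweight_def)
    finally show ?thesis .
  qed
  have nrm: "(\<integral>v. norm (f i v) \<partial>lborel) = \<bar>moebius (Suc i) / real (Suc i)\<bar> * lapl \<sigma> (ln (real (Suc i)))" for i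
    unfolding f_def norm_mult norm_of_real 
    using lapl_complex(3)[OF s(1), of "ln (real (Suc i))"] s(2) by (simp add: norm_mult del: of_nat_Suc)
  have sums: "summable (\<lambda>i. \<integral>v. norm (f i v) \<partial>lborel)"
    unfolding nrm by (rule summable_lapl[OF \<sigma>])
  have ae: "AE v in lborel. summable (\<lambda>i. norm (f i v))"
  proof (rule AE_I2)
    fix v
    have "f i v = 0" if "i \<notin> {..<nat \<lceil>exp v\<rceil>}" for i
    proof -
      have "real (Suc i) > exp v" using that by (simp, linarith)
      then have "ln (real (Suc i)) > v" by (metis exp_ln exp_less_cancel_iff of_nat_0_less_iff zero_less_Suc)
      then show ?thesis by (simp add: f_def)
    qed
    then show "summable (\<lambda>i. norm (f i v))" by (intro summable_finite[of "{..<nat \<lceil>exp v\<rceil>}"]) auto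
  qed
  have eq: "(\<lambda>v. \<Sum>i. f i v) = (\<lambda>v. of_real (mweight \<sigma> v) * exp (- (\<i> * of_real (\<tau> * v))))"
    using fs by (auto simp: fun_eq_iff sums_iff)
  show "integrable lborel (\<lambda>v. of_real (mweight \<sigma> v) * exp (- (\<i> * of_real (\<tau> * v))))"
    unfolding eq[symmetric] by (rule integrable_suminf[OF int ae sums])
  have "(\<lambda>i. integral\<^sup>L lborel (f i)) sums (\<integral>v. of_real (mweight \<sigma> v) * exp (- (\<i> * of_real (\<tau> * v))) \<partial>lborel)"
    unfolding eq[symmetric] by (rule sums_integral[OF int ae sums])
  also have "(\<lambda>i. integral\<^sup>L lborel (f i)) = (\<lambda>i. of_real (moebius (Suc i) / real (Suc i)) * lapl s (ln (real (Suc i))))"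
    unfolding f_def by (rule ext, subst integral_mult_right_zero, subst lapl_complex(2)[OF s(1)], rule refl)
  finally show "(\<integral>v. of_real (mweight \<sigma> v) * exp (- (\<i> * of_real (\<tau> * v))) \<partial>lborel) = mtrans (Complex \<sigma> \<tau>)"
    using mtrans_sums[OF s(1)] by (auto simp: s_def sums_iff)
qed

text \<open>The Gaussian weight is the characteristic function of the standard normal law, so Fubini
  turns the average of h near v0 into a normal average of its transform at u / \<delta>. A narrow
  window thus sees the transform at high frequencies, where it is small.\<close>

lemma gaussian_average_transform:
  fixes h :: "real \<Rightarrow> real"
  assumes h: "integrable lborel h" and \<delta>: "\<delta> > 0"
  shows "of_real (\<integral>v. h v * exp (- ((v0 - v) / \<delta>)\<^sup>2 / 2) \<partial>lborel) =
    (CLINT u|std_normal_distribution. exp (\<i> * of_real (u * v0 / \<delta>)) * 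
       (CLINT v|lborel. of_real (h v) * exp (- (\<i> * of_real (u / \<delta> * v)))))"
proof -
  interpret N: real_distribution std_normal_distribution by (rule real_dist_normal_dist)
  interpret P: pair_sigma_finite lborel std_normal_distribution ..
  define F where "F v u = of_real (h v) * exp (\<i> * of_real ((v0 - v) / \<delta> * u))" for v u
  have hm[measurable]: "h \<in> borel_measurable borel" using h by auto
  have nF: "norm (F v u) = \<bar>h v\<bar>" for u v by (simp add: F_def norm_mult)
  have int: "integrable (lborel \<Otimes>\<^sub>M std_normal_distribution) (case_prod F)"
  proof (rule P.Fubini_integrable)
    show "case_prod F \<in> borel_measurable (lborel \<Otimes>\<^sub>M std_normal_distribution)"
      unfolding F_def by measurable
    show "integrable lborel (\<lambda>v. \<integral>u. norm (case_prod F (v, u)) \<partial>std_normal_distribution)"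
      using h N.prob_space by (simp add: nF)
    show "AE v in lborel. integrable std_normal_distribution (\<lambda>u. case_prod F (v, u))"
    proof (rule AE_I2)
      fix v
      show "integrable std_normal_distribution (\<lambda>u. case_prod F (v, u))"
      proof (rule N.integrable_const_bound[of _ "\<bar>h v\<bar>"])
        show "(\<lambda>u. case_prod F (v, u)) \<in> borel_measurable std_normal_distribution"
          unfolding F_def prod.case by measurable
      qed (simp add: nF)
    qed
  qed
  have "(\<integral>u. F v u \<partial>std_normal_distribution) = of_real (h v * exp (- ((v0 - v) / \<delta>)\<^sup>2 / 2))" for v
  proof -
    have "(\<integral>u. F v u \<partial>std_normal_distribution) = of_real (h v) * char std_normal_distribution ((v0 - v) / \<delta>)"
      unfolding F_def char_def by (rule integral_mult_right_zero)
    then show ?thesis by (simp add: char_std_normal_distribution)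
  qed
  then have "of_real (\<integral>v. h v * exp (- ((v0 - v) / \<delta>)\<^sup>2 / 2) \<partial>lborel) = (\<integral>v. (\<integral>u. F v u \<partial>std_normal_distribution) \<partial>lborel)"
    by (simp only: integral_complex_of_real)
  also have "\<dots> = (\<integral>u. (\<integral>v. F v u \<partial>lborel) \<partial>std_normal_distribution)"
    by (rule P.Fubini_integral[symmetric, OF int])
  also have "(\<lambda>u. \<integral>v. F v u \<partial>lborel) = (\<lambda>u. exp (\<i> * of_real (u * v0 / \<delta>)) * 
       (CLINT v|lborel. of_real (h v) * exp (- (\<i> * of_real (u / \<delta> * v)))))"
  proof
    fix u
    have "F v u = exp (\<i> * of_real (u * v0 / \<delta>)) * (of_real (h v) * exp (- (\<i> * of_real (u / \<delta> * v))))" for v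
    proof -
      have "exp (\<i> * of_real ((v0 - v) / \<delta> * u)) = exp (\<i> * of_real (u * v0 / \<delta>)) * exp (- (\<i> * of_real (u / \<delta> * v)))"
        unfolding exp_add[symmetric] by (rule arg_cong[where f = exp]) (use \<delta> in \<open>simp add: field_simps\<close>)
      then show ?thesis by (simp add: F_def)
    qed
    then show "(\<integral>v. F v u \<partial>lborel) = exp (\<i> * of_real (u * v0 / \<delta>)) * 
       (CLINT v|lborel. of_real (h v) * exp (- (\<i> * of_real (u / \<delta> * v))))"
      by simp
  qed
  finally show ?thesis .
qed

lemma integrable_powr_unit_interval: "integrable lborel (\<lambda>u::real. indicator {0..1} u * u powr (- (3/4)))"
proof -
  have "(\<lambda>u::real. u powr (- (3/4))) absolutely_integrable_on {0..1}"
    by (rule nonnegative_absolutely_integrable_1) (auto intro: integrable_on_powr_from_0)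
  then have "integrable lebesgue (\<lambda>u::real. indicator {0..1} u * u powr (- (3/4)))"
    by (simp add: set_integrable_def)
  then show ?thesis by (subst (asm) integrable_completion) auto
qed

text \<open>After rescaling by \<delta>, the decay exponent 3/4 of the transform reappears as a
  singularity at u = 0. It is integrable because 3/4 < 1; for |u| > 1 the density itself is a
  bound.\<close>

lemma integrable_normal_powr: "integrable std_normal_distribution (\<lambda>u. \<bar>u\<bar> powr (- (3/4)))"
proof -
  let ?g = "\<lambda>u::real. indicator {0..1} u * u powr (- (3/4))"
  have g: "integrable lborel ?g" by (rule integrable_powr_unit_interval)
  have g': "integrable lborel (\<lambda>u. ?g (- u))"
    using lborel_integrable_real_affine[OF g, of "-1" 0] by simp
  have "integrable lborel (\<lambda>u. std_normal_density u *\<^sub>R \<bar>u\<bar> powr (- (3/4)))"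
  proof (rule Bochner_Integration.integrable_bound)
    show "integrable lborel (\<lambda>u. ?g u + ?g (- u) + std_normal_density u)"
      using g g' by (intro Bochner_Integration.integrable_add) auto
    show "AE u in lborel. norm (std_normal_density u *\<^sub>R \<bar>u\<bar> powr (- (3/4))) \<le> norm (?g u + ?g (- u) + std_normal_density u)"
    proof (rule AE_I2)
      fix u :: real
      have d: "0 \<le> std_normal_density u" "std_normal_density u \<le> 1"
      proof -
        have "exp (- u\<^sup>2 / 2) \<le> 1" by simp
        moreover have "1 \<le> sqrt (2 * pi)" using pi_ge_two by (intro real_le_rsqrt) auto
        ultimately have "1 / sqrt (2 * pi) * exp (- u\<^sup>2 / 2) \<le> 1 * 1"
          by (intro mult_mono) auto
        then show "std_normal_density u \<le> 1" unfolding std_normal_density_def by simp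
      qed simp
      show "norm (std_normal_density u *\<^sub>R \<bar>u\<bar> powr (- (3/4))) \<le> norm (?g u + ?g (- u) + std_normal_density u)"
      proof (cases "\<bar>u\<bar> \<le> 1")
        case True
        have "std_normal_density u * \<bar>u\<bar> powr (- (3/4)) \<le> 1 * \<bar>u\<bar> powr (- (3/4))"
          using d by (intro mult_right_mono) auto
        also have "\<dots> \<le> ?g u + ?g (- u)" using True by (cases "u \<ge> 0") (auto simp: indicator_def)
        finally have "std_normal_density u * \<bar>u\<bar> powr (- (3/4)) \<le> ?g u + ?g (- u)" .
        moreover have "0 \<le> std_normal_density u * \<bar>u\<bar> powr (- (3/4))" using d by simp
        ultimately show ?thesis using d unfolding real_norm_def real_scaleR_def by linarith
      next
        case False
        have "\<bar>u\<bar> powr (- (3/4)) \<le> \<bar>u\<bar> powr 0" using False by (intro powr_mono) auto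
        then have "\<bar>u\<bar> powr (- (3/4)) \<le> 1" using False by (cases "u = 0") auto
        then have "std_normal_density u * \<bar>u\<bar> powr (- (3/4)) \<le> std_normal_density u * 1"
          using d False by (intro mult_left_mono) auto
        moreover have "0 \<le> ?g u + ?g (- u)" by simp
        moreover have "0 \<le> std_normal_density u * \<bar>u\<bar> powr (- (3/4))" using d by simp
        ultimately show ?thesis using d unfolding real_norm_def real_scaleR_def by linarith
      qed
    qed
  qed auto
  then show ?thesis by (subst integrable_density) auto
qed

lemma sum_inverse_interval_le:
  assumes "1 \<le> m" "m \<le> k"
  shows "(\<Sum>n\<in>{m<..k}. 1 / real n) \<le> ln (real k) - ln (real m)"
  using assms(2)
proof (induction k rule: dec_induct)
  case (step k)
  have "{m<..Suc k} = insert (Suc k) {m<..k}" using step by auto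
  then have "(\<Sum>n\<in>{m<..Suc k}. 1 / real n) = 1 / real (Suc k) + (\<Sum>n\<in>{m<..k}. 1 / real n)" by simp
  moreover have "1 / real (Suc k) \<le> ln (real (Suc k)) - ln (real k)"
  proof -
    have "ln (real k / real (Suc k)) \<le> real k / real (Suc k) - 1"
      using step assms by (intro ln_le_minus_one) auto
    moreover have "ln (real k / real (Suc k)) = ln (real k) - ln (real (Suc k))"
      using step assms by (simp add: ln_div del: of_nat_Suc)
    moreover have "real k / real (Suc k) - 1 = - (1 / real (Suc k))" by (simp add: field_simps)
    ultimately show ?thesis by linarith
  qed
  ultimately show ?case using step.IH by linarith
qed auto

lemma sum_inverse_le:
  assumes "x \<ge> 1"
  shows "(\<Sum>n=1..nat \<lfloor>x\<rfloor>. 1 / real n) \<le> 1 + ln x"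
proof -
  let ?k = "nat \<lfloor>x\<rfloor>"
  have k: "1 \<le> ?k" "real ?k \<le> x" using assms by linarith+
  have "{1..?k} = insert 1 {1<..?k}" using k by auto
  then have "(\<Sum>n=1..?k. 1 / real n) = 1 + (\<Sum>n\<in>{1<..?k}. 1 / real n)" by simp
  also have "\<dots> \<le> 1 + ln (real ?k)" using sum_inverse_interval_le[of 1 ?k] k by simp
  also have "\<dots> \<le> 1 + ln x" using k by simp
  finally show ?thesis .
qed

lemma abs_msum_le:
  assumes "x \<ge> 1"
  shows "\<bar>msum x\<bar> \<le> 1 + ln x"
proof -
  have "\<bar>msum x\<bar> \<le> (\<Sum>n=1..nat \<lfloor>x\<rfloor>. 1 / real n)"
    unfolding msum_def using abs_moebius_le by (intro order.trans[OF sum_abs] sum_mono) (auto intro: divide_right_mono)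
  then show ?thesis using sum_inverse_le[OF assms] by linarith
qed

text \<open>The term 1/a pays for the first integer beyond a; the later ones are compared with the
  integral of 1/x.\<close>

lemma msum_diff_le:
  assumes "1 \<le> a" "a \<le> b"
  shows "\<bar>msum b - msum a\<bar> \<le> ln b - ln a + 1 / a"
proof (cases "nat \<lfloor>a\<rfloor> = nat \<lfloor>b\<rfloor>")
  case True
  then have "msum b = msum a" by (simp add: msum_def)
  then show ?thesis using assms by simp
next
  case False
  let ?m = "nat \<lfloor>a\<rfloor>" and ?k = "nat \<lfloor>b\<rfloor>"
  have mk: "1 \<le> ?m" "Suc ?m \<le> ?k" "a \<le> real (Suc ?m)" "real ?k \<le> b"
    using assms False by linarith+
  have "{1..?k} = {1..?m} \<union> {?m<..?k}" using mk by auto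
  then have "msum b - msum a = (\<Sum>n\<in>{?m<..?k}. moebius n / real n)"
    unfolding msum_def by (simp only:) (subst sum.union_disjoint, auto)
  then have "\<bar>msum b - msum a\<bar> \<le> (\<Sum>n\<in>{?m<..?k}. 1 / real n)"
    using abs_moebius_le by (simp only:) (intro order.trans[OF sum_abs] sum_mono, auto intro: divide_right_mono)
  also have "{?m<..?k} = insert (Suc ?m) {Suc ?m<..?k}" using mk by auto
  then have "(\<Sum>n\<in>{?m<..?k}. 1 / real n) = 1 / real (Suc ?m) + (\<Sum>n\<in>{Suc ?m<..?k}. 1 / real n)" by simp
  also have "\<dots> \<le> 1 / a + (ln (real ?k) - ln (real (Suc ?m)))"
    using sum_inverse_interval_le[of "Suc ?m" ?k] mk assms by (intro add_mono frac_le) auto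
  also have "\<dots> \<le> 1 / a + (ln b - ln a)"
    using mk assms by (intro add_mono diff_mono) (auto simp del: of_nat_Suc)
  finally show ?thesis by simp
qed

lemma power_div_fact_le_exp:
  fixes x :: real
  assumes "0 \<le> x"
  shows "x ^ k / fact k \<le> exp x"
proof -
  have "(\<Sum>n\<in>{k}. x ^ n /\<^sub>R fact n) \<le> (\<Sum>n. x ^ n /\<^sub>R fact n)"
    using exp_converges[of x] assms by (intro sum_le_suminf) (auto simp: sums_iff)
  then show ?thesis using exp_converges[of x] by (simp add: sums_iff divide_inverse mult.commute)
qed

lemma power_exp_le:
  fixes v v0 :: real
  assumes "0 \<le> v" "0 < v0"
  shows "v ^ k * exp (- (1 / v0 * v)) \<le> fact k * v0 ^ k"
proof -
  have "(v / v0) ^ k / fact k \<le> exp (v / v0)"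
    using power_div_fact_le_exp[of "v / v0" k] assms by simp
  then show ?thesis using assms by (simp add: exp_minus field_simps power_divide)
qed

text \<open>With \<sigma> = 1/v0 the damping is harmless near v0. Within distance v0/2 the product
  rule applies: v^2 e^(-v/v0) has size at most v0^2 at v0 and slope at most 6 v0, while
  \<open>msum\<close> is at most 3 v0 and varies slowly, up to jumps of size e^(-v0/2). Farther away
  the global bound 8 v0^3 for the weight is enough.\<close>

lemma mweight_lipschitz:
  assumes v0: "v0 \<ge> 2"
  shows "\<bar>mweight (1 / v0) v - mweight (1 / v0) v0\<bar> \<le> 64 * v0\<^sup>2 * (\<bar>v - v0\<bar> + exp (- (v0 / 2)))"
proof -
  let ?h = "mweight (1 / v0)"
  have hb: "\<bar>?h w\<bar> \<le> 8 * v0 ^ 3" for w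
  proof (cases "w \<ge> 0")
    case True
    have "\<bar>?h w\<bar> = w\<^sup>2 * exp (- (1 / v0 * w)) * \<bar>msum (exp w)\<bar>" using True by (simp add: mweight_def abs_mult)
    also have "\<dots> \<le> w\<^sup>2 * exp (- (1 / v0 * w)) * (1 + w)"
      using abs_msum_le[of "exp w"] True by (intro mult_left_mono) auto
    also have "\<dots> = w\<^sup>2 * exp (- (1 / v0 * w)) + w ^ 3 * exp (- (1 / v0 * w))" by (simp add: algebra_simps power2_eq_square power3_eq_cube)
    also have "\<dots> \<le> fact 2 * v0\<^sup>2 + fact 3 * v0 ^ 3" using True v0 by (intro add_mono power_exp_le) auto
    also have "\<dots> \<le> 2 * v0 ^ 3 + 6 * v0 ^ 3" using v0 by (simp add: fact_numeral power_increasing)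
    finally show ?thesis by simp
  qed (use v0 in \<open>simp add: mweight_def\<close>)
  show ?thesis
  proof (cases "\<bar>v - v0\<bar> \<le> v0 / 2")
    case False
    have "\<bar>?h v - ?h v0\<bar> \<le> 16 * v0 ^ 3" using hb[of v] hb[of v0] by linarith
    also have "\<dots> = 32 * v0\<^sup>2 * (v0 / 2)" by (simp add: power2_eq_square power3_eq_cube)
    also have "\<dots> \<le> 64 * v0\<^sup>2 * (\<bar>v - v0\<bar> + exp (- (v0 / 2)))"
      using False v0 by (intro mult_mono) (auto intro: add_increasing2)
    finally show ?thesis .
  next
    case True
    define q where "q w = w\<^sup>2 * exp (- (1 / v0 * w))" for w
    have v: "v0 / 2 \<le> v" "v \<le> 3 / 2 * v0" "1 \<le> v" using True v0 by linarith+
    have dq: "\<bar>q v - q v0\<bar> \<le> 6 * v0 * \<bar>v - v0\<bar>"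
    proof -
      have "norm (q v - q v0) \<le> (6 * v0) * norm (v - v0)"
      proof (rule field_differentiable_bound)
        show "convex {v0/2..3/2 * v0}" by simp
        fix z assume z: "z \<in> {v0/2..3/2 * v0}"
        show "(q has_field_derivative (2 * z - z\<^sup>2 / v0) * exp (- (1 / v0 * z))) (at z within {v0/2..3/2 * v0})"
          unfolding q_def using v0 by (auto intro!: derivative_eq_intros simp: algebra_simps power2_eq_square)
        have "z\<^sup>2 \<le> (3/2 * v0)\<^sup>2" using z v0 by (intro power_mono) auto
        then have "z\<^sup>2 / v0 \<le> 9/4 * v0" using v0 by (simp add: field_simps power2_eq_square)
        moreover have "0 \<le> z\<^sup>2 / v0" using v0 by simp
        moreover have "z \<le> 3 / 2 * v0" "0 \<le> z" using z v0 by auto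
        ultimately have "\<bar>2 * z - z\<^sup>2 / v0\<bar> \<le> 6 * v0" using v0 by linarith
        moreover have "exp (- (1 / v0 * z)) \<le> 1" using z v0 by simp
        ultimately show "norm ((2 * z - z\<^sup>2 / v0) * exp (- (1 / v0 * z))) \<le> 6 * v0"
          using mult_mono[of "\<bar>2 * z - z\<^sup>2 / v0\<bar>" "6 * v0" "exp (- (1 / v0 * z))" 1] v0 by (simp add: abs_mult)
      qed (use v v0 in auto)
      then show ?thesis by simp
    qed
    have q0: "\<bar>q v0\<bar> \<le> v0\<^sup>2" unfolding q_def using v0 by (simp add: abs_mult)
    have m: "\<bar>msum (exp v)\<bar> \<le> 3 * v0" using abs_msum_le[of "exp v"] v v0 by simp
    have dm: "\<bar>msum (exp v) - msum (exp v0)\<bar> \<le> \<bar>v - v0\<bar> + exp (- (v0 / 2))"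
    proof -
      define a where "a = min v v0"
      define b where "b = max v v0"
      have "\<bar>msum (exp b) - msum (exp a)\<bar> \<le> ln (exp b) - ln (exp a) + 1 / exp a"
        using v v0 by (intro msum_diff_le) (auto simp: a_def b_def)
      moreover have "1 / exp a \<le> exp (- (v0 / 2))" using v v0 by (simp add: exp_minus frac_le a_def inverse_eq_divide)
      moreover have "b - a = \<bar>v - v0\<bar>" by (auto simp: a_def b_def)
      moreover have "\<bar>msum (exp b) - msum (exp a)\<bar> = \<bar>msum (exp v) - msum (exp v0)\<bar>"
        by (auto simp: a_def b_def min_def max_def)
      ultimately show ?thesis by simp
    qed
    have "?h v - ?h v0 = (q v - q v0) * msum (exp v) + q v0 * (msum (exp v) - msum (exp v0))"
      using v v0 by (simp add: mweight_def q_def algebra_simps)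
    then have "\<bar>?h v - ?h v0\<bar> \<le> \<bar>q v - q v0\<bar> * \<bar>msum (exp v)\<bar> + \<bar>q v0\<bar> * \<bar>msum (exp v) - msum (exp v0)\<bar>"
      by (simp only: abs_mult[symmetric] abs_triangle_ineq)
    also have "\<dots> \<le> (6 * v0 * \<bar>v - v0\<bar>) * (3 * v0) + v0\<^sup>2 * (\<bar>v - v0\<bar> + exp (- (v0 / 2)))"
      using dq q0 m dm v0 by (intro add_mono mult_mono) auto
    also have "\<dots> = 19 * (v0\<^sup>2 * \<bar>v - v0\<bar>) + 1 * (v0\<^sup>2 * exp (- (v0 / 2)))" by (simp add: algebra_simps power2_eq_square)
    also have "\<dots> \<le> 64 * (v0\<^sup>2 * \<bar>v - v0\<bar>) + 64 * (v0\<^sup>2 * exp (- (v0 / 2)))"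
      by (intro add_mono mult_right_mono) auto
    finally show ?thesis by (simp add: algebra_simps)
  qed
qed

text \<open>A Tauberian step. Normalising a window of width \<delta> costs 1/\<delta>, and the
  transform at u/\<delta> is at most a multiple of (|u|/\<delta>)^(-3/4), so the average is
  O(\<delta>^(-1/4)) uniformly in \<sigma>. The average differs from the value at v0 by O(v0^2
  (\<delta> + e^(-v0/2))). Division by v0^2 gives the three terms.\<close>

lemma msum_bound_aux:
  obtains C where "C > 0" "\<And>v0 \<delta>. v0 \<ge> 2 \<Longrightarrow> 0 < \<delta> \<Longrightarrow> \<delta> \<le> 1 \<Longrightarrow>
     \<bar>msum (exp v0)\<bar> \<le> C * (\<delta> powr (- (1/4)) / v0\<^sup>2 + \<delta> + exp (- (v0 / 2)))"
proof -
  obtain C where C: "C > 0" "\<And>s. 0 < Re s \<Longrightarrow> Re s \<le> 1 \<Longrightarrow> norm (mtrans s) \<le> C * (3 + norm s) powr (- (3/4))"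
    using norm_mtrans_le by metis
  define K where "K = (\<integral>u. \<bar>u\<bar> powr (- (3/4)) \<partial>std_normal_distribution)"
  have K: "K \<ge> 0" unfolding K_def by (intro integral_nonneg_AE) auto
  define C' where "C' = 3 * (C * K + 64)"
  have "\<bar>msum (exp v0)\<bar> \<le> C' * (\<delta> powr (- (1/4)) / v0\<^sup>2 + \<delta> + exp (- (v0 / 2)))"
    if v0: "v0 \<ge> 2" and \<delta>: "0 < \<delta>" "\<delta> \<le> 1" for v0 \<delta>
  proof -
    \<comment> \<open>With this \<sigma> the weight at v0 is v0^2 \<open>msum (exp v0)\<close> / e,
      so undoing the damping costs only the factor e \<le> 3 present in \<open>C'\<close>.\<close>
    let ?\<sigma> = "1 / v0" let ?h = "mweight (1 / v0)"
    let ?E = "\<lambda>v. exp (- ((v0 - v) / \<delta>)\<^sup>2 / 2)" let ?D = "normal_density v0 \<delta>"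
    have \<sigma>: "0 < ?\<sigma>" "?\<sigma> \<le> 1" using v0 by auto
    have hint: "integrable lborel ?h"
    proof -
      have "integrable lborel (\<lambda>v. of_real (?h v) :: complex)"
        using mweight_transform(1)[OF \<sigma>(1), of 0] by simp
      from integrable_Re[OF this] show ?thesis by simp
    qed
    have DE: "?D v = 1 / (sqrt (2 * pi) * \<delta>) * ?E v" for v
      using \<delta> by (simp add: normal_density_def real_sqrt_mult power_divide power2_commute)
    have ub: "\<bar>\<integral>v. ?h v * ?E v \<partial>lborel\<bar> \<le> C * K * \<delta> powr (3/4)"
    proof -
      let ?G = "\<lambda>u. exp (\<i> * of_real (u * v0 / \<delta>)) * mtrans (Complex ?\<sigma> (u / \<delta>))"
      have "\<bar>\<integral>v. ?h v * ?E v \<partial>lborel\<bar> = norm (of_real (\<integral>v. ?h v * ?E v \<partial>lborel) :: complex)" by simp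
      also have "\<dots> = norm (CLINT u|std_normal_distribution. ?G u)"
        unfolding gaussian_average_transform[OF hint \<delta>(1)] mweight_transform(2)[OF \<sigma>(1)] ..
      also have "\<dots> \<le> (\<integral>u. norm (?G u) \<partial>std_normal_distribution)" by (rule integral_norm_bound)
      also have "\<dots> \<le> (\<integral>u. C * \<delta> powr (3/4) * \<bar>u\<bar> powr (- (3/4)) \<partial>std_normal_distribution)"
      proof (rule integral_mono_AE')
        show "integrable std_normal_distribution (\<lambda>u. C * \<delta> powr (3/4) * \<bar>u\<bar> powr (- (3/4)))"
          using integrable_normal_powr by (intro integrable_mult_right) 
        have "AE u in lborel. u \<noteq> (0::real)" by (rule AE_lborel_singleton)
        then have "AE u in std_normal_distribution. u \<noteq> (0::real)" 
          by (subst AE_density) (auto elim: eventually_mono)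
        then show "AE u in std_normal_distribution. norm (?G u) \<le> C * \<delta> powr (3/4) * \<bar>u\<bar> powr (- (3/4))"
        proof eventually_elim
          case (elim u)
          have "norm (?G u) = norm (mtrans (Complex ?\<sigma> (u / \<delta>)))" by (simp add: norm_mult)
          also have "\<dots> \<le> C * (3 + norm (Complex ?\<sigma> (u / \<delta>))) powr (- (3/4))" using \<sigma> by (intro C) auto
          also have "\<dots> \<le> C * (\<bar>u\<bar> / \<delta>) powr (- (3/4))"
          proof (intro mult_left_mono powr_mono2')
            have "\<bar>u / \<delta>\<bar> \<le> norm (Complex ?\<sigma> (u / \<delta>))" using abs_Im_le_cmod[of "Complex ?\<sigma> (u / \<delta>)"] by simp
            then show "\<bar>u\<bar> / \<delta> \<le> 3 + norm (Complex ?\<sigma> (u / \<delta>))" using \<delta> by simp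
          qed (use elim \<delta> C in auto)
          also have "(\<bar>u\<bar> / \<delta>) powr (- (3/4)) = \<delta> powr (3/4) * \<bar>u\<bar> powr (- (3/4))"
            using \<delta> by (simp add: powr_divide powr_minus_divide)
          finally show ?case by simp
        qed
        show "AE u in std_normal_distribution. 0 \<le> C * \<delta> powr (3/4) * \<bar>u\<bar> powr (- (3/4))" using C by simp
      qed
      also have "\<dots> = C * K * \<delta> powr (3/4)" by (simp add: K_def)
      finally show ?thesis .
    qed
    have hD: "integrable lborel (\<lambda>v. ?h v * ?D v)"
    proof (rule Bochner_Integration.integrable_bound)
      show "integrable lborel (\<lambda>v. 1 / (sqrt (2 * pi) * \<delta>) * ?h v)"
        using hint by (rule integrable_mult_right)
      show "AE v in lborel. norm (?h v * ?D v) \<le> norm (1 / (sqrt (2 * pi) * \<delta>) * ?h v)"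
      proof (rule AE_I2)
        fix v
        have "?D v \<le> 1 / (sqrt (2 * pi) * \<delta>) * 1"
          unfolding DE using \<delta> by (intro mult_left_mono) auto
        then have "\<bar>?h v\<bar> * ?D v \<le> \<bar>?h v\<bar> * (1 / (sqrt (2 * pi) * \<delta>))"
          by (intro mult_left_mono) auto
        then show "norm (?h v * ?D v) \<le> norm (1 / (sqrt (2 * pi) * \<delta>) * ?h v)"
          using \<delta> by (simp add: abs_mult normal_density_nonneg)
      qed
    qed (use hint in auto)
    have avg: "\<bar>\<integral>v. ?h v * ?D v \<partial>lborel\<bar> \<le> C * K * \<delta> powr (- (1/4))"
    proof -
      have "(\<integral>v. ?h v * ?D v \<partial>lborel) = (\<integral>v. 1 / (sqrt (2 * pi) * \<delta>) * (?h v * ?E v) \<partial>lborel)"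
        unfolding DE by (intro Bochner_Integration.integral_cong) auto
      also have "\<dots> = 1 / (sqrt (2 * pi) * \<delta>) * (\<integral>v. ?h v * ?E v \<partial>lborel)" by (rule integral_mult_right_zero)
      finally have "\<bar>\<integral>v. ?h v * ?D v \<partial>lborel\<bar> = 1 / (sqrt (2 * pi) * \<delta>) * \<bar>\<integral>v. ?h v * ?E v \<partial>lborel\<bar>"
        using \<delta> by (simp add: abs_mult)
      also have "\<dots> \<le> 1 / \<delta> * (C * K * \<delta> powr (3/4))"
      proof (rule mult_mono[OF _ ub])
        have "1 \<le> sqrt (2 * pi)" using pi_ge_two by (intro real_le_rsqrt) auto
        then show "1 / (sqrt (2 * pi) * \<delta>) \<le> 1 / \<delta>" using \<delta> by (intro frac_le) auto
      qed (use \<delta> in auto)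
      also have "\<dots> = C * K * (\<delta> powr (3/4) / \<delta>)" by simp
      also have "\<delta> powr (3/4) / \<delta> = \<delta> powr (- (1/4))" using \<delta> powr_diff[of \<delta> "3/4" 1] by simp
      finally show ?thesis .
    qed
    have Dint: "integrable lborel (\<lambda>v. ?D v * \<bar>v - v0\<bar>)" "(\<integral>v. ?D v * \<bar>v - v0\<bar> \<partial>lborel) \<le> \<delta>"
    proof -
      have b: "has_bochner_integral lborel (\<lambda>v. ?D v * \<bar>v - v0\<bar>) (\<delta> * sqrt (2 / pi))"
        using normal_moment_abs_odd[OF \<delta>(1), of v0 0] by simp
      then show "integrable lborel (\<lambda>v. ?D v * \<bar>v - v0\<bar>)" by (rule integrable.intros)
      have "sqrt (2 / pi) \<le> 1" using pi_ge_two by simp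
      then show "(\<integral>v. ?D v * \<bar>v - v0\<bar> \<partial>lborel) \<le> \<delta>"
        unfolding has_bochner_integral_integral_eq[OF b] using \<delta> by (simp add: mult_left_le)
    qed
    have "?h v0 = (\<integral>v. ?h v0 * ?D v \<partial>lborel)" using \<delta> by simp
    also have "\<dots> = (\<integral>v. ?h v * ?D v - (?h v - ?h v0) * ?D v \<partial>lborel)"
      by (intro Bochner_Integration.integral_cong) (auto simp: algebra_simps)
    also have "\<dots> = (\<integral>v. ?h v * ?D v \<partial>lborel) - (\<integral>v. (?h v - ?h v0) * ?D v \<partial>lborel)"
      using hD \<delta> by (intro Bochner_Integration.integral_diff) (auto simp: left_diff_distrib)
    finally have "\<bar>?h v0\<bar> \<le> C * K * \<delta> powr (- (1/4)) + \<bar>\<integral>v. (?h v - ?h v0) * ?D v \<partial>lborel\<bar>"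
      using avg by linarith
    also have "\<bar>\<integral>v. (?h v - ?h v0) * ?D v \<partial>lborel\<bar> \<le> (\<integral>v. 64 * v0\<^sup>2 * (?D v * \<bar>v - v0\<bar>) + 64 * v0\<^sup>2 * exp (- (v0 / 2)) * ?D v \<partial>lborel)"
    proof -
      have "norm (\<integral>v. (?h v - ?h v0) * ?D v \<partial>lborel) \<le> (\<integral>v. norm ((?h v - ?h v0) * ?D v) \<partial>lborel)" by (rule integral_norm_bound)
      also have "\<dots> \<le> (\<integral>v. 64 * v0\<^sup>2 * (?D v * \<bar>v - v0\<bar>) + 64 * v0\<^sup>2 * exp (- (v0 / 2)) * ?D v \<partial>lborel)"
      proof (rule integral_mono')
        show "integrable lborel (\<lambda>v. 64 * v0\<^sup>2 * (?D v * \<bar>v - v0\<bar>) + 64 * v0\<^sup>2 * exp (- (v0 / 2)) * ?D v)"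
          using Dint \<delta> by (intro Bochner_Integration.integrable_add integrable_mult_right) auto
        fix v
        have D0: "?D v \<ge> 0" by (rule normal_density_nonneg)
        have "norm ((?h v - ?h v0) * ?D v) = \<bar>?h v - ?h v0\<bar> * ?D v" using D0 by (simp add: abs_mult)
        also have "\<dots> \<le> 64 * v0\<^sup>2 * (\<bar>v - v0\<bar> + exp (- (v0 / 2))) * ?D v"
          by (intro mult_right_mono mweight_lipschitz v0 D0)
        finally show "norm ((?h v - ?h v0) * ?D v) \<le> 64 * v0\<^sup>2 * (?D v * \<bar>v - v0\<bar>) + 64 * v0\<^sup>2 * exp (- (v0 / 2)) * ?D v"
          by (simp add: algebra_simps)
        show "0 \<le> 64 * v0\<^sup>2 * (?D v * \<bar>v - v0\<bar>) + 64 * v0\<^sup>2 * exp (- (v0 / 2)) * ?D v"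
          using D0 by simp
      qed
      finally show ?thesis by simp
    qed
    also have "\<dots> = 64 * v0\<^sup>2 * (\<integral>v. ?D v * \<bar>v - v0\<bar> \<partial>lborel) + 64 * v0\<^sup>2 * exp (- (v0 / 2))"
      using Dint \<delta> by (subst Bochner_Integration.integral_add) auto
    also have "\<dots> \<le> 64 * v0\<^sup>2 * \<delta> + 64 * v0\<^sup>2 * exp (- (v0 / 2))"
      using Dint by (intro add_right_mono mult_left_mono) auto
    finally have *: "\<bar>?h v0\<bar> \<le> C * K * \<delta> powr (- (1/4)) + (64 * v0\<^sup>2 * \<delta> + 64 * v0\<^sup>2 * exp (- (v0 / 2)))" by simp
    have "v0\<^sup>2 * \<bar>msum (exp v0)\<bar> = exp 1 * \<bar>?h v0\<bar>"
      using v0 by (simp add: mweight_def abs_mult exp_minus)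
    also have "\<dots> \<le> 3 * (C * K * \<delta> powr (- (1/4)) + (64 * v0\<^sup>2 * \<delta> + 64 * v0\<^sup>2 * exp (- (v0 / 2))))"
      using * exp_le by (intro mult_mono) auto
    also have "\<dots> \<le> 3 * ((C * K + 64) * \<delta> powr (- (1/4)) + ((C * K + 64) * v0\<^sup>2 * \<delta> + (C * K + 64) * v0\<^sup>2 * exp (- (v0 / 2))))"
      using C K \<delta> by (intro mult_left_mono add_mono mult_right_mono) auto
    also have "\<dots> = v0\<^sup>2 * (C' * (\<delta> powr (- (1/4)) / v0\<^sup>2 + \<delta> + exp (- (v0 / 2))))"
      using v0 by (simp add: C'_def field_simps)
    finally show ?thesis using v0 by simp
  qed
  moreover have "C' > 0" using C K by (simp add: C'_def add_nonneg_pos)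
  ultimately show ?thesis using that by blast
qed

lemma msum_bound:
  obtains C where "C > 0" "\<And>t. t \<ge> 1 \<Longrightarrow> \<bar>msum t\<bar> \<le> C * (1 + ln t) powr (- (3/2))"
proof -
  obtain C where C: "C > 0" "\<And>v0 \<delta>. v0 \<ge> 2 \<Longrightarrow> 0 < \<delta> \<Longrightarrow> \<delta> \<le> 1 \<Longrightarrow>
     \<bar>msum (exp v0)\<bar> \<le> C * (\<delta> powr (- (1/4)) / v0\<^sup>2 + \<delta> + exp (- (v0 / 2)))"
    using msum_bound_aux by metis
  have "\<bar>msum t\<bar> \<le> (40 + 40 * C) * (1 + ln t) powr (- (3/2))" if t: "t \<ge> 1" for t
  proof -
    define v where "v = ln t"
    have v: "v \<ge> 0" "t = exp v" using t by (auto simp: v_def)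
    show ?thesis
    proof (cases "v \<ge> 2")
      case False
      have "\<bar>msum t\<bar> \<le> 3" using abs_msum_le[OF t] False by (simp add: v_def)
      also have "3 \<le> 40 * (1/9 :: real)" by simp
      also have "\<dots> \<le> 40 * (1 + ln t) powr (- (3/2))"
      proof (intro mult_left_mono)
        have l: "0 < 1 + ln t" using ln_ge_zero[OF t] by linarith
        have "1 / 9 = (3::real) powr (-2)" by (simp add: powr_minus_divide)
        also have "\<dots> \<le> 3 powr (- (3/2))" by (intro powr_mono) auto
        also have "\<dots> \<le> (1 + ln t) powr (- (3/2))" using False l by (intro powr_mono2') (auto simp: v_def)
        finally show "1 / 9 \<le> (1 + ln t) powr (- (3/2))" .
      qed simp
      also have "\<dots> \<le> (40 + 40 * C) * (1 + ln t) powr (- (3/2))" using C by (intro mult_right_mono) auto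
      finally show ?thesis .
    next
      case True
      \<comment> \<open>The fluctuation term is then v^(-3/2), while \<delta>^(-1/4) / v^2 =
        v^(-13/8) is smaller. For the later sum over dyadic blocks what counts is that 3/2 exceeds
        1.\<close>
      define \<delta> where "\<delta> = v powr (- (3/2))"
      have "v powr (- (3/2)) \<le> v powr 0" using True by (intro powr_mono) auto
      then have \<delta>: "0 < \<delta>" "\<delta> \<le> 1" using True by (auto simp: \<delta>_def)
      have 1: "\<delta> powr (- (1/4)) / v\<^sup>2 \<le> v powr (- (3/2))"
      proof -
        have "\<delta> powr (- (1/4)) / v\<^sup>2 = v powr (3/8) / v powr 2" using True by (simp add: \<delta>_def powr_powr)
        also have "\<dots> = v powr (3/8 - 2)" by (simp only: powr_diff)
        also have "\<dots> \<le> v powr (- (3/2))" using True by (intro powr_mono) auto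
        finally show ?thesis .
      qed
      have 2: "exp (- (v / 2)) \<le> 8 * v powr (- (3/2))"
      proof -
        have "(v / 2)\<^sup>2 / fact 2 \<le> exp (v / 2)" using v by (intro power_div_fact_le_exp) auto
        then have "v\<^sup>2 * exp (- (v / 2)) \<le> 8" by (simp add: exp_minus field_simps power2_eq_square fact_numeral)
        then have "exp (- (v / 2)) \<le> 8 * v powr (-2)" using True by (simp add: powr_minus_divide field_simps)
        also have "\<dots> \<le> 8 * v powr (- (3/2))" using True by (intro mult_left_mono powr_mono) auto
        finally show ?thesis .
      qed
      have "\<bar>msum t\<bar> \<le> C * (\<delta> powr (- (1/4)) / v\<^sup>2 + \<delta> + exp (- (v / 2)))"
        unfolding v(2) by (intro C True \<delta>)
      also have "\<dots> \<le> C * (10 * v powr (- (3/2)))"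
        using 1 2 C by (intro mult_left_mono) (auto simp: \<delta>_def)
      also have "\<dots> \<le> C * (10 * (4 * (1 + v) powr (- (3/2))))"
      proof -
        have "(1 + v) powr (3/2) \<le> (2 * v) powr (3/2)" using True by (intro powr_mono2) auto
        also have "\<dots> = 2 powr (3/2) * v powr (3/2)" using v by (simp add: powr_mult)
        also have "\<dots> \<le> 2 powr 2 * v powr (3/2)" by (intro mult_right_mono powr_mono) auto
        finally have "v powr (- (3/2)) \<le> 4 * (1 + v) powr (- (3/2))" using True by (simp add: powr_minus_divide field_simps)
        then show ?thesis using C by (intro mult_left_mono) auto
      qed
      also have "\<dots> \<le> (40 + 40 * C) * (1 + ln t) powr (- (3/2))"
        unfolding v_def[symmetric] by (simp add: algebra_simps)
      finally show ?thesis .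
    qed
  qed
  moreover have "40 + 40 * C > 0" using C by simp
  ultimately show ?thesis using that by blast
qed

section \<open>Completely multiplicative functions bounded by one\<close>

text \<open>Values at primes may lie anywhere in [-1, 1], so that replacing the signs of large
  primes by 0 stays inside the class. Arguments are positive because the empty product gives
  \<open>rcmf w 0 = 1\<close>, which breaks multiplicativity at 0.\<close>

definition unit_cm :: "(nat \<Rightarrow> real) \<Rightarrow> bool" where
  "unit_cm u \<longleftrightarrow> u 1 = 1 \<and> (\<forall>m>0. \<forall>n>0. u (m * n) = u m * u n) \<and> (\<forall>p. prime p \<longrightarrow> \<bar>u p\<bar> \<le> 1)"

lemma unit_cmD:
  assumes "unit_cm u"
  shows "u 1 = 1" "\<And>m n. m > 0 \<Longrightarrow> n > 0 \<Longrightarrow> u (m * n) = u m * u n" "\<And>p. prime p \<Longrightarrow> \<bar>u p\<bar> \<le> 1"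
  using assms by (auto simp: unit_cm_def)

lemma unit_cm_power:
  assumes "unit_cm u" "m > 0"
  shows "u (m ^ k) = u m ^ k"
  by (induction k) (use unit_cmD[OF assms(1)] assms(2) in auto)

lemma unit_cm_abs_le:
  assumes "unit_cm u" "n > 0"
  shows "\<bar>u n\<bar> \<le> 1"
  using assms(2)
proof (induction n rule: less_induct)
  case (less n)
  show ?case
  proof (cases "n = 1")
    case True
    then show ?thesis using unit_cmD(1)[OF assms(1)] by simp
  next
    case False
    then obtain p where p: "prime p" "p dvd n" using prime_factor_nat by blast
    then obtain m where m: "n = p * m" by auto
    have "m > 0" "p > 1" using less.prems m p prime_gt_1_nat by (auto intro!: Nat.gr0I)
    then have "\<bar>u m\<bar> \<le> 1" using m by (intro less.IH) auto
    then show ?thesis unfolding m using unit_cmD(2)[OF assms(1), of p m] unit_cmD(3)[OF assms(1) p(1)] \<open>m > 0\<close> \<open>p > 1\<close>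
      by (simp add: abs_mult mult_le_one)
  qed
qed

section \<open>The convolution of u with 1 and its sums over dyadic blocks\<close>

definition divsum :: "(nat \<Rightarrow> real) \<Rightarrow> nat \<Rightarrow> real" where
  "divsum u n = (\<Sum>d | d dvd n. u d)"

lemma divsum_prime_power_mult:
  assumes u: "unit_cm u" and p: "prime p" and m: "m > 0" "\<not> p dvd m"
  shows "divsum u (p ^ k * m) = (\<Sum>i\<le>k. u p ^ i) * divsum u m"
proof (induction k)
  case (Suc k)
  have p0: "p > 0" using p prime_gt_0_nat by auto
  let ?A = "{d. d dvd p ^ k * m}" and ?B = "(*) (p ^ Suc k) ` {e. e dvd m}"
  have eq: "{d. d dvd p ^ Suc k * m} = ?A \<union> ?B"
  proof (intro set_eqI iffI)
    fix d assume "d \<in> {d. d dvd p ^ Suc k * m}"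
    then have "d dvd p ^ Suc k * m" by simp
    then obtain b c where bc: "d = b * c" "b dvd p ^ Suc k" "c dvd m" using division_decomp by blast
    then obtain i where i: "i \<le> Suc k" "b = p ^ i" using divides_primepow_nat[OF p] by blast
    show "d \<in> ?A \<union> ?B"
    proof (cases "i = Suc k")
      case True then show ?thesis using bc i by auto
    next
      case False
      then have "p ^ i dvd p ^ k" using i by (intro le_imp_power_dvd) auto
      then show ?thesis using bc i by (auto intro: mult_dvd_mono)
    qed
  next
    fix d assume "d \<in> ?A \<union> ?B"
    then show "d \<in> {d. d dvd p ^ Suc k * m}"
    proof
      assume "d \<in> ?A"
      moreover have "p ^ k * m dvd p ^ Suc k * m" by (intro mult_dvd_mono le_imp_power_dvd) auto
      ultimately show ?thesis using dvd_trans by blast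
    next
      assume "d \<in> ?B"
      then show ?thesis by (auto intro: mult_dvd_mono)
    qed
  qed
  have disj: "?A \<inter> ?B = {}"
  proof -
    have False if "e dvd m" "p ^ Suc k * e dvd p ^ k * m" for e
    proof -
      have "p ^ k * (p * e) dvd p ^ k * m" using that by (simp add: mult_ac)
      then have "p * e dvd m" using p0 by simp
      then show False using m(2) dvd_mult_left by blast
    qed
    then show ?thesis by blast
  qed
  have "divsum u (p ^ Suc k * m) = (\<Sum>d\<in>?A. u d) + (\<Sum>d\<in>?B. u d)"
    unfolding divsum_def eq using m p0 disj by (intro sum.union_disjoint) auto
  also have "(\<Sum>d\<in>?B. u d) = (\<Sum>e | e dvd m. u (p ^ Suc k * e))"
    using p0 by (subst sum.reindex) (auto simp: inj_on_def)
  also have "\<dots> = (\<Sum>e | e dvd m. u p ^ Suc k * u e)"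
  proof (intro sum.cong refl)
    fix e assume "e \<in> {e. e dvd m}"
    then have "e > 0" using m by (auto intro!: Nat.gr0I)
    then show "u (p ^ Suc k * e) = u p ^ Suc k * u e"
      using unit_cmD(2)[OF u, of "p ^ Suc k" e] unit_cm_power[OF u p0, of "Suc k"] p0 by simp
  qed
  also have "(\<Sum>d\<in>?A. u d) + \<dots> = (\<Sum>i\<le>Suc k. u p ^ i) * divsum u m"
    using Suc.IH unfolding divsum_def by (simp add: sum_distrib_left algebra_simps)
  finally show ?case .
qed (use u in simp)

text \<open>Splitting off a prime power p^k produces the factor 1 + t + ... + t^k with t = u(p),
  which is nonnegative for |t| \<le> 1 by the geometric sum formula.\<close>

lemma divsum_nonneg:
  assumes u: "unit_cm u" and "n > 0"
  shows "divsum u n \<ge> 0"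
  using assms(2)
proof (induction n rule: less_induct)
  case (less n)
  show ?case
  proof (cases "n = 1")
    case True
    then show ?thesis using unit_cmD(1)[OF u] by (simp add: divsum_def)
  next
    case False
    then obtain p where p: "prime p" "p dvd n" using prime_factor_nat by blast
    define k where "k = multiplicity p n"
    obtain m where m: "n = p ^ k * m" "\<not> p dvd m"
      using multiplicity_decompose'[of n p] p less.prems k_def by (metis not_prime_unit neq0_conv)
    have k: "k > 0" unfolding k_def using p less.prems by (simp add: prime_multiplicity_gt_zero_iff)
    have m0: "m > 0" using less.prems m by (auto intro!: Nat.gr0I)
    have "p ^ k > 1" using one_less_power[of p k] prime_gt_1_nat[OF p(1)] k by simp
    then have "m < n" using m m0 by simp
    then have IH: "divsum u m \<ge> 0" using less.IH m0 by blast
    have "(\<Sum>i\<le>k. u p ^ i) \<ge> 0"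
    proof (cases "u p = 1")
      case False
      then have lt: "u p < 1" using unit_cmD(3)[OF u p(1)] by (simp add: abs_le_iff)
      have "u p ^ Suc k \<le> \<bar>u p\<bar> ^ Suc k" by (metis abs_ge_self power_abs)
      also have "\<dots> \<le> 1" using unit_cmD(3)[OF u p(1)] by (intro power_le_one) auto
      finally have "u p ^ Suc k \<le> 1" .
      then have "(1 - u p ^ Suc k) / (1 - u p) \<ge> 0" using lt by simp
      then show ?thesis using False sum_gp0[of "u p" k] by simp
    qed simp
    then show ?thesis unfolding m(1) divsum_prime_power_mult[OF u p(1) m0 m(2)] using IH by simp
  qed
qed

lemma sum_dvd_swap:
  fixes A :: "nat \<Rightarrow> nat \<Rightarrow> real"
  assumes "s > 0"
  shows "(\<Sum>e | e dvd s. \<Sum>d | d dvd e. A d (e div d)) = (\<Sum>d | d dvd s. \<Sum>c | c dvd s div d. A d c)"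
proof -
  have fin: "finite {d. d dvd s}" "\<And>e. e dvd s \<Longrightarrow> finite {d. d dvd e}" "\<And>e. e dvd s \<Longrightarrow> finite {c. c dvd s div e}"
    using assms by (auto intro!: finite_divisors_nat Nat.gr0I)
  have "(\<Sum>e | e dvd s. \<Sum>d | d dvd e. A d (e div d)) = (\<Sum>(e,d)\<in>(SIGMA e:{e. e dvd s}. {d. d dvd e}). A d (e div d))"
    using fin by (subst sum.Sigma) auto
  also have "\<dots> = (\<Sum>(d,c)\<in>(SIGMA d:{d. d dvd s}. {c. c dvd s div d}). A d c)"
  proof (rule sum.reindex_bij_witness[where i = "\<lambda>(d,c). (d*c, d)" and j = "\<lambda>(e,d). (d, e div d)"], goal_cases)
    case (2 a)
    then obtain e d where a: "a = (e, d)" "e dvd s" "d dvd e" by auto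
    then have "d dvd s" using dvd_trans by blast
    moreover have "e div d dvd s div d" using a by (intro div_dvd_div[THEN iffD2]) auto
    ultimately show ?case using a by auto
  next
    case (3 b)
    then obtain d c where "b = (d, c)" "d dvd s" "c dvd s div d" by auto
    moreover have "d > 0" using calculation assms by (auto intro!: Nat.gr0I)
    ultimately show ?case by auto
  next
    case (4 b)
    then obtain d c where b: "b = (d, c)" "d dvd s" "c dvd s div d" by auto
    then have "d * c dvd d * (s div d)" by (intro mult_dvd_mono) auto
    then show ?case using b by auto
  qed auto
  also have "\<dots> = (\<Sum>d | d dvd s. \<Sum>c | c dvd s div d. A d c)"
    using fin by (subst sum.Sigma) auto
  finally show ?thesis .
qed

lemma sum_dvd_reflect:
  fixes h :: "nat \<Rightarrow> real"
  assumes "s > 0"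
  shows "(\<Sum>d | d dvd s. h (s div d)) = (\<Sum>d | d dvd s. h d)"
  by (rule sum.reindex_bij_witness[where i = "\<lambda>d. s div d" and j = "\<lambda>d. s div d"])
     (use assms in \<open>auto simp: dvd_div_eq_0_iff\<close>)

text \<open>Since \<open>ln = \<Lambda> * 1\<close>, multiplication by \<open>ln\<close> turns \<open>1 * u\<close> into \<open>(\<Lambda> + \<Lambda> u) * 1 * u\<close>.\<close>
lemma divsum_ln_le:
  assumes u: "unit_cm u" and s: "s > 0"
  shows "divsum u s * ln (real s) \<le> 2 * (\<Sum>d | d dvd s. divsum u d * mangoldt (s div d))"
proof -
  have pos: "d > 0" if "d dvd s" for d using that s by (auto intro!: Nat.gr0I)
  have "divsum u s * ln (real s) = (\<Sum>e | e dvd s. u e * (ln (real e) + ln (real (s div e))))"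
    unfolding divsum_def sum_distrib_right
  proof (intro sum.cong refl)
    fix e assume "e \<in> {e. e dvd s}"
    then obtain c where c: "s = e * c" by auto
    then have "e > 0" "c > 0" using s by (auto intro!: Nat.gr0I)
    then show "u e * ln (real s) = u e * (ln (real e) + ln (real (s div e)))"
      by (simp add: c ln_mult)
  qed
  also have "\<dots> = (\<Sum>e | e dvd s. u e * ln (real e)) + (\<Sum>e | e dvd s. u e * ln (real (s div e)))"
    by (simp add: distrib_left sum.distrib)
  also have "(\<Sum>e | e dvd s. u e * ln (real e)) = (\<Sum>e | e dvd s. \<Sum>d | d dvd e. mangoldt d * u d * u (e div d))"
  proof (intro sum.cong refl)
    fix e assume "e \<in> {e. e dvd s}"
    then have e: "e > 0" using pos by auto
    have "u e * ln (real e) = (\<Sum>d | d dvd e. mangoldt d * u e)"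
      using mangoldt_sum[of e, where ?'a = real] e by (simp add: sum_distrib_right[symmetric])
    also have "\<dots> = (\<Sum>d | d dvd e. mangoldt d * u d * u (e div d))"
    proof (intro sum.cong refl)
      fix d assume "d \<in> {d. d dvd e}"
      then obtain c where "e = d * c" by auto
      then show "mangoldt d * u e = mangoldt d * u d * u (e div d)"
        using e unit_cmD(2)[OF u, of d c] by auto
    qed
    finally show "u e * ln (real e) = (\<Sum>d | d dvd e. mangoldt d * u d * u (e div d))" .
  qed
  also have "\<dots> = (\<Sum>d | d dvd s. \<Sum>c | c dvd s div d. mangoldt d * u d * u c)"
    by (rule sum_dvd_swap[OF s])
  also have "\<dots> = (\<Sum>d | d dvd s. mangoldt d * u d * divsum u (s div d))"
    by (simp add: divsum_def sum_distrib_left)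
  also have "(\<Sum>e | e dvd s. u e * ln (real (s div e))) = (\<Sum>e | e dvd s. \<Sum>d | d dvd s div e. u e * mangoldt d)"
  proof (intro sum.cong refl)
    fix e assume "e \<in> {e. e dvd s}"
    then have "s div e \<noteq> 0" using s pos by (auto simp: dvd_div_eq_0_iff)
    then show "u e * ln (real (s div e)) = (\<Sum>d | d dvd s div e. u e * mangoldt d)"
      using mangoldt_sum[of "s div e", where ?'a = real] by (simp add: sum_distrib_left[symmetric])
  qed
  also have "\<dots> = (\<Sum>e | e dvd s. \<Sum>d | d dvd e. u d * mangoldt (e div d))"
    by (rule sum_dvd_swap[OF s, symmetric])
  also have "\<dots> = (\<Sum>e | e dvd s. \<Sum>d | d dvd e. mangoldt d * u (e div d))"
  proof (rule sum.cong[OF refl])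
    fix e assume "e \<in> {e. e dvd s}"
    then have e: "e > 0" using pos by auto
    have "(\<Sum>d | d dvd e. u d * mangoldt (e div d)) = (\<Sum>d | d dvd e. (\<lambda>c. u (e div c) * mangoldt c) (e div d))"
      using e by (intro sum.cong refl) auto
    also have "\<dots> = (\<Sum>d | d dvd e. u (e div d) * mangoldt d)" by (rule sum_dvd_reflect[OF e])
    finally show "(\<Sum>d | d dvd e. u d * mangoldt (e div d)) = (\<Sum>d | d dvd e. mangoldt d * u (e div d))"
      by (simp add: mult.commute)
  qed
  also have "\<dots> = (\<Sum>d | d dvd s. \<Sum>c | c dvd s div d. mangoldt d * u c)"
    by (rule sum_dvd_swap[OF s])
  also have "\<dots> = (\<Sum>d | d dvd s. mangoldt d * divsum u (s div d))"
    by (simp add: divsum_def sum_distrib_left)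
  finally have "divsum u s * ln (real s) = (\<Sum>d | d dvd s. mangoldt d * u d * divsum u (s div d)) + (\<Sum>d | d dvd s. mangoldt d * divsum u (s div d))" .
  also have "\<dots> \<le> (\<Sum>d | d dvd s. mangoldt d * divsum u (s div d)) + (\<Sum>d | d dvd s. mangoldt d * divsum u (s div d))"
  proof (intro add_right_mono sum_mono)
    fix d assume "d \<in> {d. d dvd s}"
    then obtain c where "s = d * c" by auto
    then have d: "d > 0" "s div d > 0" using s by (auto intro!: Nat.gr0I)
    have "mangoldt d * u d * divsum u (s div d) \<le> mangoldt d * 1 * divsum u (s div d)"
      using unit_cm_abs_le[OF u d(1)] divsum_nonneg[OF u d(2)]
      by (intro mult_right_mono mult_left_mono) (auto simp: mangoldt_nonneg)
    then show "mangoldt d * u d * divsum u (s div d) \<le> mangoldt d * divsum u (s div d)" by simp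
  qed
  also have "\<dots> = 2 * (\<Sum>d | d dvd s. mangoldt d * divsum u (s div d))" by simp
  also have "(\<Sum>d | d dvd s. mangoldt d * divsum u (s div d)) = (\<Sum>d | d dvd s. (\<lambda>c. divsum u c * mangoldt (s div c)) (s div d))"
    using s by (intro sum.cong refl) (auto simp: mult.commute)
  also have "\<dots> = (\<Sum>d | d dvd s. divsum u d * mangoldt (s div d))" by (rule sum_dvd_reflect[OF s])
  finally show ?thesis .
qed

lemma nat_floor_div:
  assumes "t \<ge> 0" "s > 0"
  shows "nat \<lfloor>t / real s\<rfloor> = nat \<lfloor>t\<rfloor> div s"
proof -
  have "k \<le> nat \<lfloor>t / real s\<rfloor> \<longleftrightarrow> k \<le> nat \<lfloor>t\<rfloor> div s" for k
  proof -
    have "k \<le> nat \<lfloor>t / real s\<rfloor> \<longleftrightarrow> real k \<le> t / real s" using assms by (simp add: le_nat_iff le_floor_iff)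
    also have "\<dots> \<longleftrightarrow> real (k * s) \<le> t" using assms by (simp add: field_simps)
    also have "\<dots> \<longleftrightarrow> k * s \<le> nat \<lfloor>t\<rfloor>" using assms by (simp add: le_nat_iff le_floor_iff)
    also have "\<dots> \<longleftrightarrow> k \<le> nat \<lfloor>t\<rfloor> div s" using assms by (simp add: less_eq_div_iff_mult_less_eq)
    finally show ?thesis .
  qed
  then show ?thesis by (meson dual_order.antisym order_refl)
qed

text \<open>Moebius inversion in summed form. After the exchange of sums, the coefficient of u(e)/e
  is the sum over m \<le> k of M(k div m) / m, where k = N div e and M denotes the partial sums of
  \<mu>(c)/c. It equals 1, since the convolution of \<mu> with 1 vanishes beyond 1.\<close>

lemma sum_eq_divsum_msum:
  assumes t: "t \<ge> 0"
  shows "(\<Sum>n=1..nat \<lfloor>t\<rfloor>. u n / real n) = (\<Sum>s=1..nat \<lfloor>t\<rfloor>. divsum u s / real s * msum (t / real s))"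
proof -
  let ?N = "nat \<lfloor>t\<rfloor>"
  let ?M = "\<lambda>k. \<Sum>c=1..k. moebius c / real c"
  have one: "(\<Sum>m=1..k. 1 / real m * ?M (k div m)) = (if k = 0 then 0 else 1)" for k
  proof -
    have "(\<Sum>m=1..k. 1 / real m * ?M (k div m)) = (\<Sum>m=1..k. \<Sum>c=1..k div m. 1 / real m * (moebius c / real c))"
      by (simp add: sum_distrib_left)
    also have "\<dots> = (\<Sum>j=1..k. \<Sum>m | m dvd j. 1 / real m * (moebius (j div m) / real (j div m)))"
      by (rule sum_divisors_swap[symmetric])
    also have "\<dots> = (\<Sum>j=1..k. if j = 1 then 1 else 0)"
    proof (intro sum.cong refl)
      fix j assume j: "j \<in> {1..k}"
      have "(\<Sum>m | m dvd j. 1 / real m * (moebius (j div m) / real (j div m))) = (\<Sum>m | m dvd j. (\<lambda>c. moebius c / real j) (j div m))"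
        using j by (intro sum.cong refl) (auto elim!: dvdE)
      also have "\<dots> = (\<Sum>c | c dvd j. moebius c / real j)" using j by (intro sum_dvd_reflect) auto
      also have "\<dots> = (\<Sum>c | c dvd j. moebius c) / real j" by (simp add: sum_divide_distrib)
      also have "\<dots> = (if j = 1 then 1 else 0)" using sum_moebius_dvd[of j] j by auto
      finally show "(\<Sum>m | m dvd j. 1 / real m * (moebius (j div m) / real (j div m))) = (if j = 1 then 1 else 0)" .
    qed
    also have "\<dots> = (if k = 0 then 0 else 1)" by simp
    finally show ?thesis .
  qed
  have "(\<Sum>s=1..?N. divsum u s / real s * msum (t / real s)) = (\<Sum>s=1..?N. \<Sum>e | e dvd s. u e / real e * (1 / real (s div e) * ?M (?N div e div (s div e))))"
  proof (intro sum.cong refl)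
    fix s assume s: "s \<in> {1..?N}"
    have "divsum u s / real s * msum (t / real s) = (\<Sum>e | e dvd s. u e * (1 / real s * ?M (?N div s)))"
    proof -
      have "divsum u s / real s * X = (\<Sum>e | e dvd s. u e * (1 / real s * X))" for X
        by (simp add: divsum_def sum_distrib_right sum_divide_distrib)
      moreover have "msum (t / real s) = ?M (?N div s)"
        unfolding msum_def using nat_floor_div[OF t, of s] s by simp
      ultimately show ?thesis by simp
    qed
    also have "\<dots> = (\<Sum>e | e dvd s. u e / real e * (1 / real (s div e) * ?M (?N div e div (s div e))))"
    proof (intro sum.cong refl)
      fix e assume "e \<in> {e. e dvd s}"
      then obtain c where "s = e * c" by auto
      then show "u e * (1 / real s * ?M (?N div s)) = u e / real e * (1 / real (s div e) * ?M (?N div e div (s div e)))"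
        using s by (auto simp: div_mult2_eq)
    qed
    finally show "divsum u s / real s * msum (t / real s) = (\<Sum>e | e dvd s. u e / real e * (1 / real (s div e) * ?M (?N div e div (s div e))))" .
  qed
  also have "\<dots> = (\<Sum>e=1..?N. \<Sum>m=1..?N div e. u e / real e * (1 / real m * ?M (?N div e div m)))"
    by (rule sum_divisors_swap)
  also have "\<dots> = (\<Sum>e=1..?N. u e / real e * (\<Sum>m=1..?N div e. 1 / real m * ?M (?N div e div m)))"
    by (simp add: sum_distrib_left)
  also have "\<dots> = (\<Sum>e=1..?N. u e / real e)"
    unfolding one by (intro sum.cong refl) (auto simp: div_eq_0_iff)
  finally show ?thesis by simp
qed

text \<open>Inserting ln a \<le> ln s and the inequality for g(s) ln s leaves, for each d, the sum
  of \<Lambda>(m)/m over a/d < m \<le> 2a/d. On such a range of bounded ratio Mertens gives at most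
  6, so a block is smaller than the full sum by a factor of order ln a.\<close>

lemma divsum_dyadic_le:
  assumes u: "unit_cm u" and a: "a \<ge> 1"
  shows "ln a * (\<Sum>s | a < real s \<and> real s \<le> 2 * a. divsum u s / real s) \<le> 12 * (\<Sum>m=1..nat \<lfloor>2 * a\<rfloor>. divsum u m / real m)"
proof -
  let ?N = "nat \<lfloor>2 * a\<rfloor>"
  have S: "{s. a < real s \<and> real s \<le> 2 * a} = {s\<in>{1..?N}. a < real s}"
    using a by (auto simp: le_nat_iff le_floor_iff)
  define F where "F d m = (if a < real (d * m) then (divsum u d / real d) * (mangoldt m / real m) else 0)" for d m :: nat
  have "ln a * (\<Sum>s | a < real s \<and> real s \<le> 2 * a. divsum u s / real s) = (\<Sum>s\<in>{s\<in>{1..?N}. a < real s}. divsum u s / real s * ln a)"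
    unfolding S by (simp add: sum_distrib_left mult.commute)
  also have "\<dots> \<le> (\<Sum>s\<in>{s\<in>{1..?N}. a < real s}. divsum u s / real s * ln (real s))"
    using a divsum_nonneg[OF u] by (intro sum_mono mult_left_mono) auto
  also have "\<dots> \<le> (\<Sum>s\<in>{s\<in>{1..?N}. a < real s}. 2 * (\<Sum>d | d dvd s. F d (s div d)))"
  proof (intro sum_mono)
    fix s assume s: "s \<in> {s\<in>{1..?N}. a < real s}"
    then have s0: "s > 0" by auto
    have "divsum u s / real s * ln (real s) = divsum u s * ln (real s) / real s" by simp
    also have "\<dots> \<le> 2 * (\<Sum>d | d dvd s. divsum u d * mangoldt (s div d)) / real s"
      by (intro divide_right_mono divsum_ln_le u s0) auto
    also have "\<dots> = 2 * (\<Sum>d | d dvd s. divsum u d * mangoldt (s div d) / real s)"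
      by (simp only: sum_divide_distrib[symmetric] times_divide_eq_right)
    also have "(\<Sum>d | d dvd s. divsum u d * mangoldt (s div d) / real s) = (\<Sum>d | d dvd s. F d (s div d))"
      using s by (intro sum.cong refl) (auto simp: F_def elim!: dvdE)
    finally show "divsum u s / real s * ln (real s) \<le> 2 * (\<Sum>d | d dvd s. F d (s div d))" .
  qed
  also have "\<dots> = 2 * (\<Sum>s\<in>{s\<in>{1..?N}. a < real s}. \<Sum>d | d dvd s. F d (s div d))"
    by (simp add: sum_distrib_left)
  also have "(\<Sum>s\<in>{s\<in>{1..?N}. a < real s}. \<Sum>d | d dvd s. F d (s div d)) \<le> (\<Sum>s\<in>{1..?N}. \<Sum>d | d dvd s. F d (s div d))"
  proof (intro sum_mono2 sum_nonneg)
    fix s d assume "s \<in> {1..?N} - {s\<in>{1..?N}. a < real s}" "d \<in> {d. d dvd s}"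
    then have "d > 0" by (auto intro!: Nat.gr0I)
    then show "0 \<le> F d (s div d)" using divsum_nonneg[OF u] by (auto simp: F_def mangoldt_nonneg)
  qed auto
  also have "\<dots> = (\<Sum>d=1..?N. \<Sum>m=1..?N div d. F d m)" by (rule sum_divisors_swap)
  also have "\<dots> \<le> (\<Sum>d=1..?N. divsum u d / real d * 6)"
  proof (intro sum_mono)
    fix d assume d: "d \<in> {1..?N}"
    define z where "z = nat \<lfloor>a / real d\<rfloor>"
    have g: "divsum u d / real d \<ge> 0" using d divsum_nonneg[OF u, of d] by simp
    have Nd: "?N div d = nat \<lfloor>2 * a / real d\<rfloor>" using nat_floor_div[of "2 * a" d] a d by simp
    have Nd': "real (?N div d) \<le> 2 * (a / real d)" unfolding Nd using a by simp
    have "(\<Sum>m=1..?N div d. F d m) = (\<Sum>m\<in>{m\<in>{1..?N div d}. a < real (d * m)}. (divsum u d / real d) * (mangoldt m / real m))"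
      unfolding F_def by (rule sum.inter_filter[symmetric]) simp
    also have "\<dots> = divsum u d / real d * (\<Sum>m\<in>{m\<in>{1..?N div d}. a < real (d * m)}. mangoldt m / real m)"
      by (simp add: sum_distrib_left)
    finally have eq: "(\<Sum>m=1..?N div d. F d m) = divsum u d / real d * (\<Sum>m\<in>{m\<in>{1..?N div d}. a < real (d * m)}. mangoldt m / real m)" .
    have le6: "(\<Sum>m\<in>{m\<in>{1..?N div d}. a < real (d * m)}. mangoldt m / real m :: real) \<le> 6"
    proof (cases "z \<ge> 1")
      case True
      have "(\<Sum>m\<in>{m\<in>{1..?N div d}. a < real (d * m)}. mangoldt m / real m :: real) \<le> (\<Sum>m\<in>{z<..?N div d}. mangoldt m / real m)"
      proof (intro sum_mono2)
        show "{m \<in> {1..?N div d}. a < real (d * m)} \<subseteq> {z<..?N div d}"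
        proof safe
          fix m assume "a < real (d * m)" "m \<in> {1..?N div d}"
          then have "a / real d < real m" using d by (simp add: field_simps)
          moreover have "0 \<le> a / real d" using a by simp
          ultimately have "z < m" unfolding z_def by linarith
          then show "m \<in> {z<..?N div d}" using \<open>m \<in> {1..?N div d}\<close> by auto
        qed
      qed (auto simp: mangoldt_nonneg)
      also have "\<dots> \<le> ln (real (?N div d)) - ln (real z) + 4"
      proof (rule sum_mangoldt_interval_le[OF True])
        show "z \<le> ?N div d" unfolding Nd z_def using a d by (intro nat_mono floor_mono) (simp add: field_simps)
      qed
      also have "\<dots> \<le> 6"
      proof -
        have z1: "a / real d \<le> 2 * real z" using True unfolding z_def by linarith
        have "real (?N div d) \<le> 4 * real z" using Nd' z1 by linarith
        moreover have "?N div d \<ge> 1" using d by (simp add: div_greater_zero_iff Suc_le_eq)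
        ultimately have "ln (real (?N div d)) \<le> ln (4 * real z)" using True by simp
        also have "\<dots> = ln 4 + ln (real z)" using True by (simp add: ln_mult)
        also have "ln 4 \<le> (2::real)" using ln_2_less_1 ln_realpow[of 2 2] by simp
        finally show ?thesis by simp
      qed
      finally show ?thesis .
    next
      \<comment> \<open>Here 2a/d < 2, so m = 1 is the only candidate, and \<Lambda>(1) = 0.\<close>
      case False
      then have "a / real d < 1" unfolding z_def using a by linarith
      then have "real (?N div d) < 2" using Nd' by linarith
      then have "?N div d \<le> 1" by simp
      then have "(\<Sum>m\<in>{m\<in>{1..?N div d}. a < real (d * m)}. mangoldt m / real m :: real) = 0"
        by (intro sum.neutral) (auto simp: le_Suc_eq)
      then show ?thesis by simp
    qed
    show "(\<Sum>m=1..?N div d. F d m) \<le> divsum u d / real d * 6" unfolding eq by (rule mult_left_mono[OF le6 g])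
  qed
  finally show ?thesis by (simp add: sum_distrib_right sum_distrib_left)
qed

section \<open>Euler products and the upper bound for smooth sums\<close>

definition Fprod :: "(nat \<Rightarrow> real) \<Rightarrow> nat \<Rightarrow> real" where
  "Fprod u y = (\<Prod>p | prime p \<and> p \<le> y. 1 / (1 - u p / real p))"

definition Ssum :: "(nat \<Rightarrow> real) \<Rightarrow> real \<Rightarrow> real" where
  "Ssum u t = (\<Sum>n=1..nat \<lfloor>t\<rfloor>. u n / real n)"

lemma smooth_mult_iff: "m > 0 \<Longrightarrow> n > 0 \<Longrightarrow> m * n \<in> smooth N \<longleftrightarrow> m \<in> smooth N \<and> n \<in> smooth N"
  by (auto simp: smooth_def prime_dvd_mult_iff)

lemma atLeastAtMost_subset_smooth: "{1..N} \<subseteq> smooth N"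
  by (auto simp: smooth_def dest: dvd_imp_le)

lemma unit_cm_factor_bounds:
  assumes "unit_cm u" "prime p"
  shows "1 - 1 / real p > 0" "1 - u p / real p \<ge> 1 - 1 / real p" "1 - u p / real p \<le> 1 + 1 / real p"
proof -
  have p: "real p > 1" using assms prime_gt_1_nat by simp
  then show "1 - 1 / real p > 0" by simp
  have "\<bar>u p / real p\<bar> \<le> 1 / real p" using unit_cmD(3)[OF assms] p by (simp add: divide_right_mono)
  then show "1 - u p / real p \<ge> 1 - 1 / real p" "1 - u p / real p \<le> 1 + 1 / real p" by linarith+
qed

lemma Fprod_pos: "unit_cm u \<Longrightarrow> Fprod u y > 0"
  unfolding Fprod_def
proof (intro prod_pos)
  fix p assume "unit_cm u" "p \<in> {p. prime p \<and> p \<le> y}"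
  then show "0 < 1 / (1 - u p / real p)" using unit_cm_factor_bounds[of u p] by simp
qed

text \<open>The extreme case is u(p) = -1: each factor is at least 1/(1 + 1/p) \<ge> 1 - 1/p, and
  Mertens bounds the reciprocal product from above.\<close>

lemma Fprod_ge:
  obtains C where "C \<ge> 1" "\<And>u y. unit_cm u \<Longrightarrow> y \<ge> 2 \<Longrightarrow> Fprod u y \<ge> 1 / (C * ln (real y))"
proof -
  obtain C where C: "C \<ge> 1" "\<And>y. 2 \<le> y \<Longrightarrow> (\<Prod>p | prime p \<and> p \<le> y. 1 / (1 - 1 / real p)) \<le> C * ln (real y)"
    using prod_primes_le by metis
  have "Fprod u y \<ge> 1 / (C * ln (real y))" if u: "unit_cm u" and y: "y \<ge> 2" for u y
  proof -
    let ?P = "\<Prod>p | prime p \<and> p \<le> y. 1 / (1 - 1 / real p)"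
    have P0: "?P > 0" by (intro prod_pos) (use unit_cm_factor_bounds(1)[OF u] in auto)
    have "1 / (C * ln (real y)) \<le> 1 / ?P" using C(2)[OF y] P0 by (intro divide_left_mono) auto
    also have "\<dots> = (\<Prod>p | prime p \<and> p \<le> y. 1 - 1 / real p)"
      by (simp add: prod_dividef)
    also have "\<dots> \<le> Fprod u y" unfolding Fprod_def
    proof (intro prod_mono conjI)
      fix p assume "p \<in> {p. prime p \<and> p \<le> y}"
      then have p: "prime p" by simp
      note b = unit_cm_factor_bounds[OF u p]
      show "0 \<le> 1 - 1 / real p" using b by simp
      have "(1 - 1 / real p) * (1 - u p / real p) \<le> (1 - 1 / real p) * (1 + 1 / real p)"
        using b by (intro mult_left_mono) auto
      also have "\<dots> = 1 - (1 / real p)\<^sup>2" by (simp add: algebra_simps power2_eq_square)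
      also have "\<dots> \<le> 1" by simp
      finally show "1 - 1 / real p \<le> 1 / (1 - u p / real p)" using b by (simp add: pos_le_divide_eq)
    qed
    finally show ?thesis .
  qed
  then show ?thesis by (rule that[OF C(1)])
qed

text \<open>Adding primes shrinks the Euler product by no more than the product of 1 + 1/p over the
  new primes.\<close>

lemma Fprod_ratio_le:
  obtains C where "C \<ge> 1" "\<And>u z y. unit_cm u \<Longrightarrow> 2 \<le> z \<Longrightarrow> z \<le> y \<Longrightarrow> Fprod u z \<le> C * (ln (real y) / ln (real z)) * Fprod u y"
proof -
  obtain C where C: "C \<ge> 1" "\<And>z y. 2 \<le> z \<Longrightarrow> z \<le> y \<Longrightarrow> (\<Prod>p | prime p \<and> z < p \<and> p \<le> y. 1 + 1 / real p) \<le> C * (ln (real y) / ln (real z))"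
    by (rule prod_primes_interval_le) blast
  have "Fprod u z \<le> C * (ln (real y) / ln (real z)) * Fprod u y" if u: "unit_cm u" and zy: "2 \<le> z" "z \<le> y" for u z y
  proof -
    let ?I = "{p. prime p \<and> z < p \<and> p \<le> y}"
    have eq: "{p. prime p \<and> p \<le> y} = {p. prime p \<and> p \<le> z} \<union> ?I" using zy by auto
    have Fy: "Fprod u y = Fprod u z * (\<Prod>p\<in>?I. 1 / (1 - u p / real p))"
      unfolding Fprod_def eq by (rule prod.union_disjoint) auto
    have "(\<Prod>p\<in>?I. 1 / (1 - u p / real p)) * (\<Prod>p\<in>?I. 1 - u p / real p) = 1"
      unfolding prod.distrib[symmetric]
    proof (intro prod.neutral ballI)
      fix p assume "p \<in> ?I"
      then have p: "prime p" by simp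
      have "1 - u p / real p > 0" using unit_cm_factor_bounds(1,2)[OF u p] by linarith
      then have "1 - u p / real p \<noteq> 0" by linarith
      then show "1 / (1 - u p / real p) * (1 - u p / real p) = 1" by (simp only: times_divide_eq_left mult_1_left) (rule divide_self)
    qed
    then have "Fprod u z = Fprod u y * (\<Prod>p\<in>?I. 1 - u p / real p)" unfolding Fy by (simp add: mult.assoc)
    also have "\<dots> \<le> Fprod u y * (C * (ln (real y) / ln (real z)))"
    proof (rule mult_left_mono)
      have "(\<Prod>p\<in>?I. 1 - u p / real p) \<le> (\<Prod>p\<in>?I. 1 + 1 / real p)"
      proof (rule prod_mono)
        fix p assume "p \<in> ?I"
        then have p: "prime p" by simp
        show "0 \<le> 1 - u p / real p \<and> 1 - u p / real p \<le> 1 + 1 / real p"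
          using unit_cm_factor_bounds[OF u p] by linarith
      qed
      also have "\<dots> \<le> C * (ln (real y) / ln (real z))" by (rule C(2)[OF zy])
      finally show "(\<Prod>p\<in>?I. 1 - u p / real p) \<le> C * (ln (real y) / ln (real z))" .
      show "0 \<le> Fprod u y" using Fprod_pos[OF u, of y] by simp
    qed
    finally show ?thesis by (simp add: mult_ac)
  qed
  then show ?thesis by (rule that[OF C(1)])
qed

lemma has_sum_unit_cm_smooth:
  assumes u: "unit_cm u"
  shows "(\<lambda>n. norm (u n / real n)) summable_on smooth N" "((\<lambda>n. u n / real n) has_sum Fprod u N) (smooth N)"
proof -
  have "(\<lambda>n. norm (u n / real n)) summable_on smooth N \<and> ((\<lambda>n. u n / real n) has_sum (\<Prod>p | prime p \<and> p \<le> N. 1 / (1 - u p / real p))) (smooth N)"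
  proof (rule has_sum_smooth)
    fix p :: nat assume p: "prime p"
    have "\<bar>u p\<bar> / real p \<le> 1 / real p" using unit_cmD(3)[OF u p] by (simp add: divide_right_mono)
    also have "\<dots> < 1" using prime_gt_1_nat[OF p] by simp
    finally show "norm (u p / real p) < 1" by simp
  qed (use unit_cmD[OF u] in auto)
  then show "(\<lambda>n. norm (u n / real n)) summable_on smooth N" "((\<lambda>n. u n / real n) has_sum Fprod u N) (smooth N)"
    by (auto simp: Fprod_def)
qed

text \<open>By nonnegativity the sum may be extended from m \<le> w to all w-smooth m, where the
  Dirichlet product of two series becomes a product of two Euler products.\<close>

lemma sum_divsum_le_prod:
  assumes u: "unit_cm u"
  shows "(\<Sum>m=1..w. divsum u m / real m) \<le> (\<Prod>p | prime p \<and> p \<le> w. 1 / (1 - 1 / real p)) * Fprod u w"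
proof -
  have one: "unit_cm (\<lambda>n. 1)" by (simp add: unit_cm_def)
  define A where "A v n = (if n \<in> smooth w then v n / real n else 0)" for v :: "nat \<Rightarrow> real" and n
  have sub: "smooth w \<subseteq> {1..}" by (auto simp: smooth_def)
  have A: "(\<lambda>n. norm (A v n)) summable_on {1..}" "infsum (A v) {1..} = Fprod v w" if "unit_cm v" for v
  proof -
    have "(\<lambda>n. norm (A v n)) summable_on {1..} \<longleftrightarrow> (\<lambda>n. norm (v n / real n)) summable_on smooth w"
      by (rule summable_on_cong_neutral) (use sub in \<open>auto simp: A_def\<close>)
    then show "(\<lambda>n. norm (A v n)) summable_on {1..}" using has_sum_unit_cm_smooth(1)[OF that] by simp
    have "(A v has_sum Fprod v w) {1..} \<longleftrightarrow> ((\<lambda>n. v n / real n) has_sum Fprod v w) (smooth w)"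
      by (rule has_sum_cong_neutral) (use sub in \<open>auto simp: A_def\<close>)
    then show "infsum (A v) {1..} = Fprod v w" using has_sum_unit_cm_smooth(2)[OF that] by (simp add: infsumI)
  qed
  have hs: "((\<lambda>n. \<Sum>d | d dvd n. A (\<lambda>_. 1) d * A u (n div d)) has_sum (Fprod (\<lambda>_. 1) w * Fprod u w)) {1..}"
    using has_sum_dirichlet_prod[OF A(1)[OF one] A(1)[OF u]] A(2)[OF one] A(2)[OF u] by simp
  have trm: "(\<Sum>d | d dvd n. A (\<lambda>_. 1) d * A u (n div d)) = (if n \<in> smooth w then divsum u n / real n else 0)" if n: "n > 0" for n
  proof -
    have "(\<Sum>d | d dvd n. A (\<lambda>_. 1) d * A u (n div d)) = (\<Sum>d | d dvd n. (\<lambda>c. if n \<in> smooth w then u c / real n else 0) (n div d))"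
    proof (intro sum.cong refl)
      fix d assume "d \<in> {d. d dvd n}"
      then obtain c where c: "n = d * c" by auto
      then have "d > 0" "c > 0" using n by (auto intro!: Nat.gr0I)
      then show "A (\<lambda>_. 1) d * A u (n div d) = (\<lambda>c. if n \<in> smooth w then u c / real n else 0) (n div d)"
        using smooth_mult_iff[of d c w] by (auto simp: A_def c)
    qed
    also have "\<dots> = (\<Sum>d | d dvd n. if n \<in> smooth w then u d / real n else 0)" by (rule sum_dvd_reflect[OF n])
    also have "\<dots> = (if n \<in> smooth w then divsum u n / real n else 0)"
      by (simp add: divsum_def sum_divide_distrib)
    finally show ?thesis .
  qed
  have "(\<Sum>m=1..w. divsum u m / real m) = (\<Sum>n\<in>{1..w}. \<Sum>d | d dvd n. A (\<lambda>_. 1) d * A u (n div d))"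
    using atLeastAtMost_subset_smooth[of w] by (intro sum.cong refl) (subst trm, auto)
  also have "\<dots> \<le> Fprod (\<lambda>_. 1) w * Fprod u w"
    by (rule finite_sum_le_has_sum[OF hs]) (use divsum_nonneg[OF u] in \<open>auto simp: trm\<close>)
  finally show ?thesis by (simp add: Fprod_def)
qed

lemma Fprod_eq_of_support:
  assumes "\<And>p. prime p \<Longrightarrow> y < p \<Longrightarrow> u p = 0" "y \<le> w"
  shows "Fprod u w = Fprod u y"
  unfolding Fprod_def by (rule prod.mono_neutral_right) (use assms in \<open>auto simp: not_le\<close>)

lemma abs_Ssum_le:
  assumes "unit_cm u" "t \<ge> 1"
  shows "\<bar>Ssum u t\<bar> \<le> 1 + ln t"
proof -
  have "\<bar>Ssum u t\<bar> \<le> (\<Sum>n=1..nat \<lfloor>t\<rfloor>. 1 / real n)"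
    unfolding Ssum_def using unit_cm_abs_le[OF assms(1)] 
    by (intro order.trans[OF sum_abs] sum_mono) (auto intro: divide_right_mono)
  then show ?thesis using sum_inverse_le[OF assms(2)] by linarith
qed

text \<open>The variable s is grouped by the size of t/s. For t / 2^(j+1) < s \<le> t / 2^j the
  Moebius sum is O((1 + j)^(-3/2)), and the block of g is O(F(y)) as long as ln s stays comparable
  with ln t. So the halving stops near s = sqrt t; below that the Moebius sum is O(1 / ln t), and
  this is paired with the full sum of g, which is O(F(y) ln t). Bounded t is covered by the lower
  bound for F(y).\<close>

lemma Ssum_upper:
  obtains C where "C > 0" "\<And>u y t. unit_cm u \<Longrightarrow> (\<And>p. prime p \<Longrightarrow> y < p \<Longrightarrow> u p = 0) \<Longrightarrow> 2 \<le> y \<Longrightarrow> real y \<le> t \<Longrightarrow>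
    \<bar>Ssum u t\<bar> \<le> C * Fprod u y"
proof -
  obtain C1 where C1: "C1 \<ge> 1" "\<And>u y. unit_cm u \<Longrightarrow> y \<ge> 2 \<Longrightarrow> Fprod u y \<ge> 1 / (C1 * ln (real y))"
    using Fprod_ge by metis
  obtain C2 where C2: "C2 \<ge> 1" "\<And>y. 2 \<le> y \<Longrightarrow> (\<Prod>p | prime p \<and> p \<le> y. 1 / (1 - 1 / real p)) \<le> C2 * ln (real y)"
    using prod_primes_le by metis
  obtain C3 where C3: "C3 > 0" "\<And>t. t \<ge> 1 \<Longrightarrow> \<bar>msum t\<bar> \<le> C3 * (1 + ln t) powr (- (3/2))"
    using msum_bound by metis
  define k where "k j = (1 + real j * ln 2) powr (- (3/2))" for j
  have k_sum: "summable k"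
  proof (rule summable_comparison_test_bigo)
    show "k \<in> O(\<lambda>n. real n powr (- (3/2)))" unfolding k_def by real_asymp
    show "summable (\<lambda>n. norm (real n powr (- (3/2))))" using summable_real_powr_iff[of "- (3/2)"] by simp
  qed
  have k0: "k j \<ge> 0" for j by (simp add: k_def)
  define K where "K = suminf k"
  have K: "K \<ge> 0" "\<And>J. (\<Sum>j<J. k j) \<le> K" unfolding K_def using k_sum k0 by (auto intro: suminf_nonneg sum_le_suminf)
  \<comment> \<open>The summands belong to t < 16, to the s left over after the halving, and to the
    dyadic blocks.\<close>
  define C where "C = (1 + ln 16) * (C1 * ln 16) + (2 * C3 * C2 + 48 * C2 * C3 * K)"
  have "\<bar>Ssum u t\<bar> \<le> C * Fprod u y" 
    if u: "unit_cm u" and supp: "\<And>p. prime p \<Longrightarrow> y < p \<Longrightarrow> u p = 0" and y: "2 \<le> y" "real y \<le> t" for u y t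
  proof -
    let ?F = "Fprod u y" and ?g = "divsum u"
    have F0: "?F > 0" by (rule Fprod_pos[OF u])
    have t2: "t \<ge> 2" using y by linarith
    \<comment> \<open>From t = 16 on, sqrt t / 2 is at least 1 and ln (sqrt t / 2) \<ge> (ln t) / 4,
      as the block estimate requires.\<close>
    show ?thesis
    proof (cases "t < 16")
      case True
      have "\<bar>Ssum u t\<bar> \<le> 1 + ln t" using t2 by (intro abs_Ssum_le u) auto
      also have "\<dots> \<le> 1 + ln 16" using True t2 by simp
      also have "\<dots> = (1 + ln 16) * 1" by simp
      also have "\<dots> \<le> (1 + ln 16) * (C1 * ln 16 * ?F)"
      proof (intro mult_left_mono)
        have "1 / (C1 * ln 16) \<le> 1 / (C1 * ln (real y))" using y True C1 by (intro divide_left_mono mult_left_mono) auto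
        also have "\<dots> \<le> ?F" by (intro C1 u y)
        finally show "1 \<le> C1 * ln 16 * ?F" using C1(1) by (simp add: field_simps)
      qed simp
      also have "\<dots> = ((1 + ln 16) * (C1 * ln 16)) * ?F" by simp
      also have "\<dots> \<le> C * ?F" using F0 C2 C3 K by (intro mult_right_mono) (auto simp: C_def)
      finally show ?thesis .
    next
      case False
      define L where "L = ln t"
      have L: "L \<ge> 4 * ln 2"
      proof -
        have "4 * ln 2 = ln (2 ^ 4 :: real)" by (subst ln_realpow) auto
        also have "\<dots> \<le> L" unfolding L_def using False by simp
        finally show ?thesis .
      qed
      have Lpos: "L > 0" using L by (smt (verit) ln_gt_zero)
      define w where "w = nat \<lfloor>t\<rfloor>"
      have w: "y \<le> w" "2 \<le> w" "real w \<le> t" unfolding w_def using y t2 by linarith+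
      define D where "D = (\<Sum>m=1..w. ?g m / real m)"
      have gn: "?g m / real m \<ge> 0" if "m \<ge> 1" for m using divsum_nonneg[OF u, of m] that by simp
      have D: "D \<le> C2 * L * ?F"
      proof -
        have "D \<le> (\<Prod>p | prime p \<and> p \<le> w. 1 / (1 - 1 / real p)) * Fprod u w"
          unfolding D_def by (rule sum_divsum_le_prod[OF u])
        also have "Fprod u w = ?F" using supp w(1) by (rule Fprod_eq_of_support)
        also have "(\<Prod>p | prime p \<and> p \<le> w. 1 / (1 - 1 / real p)) * ?F \<le> C2 * ln (real w) * ?F"
          using F0 by (intro mult_right_mono C2 w) auto
        also have "\<dots> \<le> C2 * L * ?F" using w C2 F0 unfolding L_def by (intro mult_right_mono mult_left_mono) auto
        finally show ?thesis .
      qed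
      define A where "A r = (\<Sum>s | 1 \<le> s \<and> real s \<le> r. ?g s / real s * \<bar>msum (t / real s)\<bar>)" for r
      have fin: "finite {s::nat. 1 \<le> s \<and> real s \<le> r}" for r
        by (rule finite_subset[of _ "{..nat \<lceil>r\<rceil>}"]) (auto simp: le_nat_iff, linarith)
      have Dle: "(\<Sum>s\<in>S. ?g s / real s) \<le> D" if "S \<subseteq> {1..w}" for S
        unfolding D_def by (rule sum_mono2) (use that gn in auto)
      have inw: "s \<in> {1..w}" if "1 \<le> s" "real s \<le> t" for s using that unfolding w_def by (simp add: le_nat_iff le_floor_iff)
      have SA: "\<bar>Ssum u t\<bar> \<le> A t"
      proof -
        have "{1..w} = {s. 1 \<le> s \<and> real s \<le> t}" using inw w by auto
        then have "Ssum u t = (\<Sum>s | 1 \<le> s \<and> real s \<le> t. ?g s / real s * msum (t / real s))"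
          unfolding Ssum_def using sum_eq_divsum_msum[of t u] t2 by (simp add: w_def)
        also have "\<bar>\<dots>\<bar> \<le> (\<Sum>s | 1 \<le> s \<and> real s \<le> t. \<bar>?g s / real s * msum (t / real s)\<bar>)" by (rule sum_abs)
        also have "\<dots> = A t" unfolding A_def
          using divsum_nonneg[OF u] by (intro sum.cong refl) (auto simp: abs_mult)
        finally show ?thesis .
      qed
      have "2 powr real (nat \<lfloor>log 2 (sqrt t)\<rfloor>) \<le> sqrt t \<and> sqrt t < 2 powr (real (nat \<lfloor>log 2 (sqrt t)\<rfloor>) + 1)"
      proof -
        have "log 2 (sqrt t) \<ge> 0" using t2 by simp
        then have "real (nat \<lfloor>log 2 (sqrt t)\<rfloor>) \<le> log 2 (sqrt t)" "log 2 (sqrt t) < real (nat \<lfloor>log 2 (sqrt t)\<rfloor>) + 1" by linarith+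
        then show ?thesis using t2 by (simp add: powr_le_iff less_powr_iff)
      qed
      then have "2 ^ nat \<lfloor>log 2 (sqrt t)\<rfloor> \<le> sqrt t \<and> sqrt t < 2 ^ (nat \<lfloor>log 2 (sqrt t)\<rfloor> + 1)"
        by (simp add: powr_realpow powr_add mult.commute)
      then obtain J :: nat where J: "2 ^ J \<le> sqrt t" "sqrt t < 2 ^ (J + 1)"
        by blast
      have step: "A (t / 2 ^ j) \<le> A (t / 2 ^ (j + 1)) + 48 * C2 * C3 * ?F * k j" if j: "j \<le> J" for j
      proof -
        define a where "a = t / 2 ^ (j + 1)"
        have a2: "t / 2 ^ j = 2 * a" by (simp add: a_def)
        have j2: "(2::real) ^ j \<le> sqrt t"
          by (rule order.trans[OF power_increasing[OF j] J(1)]) simp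
        have as: "sqrt t / 2 \<le> a"
        proof -
          have "sqrt t * 2 ^ j \<le> sqrt t * sqrt t" using j2 t2 by (intro mult_left_mono) auto
          then show ?thesis unfolding a_def using t2 by (simp add: field_simps)
        qed
        have "sqrt t \<ge> 4" using False by (intro real_le_rsqrt) auto
        then have a1: "a \<ge> 1" using as by linarith
        let ?B = "{s. a < real s \<and> real s \<le> 2 * a}"
        have at: "2 * a \<le> t" unfolding a2[symmetric] using t2 by (simp add: divide_le_eq mult_le_cancel_left1)
        have Bw: "?B \<subseteq> {1..w}" using a1 at by (intro subsetI inw) auto
        have lna: "ln a \<ge> L / 4"
        proof -
          have "ln (sqrt t / 2) \<le> ln a" using as t2 by (intro ln_mono) auto
          moreover have "ln (sqrt t / 2) = L / 2 - ln 2" using t2 by (simp add: ln_div ln_sqrt L_def)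
          ultimately show ?thesis using L by linarith
        qed
        have V: "(\<Sum>s\<in>?B. ?g s / real s) \<le> 48 * C2 * ?F"
        proof -
          have V0: "(\<Sum>s\<in>?B. ?g s / real s) \<ge> 0" using a1 by (intro sum_nonneg gn) auto
          have "L / 4 * (\<Sum>s\<in>?B. ?g s / real s) \<le> ln a * (\<Sum>s\<in>?B. ?g s / real s)"
            using lna V0 by (intro mult_right_mono)
          also have "\<dots> \<le> 12 * (\<Sum>m=1..nat \<lfloor>2 * a\<rfloor>. ?g m / real m)" by (rule divsum_dyadic_le[OF u a1])
          also have "\<dots> \<le> 12 * D" using at by (intro mult_left_mono Dle) (auto simp: w_def intro!: nat_mono floor_mono order.trans)
          also have "\<dots> \<le> 12 * (C2 * L * ?F)" using D by simp
          finally have "L * (\<Sum>s\<in>?B. ?g s / real s) \<le> L * (48 * C2 * ?F)" by (simp add: algebra_simps)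
          then show ?thesis using Lpos by simp
        qed
        have "{s. 1 \<le> s \<and> real s \<le> 2 * a} = {s. 1 \<le> s \<and> real s \<le> a} \<union> ?B" using a1 by auto
        then have Aa: "A (2 * a) = A a + (\<Sum>s\<in>?B. ?g s / real s * \<bar>msum (t / real s)\<bar>)"
          unfolding A_def using fin finite_subset[OF Bw] by (simp only:) (subst sum.union_disjoint, auto)
        have "(\<Sum>s\<in>?B. ?g s / real s * \<bar>msum (t / real s)\<bar>) \<le> (\<Sum>s\<in>?B. ?g s / real s * (C3 * k j))"
        proof (intro sum_mono mult_left_mono)
          fix s assume s: "s \<in> ?B"
          then have s1: "1 \<le> s" using a1 by auto
          have ts: "2 ^ j \<le> t / real s" using s s1 a2 by (simp add: field_simps)
          have one: "(1::real) \<le> 2 ^ j" by simp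
          have "\<bar>msum (t / real s)\<bar> \<le> C3 * (1 + ln (t / real s)) powr (- (3/2))"
            using ts one by (intro C3) linarith
          also have "\<dots> \<le> C3 * k j" unfolding k_def
          proof (intro mult_left_mono powr_mono2')
            have "real j * ln 2 = ln (2 ^ j)" by (simp add: ln_realpow)
            also have "\<dots> \<le> ln (t / real s)" using ts by (intro ln_mono) auto
            finally show "1 + real j * ln 2 \<le> 1 + ln (t / real s)" by simp
          qed (use C3 in \<open>auto intro: add_pos_nonneg\<close>)
          finally show "\<bar>msum (t / real s)\<bar> \<le> C3 * k j" .
          show "0 \<le> ?g s / real s" by (rule gn[OF s1])
        qed
        also have "\<dots> = (\<Sum>s\<in>?B. ?g s / real s) * (C3 * k j)" by (simp add: sum_distrib_right)
        also have "\<dots> \<le> 48 * C2 * ?F * (C3 * k j)" using V C3 k0 by (intro mult_right_mono) auto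
        finally have "A (2 * a) \<le> A a + 48 * C2 * ?F * (C3 * k j)" unfolding Aa by (rule add_left_mono)
        then show ?thesis unfolding a2 a_def[symmetric] by (simp add: mult_ac)
      qed
      have tel: "A t \<le> A (t / 2 ^ n) + 48 * C2 * C3 * ?F * (\<Sum>j<n. k j)" if "n \<le> J + 1" for n
        using that
      proof (induction n)
        case (Suc n)
        then have "A t \<le> A (t / 2 ^ n) + 48 * C2 * C3 * ?F * (\<Sum>j<n. k j)" by simp
        also have "A (t / 2 ^ n) \<le> A (t / 2 ^ (n + 1)) + 48 * C2 * C3 * ?F * k n" using Suc by (intro step) auto
        finally show ?case by (simp add: distrib_left)
      qed simp
      have rest: "A (t / 2 ^ (J + 1)) \<le> 2 * C3 * C2 * ?F"
      proof -
        have le: "t / 2 ^ (J + 1) \<le> t" using t2 one_le_power[of "2::real" "J+1"] by (simp add: divide_le_eq mult_le_cancel_left1)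
        have "A (t / 2 ^ (J + 1)) \<le> (\<Sum>s | 1 \<le> s \<and> real s \<le> t / 2 ^ (J + 1). ?g s / real s * (2 * C3 / L))"
          unfolding A_def
        proof (intro sum_mono mult_left_mono)
          fix s assume s: "s \<in> {s. 1 \<le> s \<and> real s \<le> t / 2 ^ (J + 1)}"
          then have s1: "1 \<le> s" by simp
          have "2 ^ (J + 1) \<le> t / real s" using s by (simp add: field_simps)
          then have ts: "sqrt t \<le> t / real s" using J by linarith
          have st1: "1 \<le> sqrt t" using t2 by simp
          have lt: "L / 2 \<le> ln (t / real s)"
          proof -
            have "L / 2 = ln (sqrt t)" using t2 by (simp add: ln_sqrt L_def)
            also have "\<dots> \<le> ln (t / real s)" using ts t2 by (intro ln_mono) auto
            finally show ?thesis .
          qed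
          have "\<bar>msum (t / real s)\<bar> \<le> C3 * (1 + ln (t / real s)) powr (- (3/2))"
            using ts st1 by (intro C3) linarith
          also have "\<dots> \<le> C3 * (1 + ln (t / real s)) powr (-1)"
            using C3 lt Lpos by (intro mult_left_mono powr_mono) auto
          also have "\<dots> = C3 * (1 / (1 + ln (t / real s)))" using lt Lpos by (simp add: powr_minus_divide)
          also have "\<dots> \<le> C3 * (1 / (L / 2))" using C3 lt Lpos by (intro mult_left_mono divide_left_mono) auto
          finally show "\<bar>msum (t / real s)\<bar> \<le> 2 * C3 / L" by (simp add: mult.commute)
          show "0 \<le> ?g s / real s" by (rule gn[OF s1])
        qed
        also have "\<dots> = (\<Sum>s | 1 \<le> s \<and> real s \<le> t / 2 ^ (J + 1). ?g s / real s) * (2 * C3 / L)" by (rule sum_distrib_right[symmetric])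
        also have "\<dots> \<le> (C2 * L * ?F) * (2 * C3 / L)"
        proof (rule mult_right_mono)
          have "(\<Sum>s | 1 \<le> s \<and> real s \<le> t / 2 ^ (J + 1). ?g s / real s) \<le> D"
            using le by (intro Dle subsetI inw) auto
          then show "(\<Sum>s | 1 \<le> s \<and> real s \<le> t / 2 ^ (J + 1). ?g s / real s) \<le> C2 * L * ?F" using D by linarith
        qed (use C3 Lpos in simp)
        also have "\<dots> = 2 * C3 * C2 * ?F" using Lpos by simp
        finally show ?thesis .
      qed
      have "\<bar>Ssum u t\<bar> \<le> 2 * C3 * C2 * ?F + 48 * C2 * C3 * ?F * K"
      proof -
        have "48 * C2 * C3 * ?F * (\<Sum>j<J+1. k j) \<le> 48 * C2 * C3 * ?F * K"
          using K(2)[of "J+1"] C2 C3 F0 by (intro mult_left_mono) auto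
        then show ?thesis using SA tel[of "J+1"] rest by linarith
      qed
      also have "\<dots> = (2 * C3 * C2 + 48 * C2 * C3 * K) * ?F" by (simp add: algebra_simps)
      also have "\<dots> \<le> C * ?F" using F0 C1 by (intro mult_right_mono) (auto simp: C_def)
      finally show ?thesis .
    qed
  qed
  moreover have "C > 0"
    unfolding C_def using C1 C2 C3 K by (intro add_pos_nonneg mult_pos_pos) (auto intro!: mult_nonneg_nonneg add_pos_pos)
  ultimately show ?thesis by (intro that[of C]) blast+
qed

section \<open>Sums over smooth numbers\<close>

text \<open>One factor ln p / ln y turns 1/p into (ln p / p) / ln y, which Mertens can sum; so the
  exponent exhibited is \<open>Suc k\<close>. The other k factors make the primes up to y^(1 -
  \<eta>) negligible, and those above contribute only about \<eta>.\<close>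

lemma sum_primes_ln_power_le:
  assumes \<theta>: "0 < \<theta>" "\<theta> \<le> 1"
  shows "\<exists>k y0. y0 \<ge> 2 \<and> (\<forall>y>y0. (\<Sum>p | prime p \<and> y0 < p \<and> p \<le> y. 1 / real p * (ln (real p) / ln (real y)) ^ k) \<le> \<theta>)"
proof -
  define \<eta> where "\<eta> = \<theta> / 4"
  have \<eta>: "0 < \<eta>" "\<eta> < 1" using \<theta> by (auto simp: \<eta>_def)
  obtain k where k: "(1 - \<eta>) ^ k < \<theta> / 4" using real_arch_pow_inv[of "\<theta> / 4" "1 - \<eta>"] \<theta> \<eta> by auto
  \<comment> \<open>Ensures \<theta> ln y \<ge> 20 for y > \<open>y0\<close>, so that the bounded
    errors in Mertens' estimate, divided by ln y, are small against \<theta>.\<close>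
  define y0 where "y0 = nat \<lceil>exp (20 / \<theta>)\<rceil>"
  have y0e: "exp (20 / \<theta>) \<le> real y0" unfolding y0_def by linarith
  have "20 / \<theta> \<ge> 20" using \<theta> by (simp add: field_simps)
  moreover have "1 + 20 / \<theta> \<le> exp (20 / \<theta>)" by (rule exp_ge_add_one_self)
  ultimately have y02: "y0 \<ge> 2" using y0e by linarith
  have "(\<Sum>p | prime p \<and> y0 < p \<and> p \<le> y. 1 / real p * (ln (real p) / ln (real y)) ^ Suc k) \<le> \<theta>" if y: "y > y0" for y
  proof -
    define L where "L = ln (real y)"
    have L: "L \<ge> 20 / \<theta>"
    proof -
      have "20 / \<theta> = ln (exp (20 / \<theta>))" by simp
      also have "\<dots> \<le> L" unfolding L_def using y0e y y02 by (subst ln_le_cancel_iff) auto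
      finally show ?thesis .
    qed
    have L20: "L \<ge> 20" using L \<open>20 / \<theta> \<ge> 20\<close> by linarith
    have \<theta>L: "20 \<le> \<theta> * L" using L \<theta> by (simp add: field_simps)
    define x where "x = real y powr (1 - \<eta>)"
    define z where "z = nat \<lfloor>x\<rfloor>"
    have x1: "x \<ge> 1" unfolding x_def using y y02 \<eta> by (intro ge_one_powr_ge_zero) auto
    have lnx: "ln x = (1 - \<eta>) * L" unfolding x_def L_def using y y02 by (simp add: ln_powr)
    have z1: "1 \<le> z" "real z \<le> x" "x \<le> real z + 1" unfolding z_def using x1 by linarith+
    then have z: "1 \<le> z" "real z \<le> x" "x \<le> 2 * real z" by linarith+
    have "x \<le> real y powr 1" unfolding x_def using y y02 \<eta> by (intro powr_mono) auto
    then have zy: "z \<le> y" using z y02 y by simp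
    have lnz: "ln (real z) \<ge> (1 - \<eta>) * L - 1"
    proof -
      have "ln x \<le> ln (2 * real z)" using z x1 by (intro ln_mono) auto
      also have "\<dots> = ln 2 + ln (real z)" using z by (simp add: ln_mult)
      finally show ?thesis using lnx ln_2_less_1 by linarith
    qed
    let ?P = "{p. prime p \<and> y0 < p \<and> p \<le> y}"
    let ?A = "{p. prime p \<and> 1 < p \<and> p \<le> y}" and ?B = "{p. prime p \<and> z < p \<and> p \<le> y}"
    have "(\<Sum>p\<in>?P. 1 / real p * (ln (real p) / L) ^ Suc k) \<le> (\<Sum>p\<in>?P. (ln (real p) / real p) * ((1 - \<eta>) ^ k / L) + (if z < p then (ln (real p) / real p) * (1 / L) else 0))"
    proof (rule sum_mono)
      fix p assume p: "p \<in> ?P"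
      then have p1: "real p > 1" using prime_gt_1_nat by auto
      have lp: "0 \<le> ln (real p) / real p" using p1 by simp
      have eq: "1 / real p * (ln (real p) / L) ^ Suc k = (ln (real p) / real p) * ((ln (real p) / L) ^ k / L)" by simp
      show "1 / real p * (ln (real p) / L) ^ Suc k \<le> (ln (real p) / real p) * ((1 - \<eta>) ^ k / L) + (if z < p then (ln (real p) / real p) * (1 / L) else 0)"
      proof (cases "z < p")
        case True
        have "ln (real p) \<le> L" unfolding L_def using p p1 by simp
        then have "(ln (real p) / L) ^ k \<le> 1" using p1 L20 by (intro power_le_one) auto
        then have "(ln (real p) / real p) * ((ln (real p) / L) ^ k / L) \<le> (ln (real p) / real p) * (1 / L)"
          using lp L20 by (intro mult_left_mono divide_right_mono) auto
        moreover have "0 \<le> (ln (real p) / real p) * ((1 - \<eta>) ^ k / L)"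
          by (intro mult_nonneg_nonneg[OF lp] divide_nonneg_nonneg zero_le_power) (use L20 \<eta> in auto)
        ultimately show ?thesis unfolding eq using True by simp
      next
        case False
        have "ln (real p) \<le> ln x" using False z p1 by (intro ln_mono) auto
        then have "ln (real p) / L \<le> 1 - \<eta>" unfolding lnx using L20 by (simp add: field_simps)
        then have "(ln (real p) / L) ^ k \<le> (1 - \<eta>) ^ k" using p1 L20 by (intro power_mono) auto
        then have "(ln (real p) / real p) * ((ln (real p) / L) ^ k / L) \<le> (ln (real p) / real p) * ((1 - \<eta>) ^ k / L)"
          using lp L20 by (intro mult_left_mono divide_right_mono) auto
        then show ?thesis unfolding eq using False by simp
      qed
    qed
    also have "\<dots> = (\<Sum>p\<in>?P. ln (real p) / real p) * ((1 - \<eta>) ^ k / L) + (\<Sum>p\<in>{p\<in>?P. z < p}. ln (real p) / real p) * (1 / L)"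
      by (simp only: sum.distrib sum_distrib_right sum.inter_filter[symmetric] finite_Collect_conjI finite_Collect_le_nat) (subst sum.inter_filter, auto)
    also have "\<dots> \<le> (L + 4) * ((1 - \<eta>) ^ k / L) + (\<eta> * L + 5) * (1 / L)"
    proof (intro add_mono mult_right_mono)
      have "(\<Sum>p\<in>?P. ln (real p) / real p) \<le> (\<Sum>p\<in>?A. ln (real p) / real p)"
        using y02 prime_gt_1_nat by (intro sum_mono2) auto
      also have "\<dots> \<le> L + 4" using sum_ln_primes_le[of 1 y] y y02 by (simp add: L_def)
      finally show "(\<Sum>p\<in>?P. ln (real p) / real p) \<le> L + 4" .
      have "(\<Sum>p\<in>{p\<in>?P. z < p}. ln (real p) / real p) \<le> (\<Sum>p\<in>?B. ln (real p) / real p)"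
        using z by (intro sum_mono2) auto
      also have "\<dots> \<le> L - ln (real z) + 4" using sum_ln_primes_le[OF z(1) zy] by (simp add: L_def)
      also have "\<dots> \<le> \<eta> * L + 5" using lnz by (simp add: algebra_simps)
      finally show "(\<Sum>p\<in>{p\<in>?P. z < p}. ln (real p) / real p) \<le> \<eta> * L + 5" .
    qed (use L20 \<eta> in auto)
    also have "\<dots> \<le> 2 * (\<theta> / 4) + (\<theta> / 4 + \<theta> / 4)"
    proof (intro add_mono)
      have "(L + 4) * ((1 - \<eta>) ^ k / L) = (L + 4) / L * (1 - \<eta>) ^ k" by simp
      also have "\<dots> \<le> 2 * (\<theta> / 4)" using L20 k \<eta> by (intro mult_mono) (auto simp: field_simps)
      finally show "(L + 4) * ((1 - \<eta>) ^ k / L) \<le> 2 * (\<theta> / 4)" .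
      have "5 / L \<le> \<theta> / 4" using \<theta>L L20 by (simp add: field_simps)
      moreover have "(\<eta> * L + 5) * (1 / L) = \<eta> + 5 / L" using L20 by (simp add: field_simps)
      ultimately show "(\<eta> * L + 5) * (1 / L) \<le> \<theta> / 4 + \<theta> / 4" by (simp add: \<eta>_def)
    qed
    also have "\<dots> = \<theta>" by simp
    finally show ?thesis unfolding L_def .
  qed
  with y02 show ?thesis by blast
qed

section \<open>Buchstab's recursion for sums over smooth numbers\<close>

definition restr :: "(nat \<Rightarrow> real) \<Rightarrow> nat \<Rightarrow> nat \<Rightarrow> real" where
  "restr f y n = (if n \<in> smooth y then f n else 0)"

definition rsum :: "(nat \<Rightarrow> real) \<Rightarrow> nat \<Rightarrow> real \<Rightarrow> real" where
  "rsum f y t = Ssum (restr f y) t"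

lemma unit_cm_restr:
  assumes "unit_cm f"
  shows "unit_cm (restr f y)"
proof -
  have "1 \<in> smooth y" by (auto simp: smooth_def)
  then show ?thesis using unit_cmD[OF assms] smooth_mult_iff by (auto simp: unit_cm_def restr_def)
qed

lemma restr_eq_0: "prime p \<Longrightarrow> y < p \<Longrightarrow> restr f y p = 0"
  by (auto simp: restr_def smooth_def)

lemma prime_in_smooth: "prime p \<Longrightarrow> p \<le> y \<Longrightarrow> p \<in> smooth y"
  by (auto simp: smooth_def prime_gt_0_nat dest: dvd_imp_le)

lemma Fprod_restr: "Fprod (restr f y) y = Fprod f y"
  unfolding Fprod_def by (intro prod.cong refl) (auto simp: restr_def prime_in_smooth)

lemma rsum_Suc_not_prime: "\<not> prime (Suc N) \<Longrightarrow> rsum f (Suc N) t = rsum f N t"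
proof -
  assume "\<not> prime (Suc N)"
  then have "restr f (Suc N) = restr f N" by (simp add: fun_eq_iff restr_def smooth_Suc_not_prime)
  then show ?thesis by (simp add: rsum_def)
qed

text \<open>The q-smooth multiples of q = N + 1 are the q m with m again q-smooth. Hence the index
  on the right stays \<open>Suc N\<close>, and complete multiplicativity makes the identity
  exact.\<close>

lemma rsum_Suc_prime:
  assumes f: "unit_cm f" and q: "prime (Suc N)" and t: "t \<ge> 0"
  shows "rsum f (Suc N) t = rsum f N t + f (Suc N) / real (Suc N) * rsum f (Suc N) (t / real (Suc N))"
proof -
  let ?q = "Suc N" and ?T = "nat \<lfloor>t\<rfloor>"
  let ?S = "\<lambda>M T. {n\<in>{1..T}. n \<in> smooth M}"
  have r: "rsum f M s = (\<Sum>n\<in>?S M (nat \<lfloor>s\<rfloor>). f n / real n)" for M s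
    unfolding rsum_def Ssum_def restr_def by (subst sum.inter_filter) (auto intro!: sum.cong)
  have eq: "?S ?q ?T = ?S N ?T \<union> (*) ?q ` ?S ?q (?T div ?q)"
  proof (intro set_eqI iffI)
    fix n assume n: "n \<in> ?S ?q ?T"
    show "n \<in> ?S N ?T \<union> (*) ?q ` ?S ?q (?T div ?q)"
    proof (cases "?q dvd n")
      case True
      then obtain m where m: "n = ?q * m" by auto
      then have "m > 0" using n by (auto intro!: Nat.gr0I)
      then have "m \<in> smooth ?q" using n m smooth_mult_iff[of ?q m ?q] by simp
      moreover have "m \<le> ?T div ?q" using n m by (simp add: less_eq_div_iff_mult_less_eq mult.commute)
      ultimately have "m \<in> ?S ?q (?T div ?q)" using \<open>m > 0\<close> by simp
      then show ?thesis using m by blast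
    next
      case False
      have "p \<le> N" if "prime p" "p dvd n" for p
        using that n False le_Suc_eq by (auto simp: smooth_def)
      then show ?thesis using n by (auto simp: smooth_def)
    qed
  next
    fix n assume "n \<in> ?S N ?T \<union> (*) ?q ` ?S ?q (?T div ?q)"
    then show "n \<in> ?S ?q ?T"
    proof
      assume "n \<in> ?S N ?T"
      then show ?thesis by (auto simp: smooth_def intro: le_SucI)
    next
      assume "n \<in> (*) ?q ` ?S ?q (?T div ?q)"
      then obtain m where m: "n = ?q * m" "m \<in> smooth ?q" "1 \<le> m" "m \<le> ?T div ?q" by auto
      have "?q \<in> smooth ?q" using q by (intro prime_in_smooth) auto
      then have "n \<in> smooth ?q" using smooth_mult_iff[of ?q m ?q] m by simp
      moreover have "n \<le> ?T" using m by (simp add: less_eq_div_iff_mult_less_eq mult.commute)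
      moreover have "1 \<le> n" using m by simp
      ultimately show ?thesis by simp
    qed
  qed
  have nd: "\<not> ?q dvd n" if "n \<in> smooth N" for n
  proof
    assume "?q dvd n"
    then have "?q \<le> N" using that q unfolding smooth_def by blast
    then show False by simp
  qed
  have disj: "?S N ?T \<inter> (*) ?q ` ?S ?q (?T div ?q) = {}"
  proof -
    have "?q * m \<notin> smooth N" for m
    proof
      assume "?q * m \<in> smooth N"
      then have "\<not> ?q dvd ?q * m" by (rule nd)
      then show False using dvd_triv_left by blast
    qed
    then show ?thesis by blast
  qed
  have "rsum f ?q t = (\<Sum>n\<in>?S N ?T. f n / real n) + (\<Sum>n\<in>(*) ?q ` ?S ?q (?T div ?q). f n / real n)"
    unfolding r eq by (rule sum.union_disjoint[OF _ _ disj]) auto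
  also have "(\<Sum>n\<in>(*) ?q ` ?S ?q (?T div ?q). f n / real n) = (\<Sum>m\<in>?S ?q (?T div ?q). f (?q * m) / real (?q * m))"
    by (subst sum.reindex) (auto simp: inj_on_def simp del: mult_Suc)
  also have "\<dots> = (\<Sum>m\<in>?S ?q (?T div ?q). f ?q / real ?q * (f m / real m))"
    by (intro sum.cong refl) (use unit_cmD(2)[OF f, of ?q] in \<open>auto simp del: mult_Suc of_nat_Suc\<close>)
  also have "\<dots> = f ?q / real ?q * rsum f ?q (t / real ?q)"
    unfolding r nat_floor_div[OF t zero_less_Suc] by (simp add: sum_distrib_left)
  finally show ?thesis unfolding r .
qed

lemma Fprod_Suc_not_prime:
  assumes "\<not> prime (Suc N)"
  shows "Fprod f (Suc N) = Fprod f N"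
proof -
  have "{p. prime p \<and> p \<le> Suc N} = {p. prime p \<and> p \<le> N}" using assms le_Suc_eq by auto
  then show ?thesis by (simp add: Fprod_def)
qed

text \<open>The recursion of \<open>rsum\<close> without the dependence on t; subtracting the two
  gives a recursion for the error \<open>rerr\<close>.\<close>

lemma Fprod_Suc_prime:
  assumes f: "unit_cm f" and q: "prime (Suc N)"
  shows "Fprod f (Suc N) = Fprod f N + f (Suc N) / real (Suc N) * Fprod f (Suc N)"
proof -
  have "{p. prime p \<and> p \<le> Suc N} = insert (Suc N) {p. prime p \<and> p \<le> N}" using q le_Suc_eq by auto
  then have "Fprod f (Suc N) = 1 / (1 - f (Suc N) / real (Suc N)) * Fprod f N" by (simp add: Fprod_def)
  moreover have "1 - f (Suc N) / real (Suc N) > 0" using unit_cm_factor_bounds[OF f q] by linarith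
  ultimately have "Fprod f (Suc N) * (1 - f (Suc N) / real (Suc N)) = Fprod f N" by simp
  then show ?thesis by (simp add: algebra_simps)
qed

definition rerr :: "(nat \<Rightarrow> real) \<Rightarrow> nat \<Rightarrow> real \<Rightarrow> real" where
  "rerr f y t = rsum f y t - Fprod f y"

lemma rerr_buchstab:
  assumes f: "unit_cm f" and t: "t \<ge> 0" and "z \<le> y"
  shows "\<bar>rerr f y t\<bar> \<le> \<bar>rerr f z t\<bar> + (\<Sum>p | prime p \<and> z < p \<and> p \<le> y. 1 / real p * \<bar>rerr f p (t / real p)\<bar>)"
  using assms(3)
proof (induction y rule: dec_induct)
  case base
  have "{p. prime p \<and> z < p \<and> p \<le> z} = {}" by auto
  then show ?case by (simp only: sum.empty)
next
  case (step y)
  show ?case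
  proof (cases "prime (Suc y)")
    case False
    then have "{p. prime p \<and> z < p \<and> p \<le> Suc y} = {p. prime p \<and> z < p \<and> p \<le> y}" using le_Suc_eq by auto
    moreover have "rerr f (Suc y) t = rerr f y t"
      using False by (simp add: rerr_def rsum_Suc_not_prime Fprod_Suc_not_prime)
    ultimately show ?thesis using step.IH by simp
  next
    case True
    let ?q = "Suc y"
    have set: "{p. prime p \<and> z < p \<and> p \<le> ?q} = insert ?q {p. prime p \<and> z < p \<and> p \<le> y}" using True step le_Suc_eq by auto
    have e: "rerr f ?q t = rerr f y t + f ?q / real ?q * rerr f ?q (t / real ?q)"
      using rsum_Suc_prime[OF f True t] Fprod_Suc_prime[OF f True] unfolding rerr_def right_diff_distrib by linarith
    have "\<bar>f ?q / real ?q * rerr f ?q (t / real ?q)\<bar> \<le> 1 / real ?q * \<bar>rerr f ?q (t / real ?q)\<bar>"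
      unfolding abs_mult using unit_cmD(3)[OF f True] by (intro mult_right_mono) (auto intro: divide_right_mono)
    then have "\<bar>rerr f ?q t\<bar> \<le> \<bar>rerr f y t\<bar> + 1 / real ?q * \<bar>rerr f ?q (t / real ?q)\<bar>" unfolding e by linarith
    then show ?thesis using step.IH unfolding set by simp
  qed
qed

text \<open>Rankin's trick: a smooth n beyond t has 1/n \<le> n^(-1/2) t^(-1/2), and n^(-1/2) is
  summable over the \<open>y0\<close>-smooth numbers. The constant depends on \<open>y0\<close>,
  which is fixed where this is used.\<close>

lemma rerr_tail:
  obtains D where "D > 0" "\<And>f y t. unit_cm f \<Longrightarrow> y \<le> y0 \<Longrightarrow> t \<ge> 1 \<Longrightarrow> \<bar>rerr f y t\<bar> \<le> D * t powr (- (1/2))"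
proof -
  define b where "b n = real n powr (- (1/2))" for n
  have bs: "(\<lambda>n. norm (b n)) summable_on smooth y0"
  proof (rule has_sum_smooth[THEN conjunct1])
    show "norm (b p) < 1" if "prime p" for p
      using powr_less_one[of "real p" "- (1/2)"] prime_gt_1_nat[OF that] by (simp add: b_def)
  qed (auto simp: b_def powr_mult)
  then have bs': "b summable_on smooth y0" by (rule abs_summable_summable)
  define D where "D = infsum b (smooth y0)"
  have "1 \<in> smooth y0" by (auto simp: smooth_def)
  then have "sum b {1} \<le> D" unfolding D_def by (intro finite_sum_le_infsum bs') (auto simp: b_def)
  then have D: "D > 0" by (simp add: b_def)
  have "\<bar>rerr f y t\<bar> \<le> D * t powr (- (1/2))" if f: "unit_cm f" and y: "y \<le> y0" and t: "t \<ge> 1" for f y t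
  proof -
    let ?S = "{n\<in>{1..nat \<lfloor>t\<rfloor>}. n \<in> smooth y}"
    have sub: "smooth y \<subseteq> smooth y0" using y by (auto simp: smooth_def intro: order.trans)
    have r: "rsum f y t = (\<Sum>n\<in>?S. f n / real n)"
      unfolding rsum_def Ssum_def restr_def by (subst sum.inter_filter) (auto intro!: sum.cong)
    have h: "((\<lambda>n. f n / real n) has_sum (Fprod f y - rsum f y t)) (smooth y - ?S)"
      unfolding r by (rule has_sum_Diff[OF has_sum_unit_cm_smooth(2)[OF f]]) auto
    have bT: "b summable_on (smooth y - ?S)" by (rule summable_on_subset_banach[OF bs']) (use sub in auto)
    have h2: "((\<lambda>n. b n * t powr (- (1/2))) has_sum (infsum b (smooth y - ?S) * t powr (- (1/2)))) (smooth y - ?S)"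
      by (intro has_sum_cmult_left has_sum_infsum bT)
    have "norm (Fprod f y - rsum f y t) \<le> infsum b (smooth y - ?S) * t powr (- (1/2))"
    proof (rule norm_infsum_le[OF h h2])
      fix n assume n: "n \<in> smooth y - ?S"
      then have n0: "n > 0" by (auto simp: smooth_def)
      then have "n > nat \<lfloor>t\<rfloor>" using n by auto
      then have nt: "t \<le> real n" by linarith
      have "norm (f n / real n) \<le> 1 / real n" using unit_cm_abs_le[OF f n0] by (simp add: divide_right_mono)
      also have "\<dots> = real n powr (- (1/2)) * real n powr (- (1/2))" using n0 by (simp add: powr_add[symmetric] powr_minus_divide)
      also have "\<dots> \<le> b n * t powr (- (1/2))" unfolding b_def using nt t by (intro mult_left_mono powr_mono2') auto
      finally show "norm (f n / real n) \<le> b n * t powr (- (1/2))" .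
    qed
    also have "\<dots> \<le> D * t powr (- (1/2))"
      unfolding D_def using sub by (intro mult_right_mono infsum_mono_neutral bT bs') (auto simp: b_def)
    finally show ?thesis by (simp add: rerr_def abs_minus_commute)
  qed
  with D show ?thesis by (rule that)
qed

text \<open>The Buchstab identity turns a crude bound for the error into one that decays in \<open>ln t / ln y\<close>. The loss
  \<open>ln y / ln p\<close> incurred when \<^term>\<open>Fprod f p\<close> is compared with \<^term>\<open>Fprod f y\<close> is absorbed by
  the polynomial decay.\<close>
lemma rerr_decay:
  obtains K kk where "K > 0" "kk \<ge> 1" "\<And>f y t. unit_cm f \<Longrightarrow> 2 \<le> y \<Longrightarrow> real y \<le> t \<Longrightarrow>
    \<bar>rerr f y t\<bar> \<le> K * (ln (real y) / ln t) ^ kk * Fprod f y"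
proof -
  obtain C where C: "C > 0" "\<And>u y t. unit_cm u \<Longrightarrow> (\<And>p. prime p \<Longrightarrow> y < p \<Longrightarrow> u p = 0) \<Longrightarrow> 2 \<le> y \<Longrightarrow> real y \<le> t \<Longrightarrow>
    \<bar>Ssum u t\<bar> \<le> C * Fprod u y"
    by (rule Ssum_upper) blast
  obtain C1 where C1: "C1 \<ge> 1" "\<And>u z y. unit_cm u \<Longrightarrow> 2 \<le> z \<Longrightarrow> z \<le> y \<Longrightarrow> Fprod u z \<le> C1 * (ln (real y) / ln (real z)) * Fprod u y"
    by (rule Fprod_ratio_le) blast
  obtain Cg where Cg: "Cg \<ge> 1" "\<And>u y. unit_cm u \<Longrightarrow> y \<ge> 2 \<Longrightarrow> Fprod u y \<ge> 1 / (Cg * ln (real y))"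
    by (rule Fprod_ge) blast
  \<comment> \<open>Reduces the factor 2 K C1 that will stand in front of the sum over primes to K /
    4.\<close>
  define \<theta> where "\<theta> = 1 / (8 * C1)"
  have \<theta>: "0 < \<theta>" "\<theta> \<le> 1" using C1 by (auto simp: \<theta>_def)
  obtain k y0 where y0: "y0 \<ge> 2" and
    R: "\<And>y. y > y0 \<Longrightarrow> (\<Sum>p | prime p \<and> y0 < p \<and> p \<le> y. 1 / real p * (ln (real p) / ln (real y)) ^ k) \<le> \<theta>"
    using sum_primes_ln_power_le[OF \<theta>] by blast
  obtain D where D: "D > 0" "\<And>f y t. unit_cm f \<Longrightarrow> y \<le> y0 \<Longrightarrow> t \<ge> 1 \<Longrightarrow> \<bar>rerr f y t\<bar> \<le> D * t powr (- (1/2))"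
    by (rule rerr_tail[where ?y0.0 = y0]) blast
  \<comment> \<open>One power more than in the sum over primes: it pays for the factor C1 ln y / ln
    p.\<close>
  define kk where "kk = Suc k"
  \<comment> \<open>Gives kk / v0 = 1/2 and hence (1 - 1/v0)^kk \<ge> 1/2 by Bernoulli, so that ln
    (t/p) can be replaced by ln t at the cost of a factor 2.\<close>
  define v0 where "v0 = 2 * real kk"
  \<comment> \<open>Makes D t^(-1/2) at most a quarter of the claimed bound: (ln t)^kk is dominated
    by t^(1/2), and F(y) \<ge> 1 / (Cg ln y).\<close>
  define K1 where "K1 = 4 * D * Cg * (2 * real kk) ^ kk / ln 2 ^ k"
  \<comment> \<open>The first summand settles ln t < v0 ln y, where the crude bound (C + 1) F(y) is
    the one available.\<close>
  define K where "K = (C + 1) * v0 ^ kk + K1"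
  have v0: "v0 \<ge> 2" by (simp add: v0_def kk_def)
  have K1: "K1 > 0" using D Cg by (simp add: K1_def kk_def)
  have K: "K > 0" "(C + 1) * v0 ^ kk \<le> K" "K1 \<le> K" using C v0 K1 by (auto simp: K_def add_nonneg_pos)
  have tail: "D * t powr (- (1/2)) \<le> K1 / 4 * (ln (real y) / ln t) ^ kk * Fprod f y"
    if f: "unit_cm f" and y: "2 \<le> y" "real y \<le> t" for f y t
  proof -
    have t: "t \<ge> 2" using y by linarith
    have lt: "ln t > 0" using t by simp
    have ly: "ln (real y) \<ge> ln 2" using y by simp
    have ly0: "ln (real y) > 0" using y by simp
    have "ln t \<le> t powr (1 / (2 * real kk)) / (1 / (2 * real kk))"
      using t by (intro ln_powr_bound) (auto simp: kk_def)
    then have "ln t ^ kk \<le> (2 * real kk * t powr (1 / (2 * real kk))) ^ kk" using lt by (intro power_mono) (auto simp: mult.commute)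
    also have "\<dots> = (2 * real kk) ^ kk * t powr (1/2)"
    proof -
      have "(t powr (1 / (2 * real kk))) ^ kk = t powr (1 / (2 * real kk) * real kk)" using t by (simp add: powr_power)
      also have "1 / (2 * real kk) * real kk = 1 / 2" by (simp add: kk_def)
      finally show ?thesis by (simp add: power_mult_distrib)
    qed
    finally have l: "ln t ^ kk \<le> (2 * real kk) ^ kk * t powr (1/2)" .
    have "D * t powr (- (1/2)) * ln t ^ kk \<le> D * t powr (- (1/2)) * ((2 * real kk) ^ kk * t powr (1/2))"
      using l D by (intro mult_left_mono) auto
    also have "\<dots> = D * (2 * real kk) ^ kk * (t powr (- (1/2)) * t powr (1/2))" by simp
    also have "t powr (- (1/2)) * t powr (1/2) = 1" using t by (simp add: powr_add[symmetric])
    also have "D * (2 * real kk) ^ kk * 1 = K1 / 4 * (ln 2 ^ k / Cg)" using Cg by (simp add: K1_def)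
    also have "\<dots> \<le> K1 / 4 * (ln (real y) ^ k / Cg)"
      using K1 Cg ly by (intro mult_left_mono divide_right_mono power_mono) auto
    also have "\<dots> = K1 / 4 * (ln (real y) ^ kk * (1 / (Cg * ln (real y))))" using ly0 by (simp add: kk_def)
    also have "\<dots> \<le> K1 / 4 * (ln (real y) ^ kk * Fprod f y)"
      using K1 ly0 by (intro mult_left_mono Cg f y) auto
    finally show ?thesis using lt by (simp add: power_divide field_simps)
  qed
  \<comment> \<open>Induction on the dyadic size of t, for all y at once: the recursion passes from
    t to t / p \<le> t / 2.\<close>
  have main: "\<bar>rerr f y t\<bar> \<le> K * (ln (real y) / ln t) ^ kk * Fprod f y"
    if "unit_cm f" "2 \<le> y" "real y \<le> t" "t \<le> 2 ^ n" for n f y t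
    using that
  proof (induction n arbitrary: y t)
    case (Suc n)
    note f = Suc.prems(1) and y = Suc.prems(2,3)
    have t: "t \<ge> 2" using y by linarith
    have lt: "ln t > 0" using t by simp
    have ly0: "ln (real y) > 0" using y by simp
    have F0: "Fprod f y > 0" by (rule Fprod_pos[OF f])
    show ?case
    proof (cases "ln t < v0 * ln (real y)")
      case True
      have "\<bar>rsum f y t\<bar> \<le> C * Fprod f y"
      proof -
        have "\<bar>Ssum (restr f y) t\<bar> \<le> C * Fprod (restr f y) y"
          by (rule C(2)[OF unit_cm_restr[OF f] _ y]) (rule restr_eq_0)
        then show ?thesis by (simp add: rsum_def Fprod_restr)
      qed
      then have "\<bar>rerr f y t\<bar> \<le> (C + 1) * Fprod f y"
        unfolding rerr_def distrib_right using F0 by linarith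
      also have "(C + 1) \<le> K * (ln (real y) / ln t) ^ kk"
      proof -
        have "1 / v0 \<le> ln (real y) / ln t" using True lt v0 by (simp add: field_simps)
        then have "(1 / v0) ^ kk \<le> (ln (real y) / ln t) ^ kk" using v0 by (intro power_mono) auto
        then have "((C + 1) * v0 ^ kk) * (1 / v0) ^ kk \<le> K * (ln (real y) / ln t) ^ kk"
          using K C v0 by (intro mult_mono) auto
        then show ?thesis using v0 by (simp add: power_divide)
      qed
      finally show ?thesis using F0 by (simp add: mult_right_mono)
    next
      case v: False
      show ?thesis
      proof (cases "y \<le> y0")
        case True
        have "\<bar>rerr f y t\<bar> \<le> D * t powr (- (1/2))" using t by (intro D f True) auto
        also have "\<dots> \<le> K1 / 4 * (ln (real y) / ln t) ^ kk * Fprod f y" by (rule tail[OF f y])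
        also have "\<dots> \<le> K * (ln (real y) / ln t) ^ kk * Fprod f y"
          using K K1 F0 lt ly0 by (intro mult_right_mono) auto
        finally show ?thesis .
      next
        case False
        let ?P = "{p. prime p \<and> y0 < p \<and> p \<le> y}"
        have "\<bar>rerr f y t\<bar> \<le> \<bar>rerr f y0 t\<bar> + (\<Sum>p\<in>?P. 1 / real p * \<bar>rerr f p (t / real p)\<bar>)"
          using t False by (intro rerr_buchstab f) auto
        also have "\<bar>rerr f y0 t\<bar> \<le> D * t powr (- (1/2))" using t by (intro D f) auto
        also have "\<dots> \<le> K1 / 4 * (ln (real y) / ln t) ^ kk * Fprod f y" by (rule tail[OF f y])
        also have "\<dots> \<le> K / 4 * (ln (real y) / ln t) ^ kk * Fprod f y"
          using K K1 F0 lt ly0 by (intro mult_right_mono) auto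
        also have "(\<Sum>p\<in>?P. 1 / real p * \<bar>rerr f p (t / real p)\<bar>) \<le> 
           (\<Sum>p\<in>?P. (2 * K * C1 * Fprod f y * (ln (real y) / ln t) ^ kk) * (1 / real p * (ln (real p) / ln (real y)) ^ k))"
        proof (rule sum_mono)
          fix p assume p: "p \<in> ?P"
          then have p2: "p \<ge> 2" "p \<le> y" using y0 by auto
          have lp: "0 < ln (real p)" "ln (real p) \<le> ln (real y)" using p2 by auto
          define s where "s = t / real p"
          have ls: "ln s = ln t - ln (real p)" unfolding s_def using t p2 by (simp add: ln_div)
          have "v0 * ln (real p) \<le> v0 * ln (real y)" using lp v0 by (intro mult_left_mono) auto
          then have vp: "v0 * ln (real p) \<le> ln t" using v by linarith
          have "2 * ln (real p) \<le> v0 * ln (real p)" using v0 lp by (intro mult_right_mono) auto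
          then have "ln (real p) \<le> ln s" unfolding ls using vp by linarith
          moreover have "s > 0" using t p2 by (simp add: s_def)
          ultimately have ps: "real p \<le> s" using p2 by (subst (asm) ln_le_cancel_iff) auto
          have sn: "s \<le> 2 ^ n"
          proof -
            have "t / real p \<le> t / 2" using t p2 by (intro divide_left_mono) auto
            also have "\<dots> \<le> 2 ^ n" using Suc.prems by simp
            finally show ?thesis by (simp add: s_def)
          qed
          have IH: "\<bar>rerr f p s\<bar> \<le> K * (ln (real p) / ln s) ^ kk * Fprod f p"
            by (rule Suc.IH[OF f p2(1) ps sn])
          have frac: "(ln (real p) / ln s) ^ kk \<le> 2 * (ln (real p) / ln t) ^ kk"
          proof -
            have "ln (real p) \<le> ln t / v0" using vp v0 by (simp add: field_simps)
            then have l1: "(1 - 1 / v0) * ln t \<le> ln s" unfolding ls by (simp add: algebra_simps)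
            have a: "1 - 1 / v0 > 0" using v0 by (simp add: field_simps)
            have b: "(1 - 1 / v0) * ln t > 0" using a lt by simp
            have "ln (real p) / ln s \<le> ln (real p) / ((1 - 1 / v0) * ln t)"
              by (intro frac_le l1 b) (use lp in auto)
            then have "(ln (real p) / ln s) ^ kk \<le> (ln (real p) / ((1 - 1 / v0) * ln t)) ^ kk"
              using lp b l1 by (intro power_mono) auto
            also have "\<dots> = (ln (real p) / ln t) ^ kk / (1 - 1 / v0) ^ kk" by (simp add: power_divide power_mult_distrib)
            also have "\<dots> \<le> (ln (real p) / ln t) ^ kk / (1 / 2)"
            proof (rule divide_left_mono)
              have "1 + real kk * (- (1 / v0)) \<le> (1 + - (1 / v0)) ^ kk"
                using v0 by (intro Bernoulli_inequality) auto
              moreover have "real kk * (1 / v0) = 1 / 2" by (simp add: v0_def kk_def)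
              ultimately show "1 / 2 \<le> (1 - 1 / v0) ^ kk" by simp
            qed (use lp lt a in auto)
            finally show ?thesis by simp
          qed
          have "1 / real p * \<bar>rerr f p s\<bar> \<le> 1 / real p * (K * (2 * (ln (real p) / ln t) ^ kk) * (C1 * (ln (real y) / ln (real p)) * Fprod f y))"
          proof (intro mult_left_mono order.trans[OF IH] mult_mono frac C1 f p2)
            show "0 \<le> Fprod f p" using Fprod_pos[OF f, of p] by simp
          qed (use K lp lt in auto)
          also have "\<dots> = (2 * K * C1 * Fprod f y * (ln (real y) / ln t) ^ kk) * (1 / real p * (ln (real p) / ln (real y)) ^ k)"
            using lp lt ly0 by (simp add: kk_def power_divide field_simps)
          finally show "1 / real p * \<bar>rerr f p (t / real p)\<bar> \<le> (2 * K * C1 * Fprod f y * (ln (real y) / ln t) ^ kk) * (1 / real p * (ln (real p) / ln (real y)) ^ k)"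
            unfolding s_def .
        qed
        also have "\<dots> = (2 * K * C1 * Fprod f y * (ln (real y) / ln t) ^ kk) * (\<Sum>p\<in>?P. 1 / real p * (ln (real p) / ln (real y)) ^ k)"
          by (simp add: sum_distrib_left)
        also have "\<dots> \<le> (2 * K * C1 * Fprod f y * (ln (real y) / ln t) ^ kk) * \<theta>"
          using False K C1 F0 lt ly0 by (intro mult_left_mono R) auto
        also have "\<dots> = K / 4 * (ln (real y) / ln t) ^ kk * Fprod f y" using C1 by (simp add: \<theta>_def)
        also have "K / 4 * (ln (real y) / ln t) ^ kk * Fprod f y + K / 4 * (ln (real y) / ln t) ^ kk * Fprod f y \<le> K * (ln (real y) / ln t) ^ kk * Fprod f y"
          using K F0 lt ly0 by simp
        finally show ?thesis by simp
      qed
    qed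
  next
    case 0
    then show ?case by simp
  qed
  have "\<bar>rerr f y t\<bar> \<le> K * (ln (real y) / ln t) ^ kk * Fprod f y"
    if "unit_cm f" "2 \<le> y" "real y \<le> t" for f y t
  proof -
    obtain n where "t < 2 ^ n" using real_arch_pow[of 2 t] by auto
    then show ?thesis using main[OF that, of n] by simp
  qed
  moreover have "kk \<ge> 1" by (simp add: kk_def)
  ultimately show ?thesis using K(1) by (intro that[of K kk]) blast+
qed

text \<open>U = 1 + 2K makes the relative error at most K / U \<le> 1/2, so half of F(y) survives;
  and F(y) is at least of order 1 / ln y \<ge> 1 / ln t.\<close>

lemma rsum_lower:
  obtains U c where "U \<ge> 1" "c > 0" "\<And>f y t. unit_cm f \<Longrightarrow> 2 \<le> y \<Longrightarrow> real y powr U \<le> t \<Longrightarrow> rsum f y t \<ge> c / ln t"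
proof -
  obtain K kk where K: "K > 0" "kk \<ge> 1" "\<And>f y t. unit_cm f \<Longrightarrow> 2 \<le> y \<Longrightarrow> real y \<le> t \<Longrightarrow>
    \<bar>rerr f y t\<bar> \<le> K * (ln (real y) / ln t) ^ kk * Fprod f y"
    by (rule rerr_decay) blast
  obtain Cg where Cg: "Cg \<ge> 1" "\<And>u y. unit_cm u \<Longrightarrow> y \<ge> 2 \<Longrightarrow> Fprod u y \<ge> 1 / (Cg * ln (real y))"
    by (rule Fprod_ge) blast
  define U where "U = 1 + 2 * K"
  have U: "U \<ge> 1" using K by (simp add: U_def)
  have "rsum f y t \<ge> (1 / (2 * Cg)) / ln t" if f: "unit_cm f" and y: "2 \<le> y" "real y powr U \<le> t" for f y t
  proof -
    have "real y powr 1 \<le> real y powr U" using y U by (intro powr_mono) auto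
    then have yt: "real y \<le> t" using y by simp
    have ly: "ln (real y) > 0" using y by simp
    have t: "t \<ge> 2" using yt y by linarith
    have "ln (real y powr U) \<le> ln t" using y t by (intro ln_mono) auto
    then have ut: "U * ln (real y) \<le> ln t" using y by (simp add: ln_powr)
    have lt: "ln t > 0" using t by simp
    have F0: "Fprod f y > 0" by (rule Fprod_pos[OF f])
    have q: "ln (real y) / ln t \<le> 1 / U" using ut lt U by (simp add: field_simps)
    have q1: "1 / U \<le> 1" using U by simp
    have "0 \<le> ln (real y) / ln t" using ly lt by simp
    then have "(ln (real y) / ln t) ^ kk \<le> (ln (real y) / ln t) ^ 1"
      by (rule power_decreasing[OF K(2) _ order.trans[OF q q1]])
    then have "(ln (real y) / ln t) ^ kk \<le> 1 / U" using q by simp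
    then have "K * (ln (real y) / ln t) ^ kk \<le> K * (1 / U)" using K by (intro mult_left_mono) auto
    also have "\<dots> \<le> 1 / 2" using K by (simp add: U_def field_simps)
    finally have "K * (ln (real y) / ln t) ^ kk * Fprod f y \<le> 1 / 2 * Fprod f y" using F0 by (intro mult_right_mono) auto
    with K(3)[OF f y(1) yt] have "\<bar>rerr f y t\<bar> \<le> 1 / 2 * Fprod f y" by linarith
    then have "rsum f y t \<ge> 1 / 2 * Fprod f y" unfolding rerr_def by linarith
    moreover have "1 / 2 * Fprod f y \<ge> 1 / 2 * (1 / (Cg * ln (real y)))" by (intro mult_left_mono Cg f y) auto
    moreover have "1 / (Cg * ln (real y)) \<ge> 1 / (Cg * ln t)"
      using Cg ly lt yt y by (intro divide_left_mono mult_left_mono mult_pos_pos) auto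
    moreover have "(1 / (2 * Cg)) / ln t = 1 / 2 * (1 / (Cg * ln t))" by simp
    ultimately show ?thesis by linarith
  qed
  moreover have "1 / (2 * Cg) > 0" using Cg by simp
  ultimately show ?thesis by (intro that[of U "1 / (2 * Cg)"] U) blast+
qed

section \<open>Random signs\<close>

lemma Ssum_eq_rsum: "Ssum f t = rsum f (nat \<lfloor>t\<rfloor>) t"
  unfolding rsum_def Ssum_def restr_def
  using atLeastAtMost_subset_smooth[of "nat \<lfloor>t\<rfloor>"] by (intro sum.cong) auto

lemma abs_rsum_le:
  assumes "unit_cm f" "t \<ge> 1"
  shows "\<bar>rsum f y t\<bar> \<le> 1 + ln t"
  unfolding rsum_def by (rule abs_Ssum_le[OF unit_cm_restr[OF assms(1)] assms(2)])

text \<open>Buchstab's recursion involves a sum over q-smooth numbers, which depends on f(q) itself.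
  A second application replaces it by the sum over (q - 1)-smooth numbers, which does not; the term
  with f(q)^2 thus created is at most (1 + ln t) / q^2. After this, each f(q) has a coefficient
  determined by smaller primes.\<close>

lemma rsum_ge_martingale:
  assumes f: "unit_cm f" and t: "t \<ge> 1" and "y \<le> N"
  shows "rsum f N t \<ge> rsum f y t + (\<Sum>q | prime q \<and> y < q \<and> q \<le> N. f q / real q * rsum f (q - 1) (t / real q))
     - (1 + ln t) * (\<Sum>q\<in>{y<..N}. 1 / (real q)\<^sup>2)"
  using assms(3)
proof (induction N rule: dec_induct)
  case base
  have "{q. prime q \<and> y < q \<and> q \<le> y} = {}" by auto
  then show ?case by (simp only: sum.empty) simp
next
  case (step N)
  let ?q = "Suc N"
  have lt: "1 + ln t \<ge> 0" using t by simp
  have s1: "(\<Sum>q\<in>{y<..?q}. 1 / (real q)\<^sup>2) = 1 / (real ?q)\<^sup>2 + (\<Sum>q\<in>{y<..N}. 1 / (real q)\<^sup>2)"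
  proof -
    have "{y<..?q} = insert ?q {y<..N}" using step by auto
    then show ?thesis by simp
  qed
  show ?case
  proof (cases "prime ?q")
    case False
    then have set: "{q. prime q \<and> y < q \<and> q \<le> ?q} = {q. prime q \<and> y < q \<and> q \<le> N}" using le_Suc_eq by auto
    have "0 \<le> (1 + ln t) * (1 / (real ?q)\<^sup>2)" using lt by simp
    then show ?thesis using step.IH unfolding set s1 rsum_Suc_not_prime[OF False] distrib_left by linarith
  next
    case True
    have set: "{q. prime q \<and> y < q \<and> q \<le> ?q} = insert ?q {q. prime q \<and> y < q \<and> q \<le> N}" using True step le_Suc_eq by auto
    define a where "a = f ?q / real ?q"
    have a: "\<bar>a\<bar> \<le> 1 / real ?q" unfolding a_def using unit_cmD(3)[OF f True] by (simp add: divide_right_mono del: of_nat_Suc)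
    have e1: "rsum f ?q t = rsum f N t + a * rsum f ?q (t / real ?q)"
      unfolding a_def using t by (intro rsum_Suc_prime f True) auto
    have e2: "rsum f ?q (t / real ?q) = rsum f N (t / real ?q) + a * rsum f ?q (t / real ?q / real ?q)"
      unfolding a_def using t by (intro rsum_Suc_prime f True) auto
    have "\<bar>rsum f ?q (t / real ?q / real ?q)\<bar> \<le> 1 + ln t"
    proof (cases "t / real ?q / real ?q \<ge> 1")
      case True
      have q1: "1 \<le> real ?q" by simp
      have "t / real ?q / real ?q \<le> t / 1 / 1" using t q1 by (intro frac_le) (auto simp del: of_nat_Suc)
      then have le: "t / real ?q / real ?q \<le> t" by (simp only: div_by_1)
      have "0 < t / real ?q / real ?q" using True by linarith
      then have "ln (t / real ?q / real ?q) \<le> ln t" using le by (subst ln_le_cancel_iff) (use t in linarith)+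
      then show ?thesis using abs_rsum_le[OF f True, of ?q] by linarith
    next
      case False
      then have "nat \<lfloor>t / real ?q / real ?q\<rfloor> = 0" by linarith
      then have "rsum f ?q (t / real ?q / real ?q) = 0" by (simp add: rsum_def Ssum_def)
      then show ?thesis using lt by simp
    qed
    then have "\<bar>a * a * rsum f ?q (t / real ?q / real ?q)\<bar> \<le> 1 / real ?q * (1 / real ?q) * (1 + ln t)"
      unfolding abs_mult using a by (intro mult_mono) auto
    also have "\<dots> = (1 + ln t) * (1 / (real ?q)\<^sup>2)" by (simp add: power2_eq_square)
    finally have "a * a * rsum f ?q (t / real ?q / real ?q) \<ge> - ((1 + ln t) * (1 / (real ?q)\<^sup>2))" by linarith
    moreover have "rsum f ?q t = rsum f N t + a * rsum f N (t / real ?q) + a * a * rsum f ?q (t / real ?q / real ?q)"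
      unfolding e1 e2 by (simp add: algebra_simps)
    moreover have "(\<Sum>q | prime q \<and> y < q \<and> q \<le> ?q. f q / real q * rsum f (q - 1) (t / real q)) = 
        a * rsum f N (t / real ?q) + (\<Sum>q | prime q \<and> y < q \<and> q \<le> N. f q / real q * rsum f (q - 1) (t / real q))"
      unfolding set by (simp add: a_def)
    ultimately show ?thesis using step.IH unfolding s1 distrib_left by linarith
  qed
qed

lemma sum_inverse_squares_le:
  assumes "1 \<le> y" "y \<le> N"
  shows "(\<Sum>q\<in>{y<..N}. 1 / (real q)\<^sup>2) \<le> 1 / real y - 1 / real N"
  using assms(2)
proof (induction N rule: dec_induct)
  case (step N)
  have "{y<..Suc N} = insert (Suc N) {y<..N}" using step by auto
  then have "(\<Sum>q\<in>{y<..Suc N}. 1 / (real q)\<^sup>2) = 1 / (real (Suc N))\<^sup>2 + (\<Sum>q\<in>{y<..N}. 1 / (real q)\<^sup>2)" by simp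
  moreover have "1 / (real (Suc N))\<^sup>2 \<le> 1 / real N - 1 / real (Suc N)"
  proof -
    have N: "real N > 0" using step assms by simp
    have "1 / real N - 1 / real (Suc N) = 1 / (real N * real (Suc N))" using N by (simp add: field_simps)
    moreover have "1 / (real (Suc N))\<^sup>2 \<le> 1 / (real N * real (Suc N))"
      using N by (intro divide_left_mono) (auto simp: power2_eq_square)
    ultimately show ?thesis by simp
  qed
  ultimately show ?case using step.IH by linarith
qed simp

section \<open>The random function: multiplicativity and measurability\<close>

lemma rcmf_superset:
  assumes "finite A" "prime_factors n \<subseteq> A" "\<And>p. p \<in> A \<Longrightarrow> prime p"
  shows "rcmf w n = (\<Prod>p\<in>A. w p ^ multiplicity p n)"
  unfolding rcmf_def
proof (rule prod.mono_neutral_left[OF assms(1,2)], intro ballI)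
  fix p assume "p \<in> A - prime_factors n"
  then have "multiplicity p n = 0" using assms(3) by (auto simp: prime_factors_multiplicity)
  then show "w p ^ multiplicity p n = 1" by simp
qed

lemma unit_cm_rcmf:
  assumes "\<And>p. prime p \<Longrightarrow> \<bar>w p\<bar> \<le> 1"
  shows "unit_cm (rcmf w)"
  unfolding unit_cm_def
proof (intro conjI allI impI)
  show "rcmf w 1 = 1" by (simp add: rcmf_def)
  show "\<bar>rcmf w p\<bar> \<le> 1" if "prime p" for p
    using assms[OF that] that by (simp add: rcmf_def prime_prime_factors)
  fix m n :: nat assume mn: "m > 0" "n > 0"
  let ?A = "prime_factors m \<union> prime_factors n"
  have "rcmf w (m * n) = (\<Prod>p\<in>?A. w p ^ multiplicity p (m * n))"
    using mn by (intro rcmf_superset) (auto simp: prime_factors_product)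
  also have "\<dots> = (\<Prod>p\<in>?A. w p ^ multiplicity p m * w p ^ multiplicity p n)"
  proof (intro prod.cong refl)
    fix p assume "p \<in> ?A"
    then have "prime_elem p" by (auto dest: in_prime_factors_imp_prime)
    then show "w p ^ multiplicity p (m * n) = w p ^ multiplicity p m * w p ^ multiplicity p n"
      using mn by (simp add: prime_elem_multiplicity_mult_distrib power_add)
  qed
  also have "\<dots> = (\<Prod>p\<in>?A. w p ^ multiplicity p m) * (\<Prod>p\<in>?A. w p ^ multiplicity p n)"
    by (rule prod.distrib)
  also have "\<dots> = rcmf w m * rcmf w n"
    by (subst (1 2) rcmf_superset[of ?A]) auto
  finally show "rcmf w (m * n) = rcmf w m * rcmf w n" .
qed

lemma rcmf_prime: "prime p \<Longrightarrow> rcmf w p = w p"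
  by (simp add: rcmf_def prime_prime_factors)

lemma prime_factors_smooth: "n \<in> smooth M \<Longrightarrow> prime_factors n \<subseteq> {p. prime p \<and> p \<le> M}"
  by (auto simp: smooth_def prime_factors_dvd)

lemma rsum_rcmf_cong:
  assumes "\<And>p. prime p \<Longrightarrow> p \<le> M \<Longrightarrow> v p = w p"
  shows "rsum (rcmf v) M t = rsum (rcmf w) M t"
proof -
  have "rcmf v n = rcmf w n" if "n \<in> smooth M" for n
    unfolding rcmf_def using prime_factors_smooth[OF that] assms by (intro prod.cong refl) auto
  then show ?thesis unfolding rsum_def Ssum_def restr_def by (intro sum.cong refl) auto
qed

lemma measurable_rademacher_component:
  assumes "p \<in> A"
  shows "(\<lambda>v. v p) \<in> borel_measurable (\<Pi>\<^sub>M p\<in>A. rademacher)"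
proof -
  have 1: "(\<lambda>v. v p) \<in> measurable (\<Pi>\<^sub>M p\<in>A. rademacher) rademacher"
    by (rule measurable_component_singleton[OF assms])
  have 2: "(\<lambda>x. x) \<in> measurable rademacher borel" unfolding rademacher_def by simp
  show ?thesis using measurable_compose[OF 1 2] by simp
qed

text \<open>The index set A is left open so that the statement serves both the whole space and the
  finitely many coordinates below a given prime.\<close>

lemma measurable_rsum_rcmf:
  assumes "{p. prime p \<and> p \<le> M} \<subseteq> A"
  shows "(\<lambda>v. rsum (rcmf v) M t) \<in> borel_measurable (\<Pi>\<^sub>M p\<in>A. rademacher)"
proof -
  have "(\<lambda>v. restr (rcmf v) M n / real n) \<in> borel_measurable (\<Pi>\<^sub>M p\<in>A. rademacher)" for n
  proof (cases "n \<in> smooth M")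
    case True
    have "(\<lambda>v. rcmf v n) \<in> borel_measurable (\<Pi>\<^sub>M p\<in>A. rademacher)"
      unfolding rcmf_def using prime_factors_smooth[OF True] assms
      by (intro borel_measurable_prod borel_measurable_power measurable_rademacher_component) auto
    then show ?thesis using True by (simp add: restr_def)
  qed (simp add: restr_def)
  then show ?thesis unfolding rsum_def Ssum_def by (intro borel_measurable_sum)
qed

lemma cosh_le_exp_square:
  fixes x :: real
  shows "cosh x \<le> exp (x\<^sup>2)"
proof -
  have "cosh x \<le> exp (x\<^sup>2)" if x: "x \<ge> 0" for x :: real
  proof (cases "x \<le> 1")
    case True
    have "exp x \<le> 1 + x + x\<^sup>2" using exp_bound[OF x True] .
    moreover have "exp (- x) \<le> 1 - x + x\<^sup>2"
    proof -
      have "exp (- x) \<le> 1 / (1 + x)" unfolding exp_minus inverse_eq_divide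
        using x exp_ge_add_one_self[of x] by (intro divide_left_mono) auto
      also have "\<dots> \<le> 1 - x + x\<^sup>2"
      proof -
        have "(1 - x + x\<^sup>2) * (1 + x) = 1 + x ^ 3" by (simp add: algebra_simps power2_eq_square power3_eq_cube)
        also have "\<dots> \<ge> 1" using x by simp
        finally show ?thesis using x by (simp add: pos_divide_le_eq)
      qed
      finally show ?thesis .
    qed
    ultimately have "cosh x \<le> 1 + x\<^sup>2" by (simp add: cosh_field_def)
    also have "\<dots> \<le> exp (x\<^sup>2)" by (rule exp_ge_add_one_self)
    finally show ?thesis .
  next
    case False
    have "exp (- x) \<le> exp x" using x by simp
    then have "cosh x \<le> exp x" by (simp add: cosh_field_def)
    also have "\<dots> \<le> exp (x\<^sup>2)" using False by (simp add: power2_eq_square)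
    finally show ?thesis .
  qed
  from this[of "\<bar>x\<bar>"] show ?thesis by simp
qed

section \<open>The product space of signs\<close>

abbreviation "primes \<equiv> {p::nat. prime p}"

lemma prob_space_rademacher: "prob_space rademacher"
  unfolding rademacher_def by (rule prob_space_measure_pmf)

lemma rad_space_eq: "rad_space = Pi\<^sub>M primes (\<lambda>_. rademacher)"
  by (simp add: rad_space_def)

lemma prob_space_rad_space: "prob_space rad_space"
  unfolding rad_space_eq by (intro prob_space_PiM prob_space_rademacher)

lemma expectation_rad_component:
  assumes "prime q"
  shows "integrable rad_space (\<lambda>w. w q)" "(\<integral>w. w q \<partial>rad_space) = 0"
proof -
  have d: "distr rad_space rademacher (\<lambda>w. w q) = rademacher"
    unfolding rad_space_eq using assms by (intro distr_PiM_component prob_space_rademacher) auto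
  have m: "(\<lambda>w. w q) \<in> measurable rad_space rademacher"
    unfolding rad_space_eq using assms by (intro measurable_component_singleton) auto
  have i: "integrable rademacher (\<lambda>x. x)"
    unfolding rademacher_def by (rule integrable_measure_pmf_finite) simp
  have "integrable (distr rad_space rademacher (\<lambda>w. w q)) (\<lambda>x. x)" unfolding d by (rule i)
  then show "integrable rad_space (\<lambda>w. w q)" by (rule integrable_distr[OF m])
  have "(\<integral>w. w q \<partial>rad_space) = (\<integral>x. x \<partial>distr rad_space rademacher (\<lambda>w. w q))"
    by (rule integral_distr[OF m, symmetric]) (simp add: rademacher_def)
  also have "\<dots> = (\<integral>x. x \<partial>rademacher)" unfolding d ..
  also have "\<dots> = 0" unfolding rademacher_def by (subst integral_pmf_of_set) auto
  finally show "(\<integral>w. w q \<partial>rad_space) = 0" .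
qed

text \<open>Points of \<open>rad_space\<close> attach arbitrary reals to the primes; the values 1
  and -1 are only almost sure, and simultaneously so because the primes are countable.\<close>

lemma AE_rad_space: "AE w in rad_space. \<forall>p. prime p \<longrightarrow> w p = 1 \<or> w p = - 1"
proof -
  have "AE w in rad_space. w p = 1 \<or> w p = - 1" if "prime p" for p
    unfolding rad_space_eq
  proof (rule AE_PiM_component)
    show "AE x in rademacher. x = 1 \<or> x = - 1"
      unfolding rademacher_def by (subst AE_measure_pmf_iff) auto
  qed (use that prob_space_rademacher in auto)
  then show ?thesis by (subst AE_all_countable) auto
qed

lemma AE_unit_cm_rcmf: "AE w in rad_space. unit_cm (rcmf w)"
    using AE_rad_space
  proof eventually_elim
    case (elim w)
    show ?case
    proof (rule unit_cm_rcmf)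
      fix p :: nat assume "prime p"
      then have "w p = 1 \<or> w p = - 1" using elim by blast
      then show "\<bar>w p\<bar> \<le> 1" by auto
    qed
  qed

lemma indep_vars_rad_space: "prob_space.indep_vars rad_space (\<lambda>_. rademacher) (\<lambda>p w. w p) primes"
proof -
  interpret P: prob_space rad_space by (rule prob_space_rad_space)
  have ne: "primes \<noteq> {}" using two_is_prime_nat by auto
  have m: "(\<lambda>w. w p) \<in> measurable rad_space rademacher" if "p \<in> primes" for p
    unfolding rad_space_eq using that by (intro measurable_component_singleton)
  have "distr rad_space (Pi\<^sub>M primes (\<lambda>_. rademacher)) (\<lambda>w. \<lambda>p\<in>primes. w p) = distr rad_space rad_space (\<lambda>w. w)"
    by (rule distr_cong) (auto simp: rad_space_eq space_PiM PiE_def extensional_restrict)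
  also have "\<dots> = rad_space" by (rule distr_id)
  also have "\<dots> = Pi\<^sub>M primes (\<lambda>p. distr rad_space rademacher (\<lambda>w. w p))"
    unfolding rad_space_eq by (intro PiM_cong refl distr_PiM_component[symmetric] prob_space_rademacher) auto
  finally show ?thesis using m by (subst P.indep_vars_iff_distr_eq_PiM'[OF ne]) auto
qed

text \<open>\<open>G (restrict w A) = G w\<close> says that G depends on the coordinates in A alone.
  As q is not among them, independence of disjoint blocks of coordinates makes the mean of the
  product vanish. This plays the role of conditioning on the earlier signs.\<close>

lemma expectation_times_rad_component:
  assumes q: "prime q" and A: "A \<subseteq> primes" "q \<notin> A"
    and G: "G \<in> borel_measurable (\<Pi>\<^sub>M p\<in>A. rademacher)" and dep: "\<And>w. G (restrict w A) = G w"
    and int: "integrable rad_space G"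
  shows "(\<integral>w. G w * w q \<partial>rad_space) = (0::real)" "integrable rad_space (\<lambda>w. G w * w q)"
proof -
  interpret P: prob_space rad_space by (rule prob_space_rad_space)
  have "P.indep_var (\<Pi>\<^sub>M p\<in>A. rademacher) (\<lambda>w. restrict (\<lambda>p. w p) A) (\<Pi>\<^sub>M p\<in>{q}. rademacher) (\<lambda>w. restrict (\<lambda>p. w p) {q})"
    by (rule P.indep_var_restrict[OF indep_vars_rad_space]) (use A q in auto)
  then have "P.indep_var borel (G \<circ> (\<lambda>w. restrict (\<lambda>p. w p) A)) borel ((\<lambda>v. v q) \<circ> (\<lambda>w. restrict (\<lambda>p. w p) {q}))"
    by (rule P.indep_var_compose[OF _ G measurable_rademacher_component]) simp
  then have ind: "P.indep_var borel G borel (\<lambda>w. w q)" using dep by (simp add: comp_def)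
  show "(\<integral>w. G w * w q \<partial>rad_space) = 0"
    using P.indep_var_lebesgue_integral[OF ind int expectation_rad_component(1)[OF q]] expectation_rad_component(2)[OF q] by simp
  show "integrable rad_space (\<lambda>w. G w * w q)"
    by (rule P.indep_var_integrable[OF ind int expectation_rad_component(1)[OF q]])
qed

section \<open>The martingale and its tail\<close>

definition mart :: "nat \<Rightarrow> real \<Rightarrow> nat \<Rightarrow> (nat \<Rightarrow> real) \<Rightarrow> real" where
  "mart y t N w = (\<Sum>q | prime q \<and> y < q \<and> q \<le> N. w q / real q * rsum (rcmf w) (q - 1) (t / real q))"

lemma measurable_mart:
  assumes "{p. prime p \<and> p \<le> N} \<subseteq> A"
  shows "mart y t N \<in> borel_measurable (\<Pi>\<^sub>M p\<in>A. rademacher)"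
  unfolding mart_def
proof (intro borel_measurable_sum borel_measurable_times borel_measurable_divide measurable_rademacher_component measurable_rsum_rcmf)
  fix q assume "q \<in> {q. prime q \<and> y < q \<and> q \<le> N}"
  then show "q \<in> A" "{p. prime p \<and> p \<le> q - 1} \<subseteq> A" using assms by auto
qed auto

lemma mart_cong:
  assumes "\<And>p. prime p \<Longrightarrow> p \<le> N \<Longrightarrow> v p = w p"
  shows "mart y t N v = mart y t N w"
  unfolding mart_def
proof (rule sum.cong[OF refl])
  fix q assume q: "q \<in> {q. prime q \<and> y < q \<and> q \<le> N}"
  have "rsum (rcmf v) (q - 1) (t / real q) = rsum (rcmf w) (q - 1) (t / real q)"
    using assms q by (intro rsum_rcmf_cong) auto
  then show "v q / real q * rsum (rcmf v) (q - 1) (t / real q) = w q / real q * rsum (rcmf w) (q - 1) (t / real q)"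
    using assms q by simp
qed

lemma mart_Suc:
  "y \<le> N \<Longrightarrow> mart y t (Suc N) w = mart y t N w + (if prime (Suc N) then w (Suc N) / real (Suc N) * rsum (rcmf w) N (t / real (Suc N)) else 0)"
proof (cases "prime (Suc N)")
  case True
  assume "y \<le> N"
  then have "{q. prime q \<and> y < q \<and> q \<le> Suc N} = insert (Suc N) {q. prime q \<and> y < q \<and> q \<le> N}" using True le_Suc_eq by auto
  then show ?thesis using True by (simp add: mart_def)
next
  case False
  then have "{q. prime q \<and> y < q \<and> q \<le> Suc N} = {q. prime q \<and> y < q \<and> q \<le> N}" using le_Suc_eq by auto
  then show ?thesis using False by (simp add: mart_def)
qed

text \<open>A new prime q multiplies the integrand by exp(- Y w(q)), where Y depends on smaller
  primes only. As w(q) is 1 or -1, this is cosh Y - w(q) sinh Y; the second part integrates to 0 by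
  independence, and cosh Y is at most exp((\<theta> (1 + ln t) / q)^2). The condition
  \<open>real N \<le> t\<close> keeps t/q \<ge> 1, where the logarithmic bound for the coefficient
  of w(q)/q is available.\<close>

lemma mart_exp_moment:
  assumes y: "1 \<le> y" and N: "y \<le> N" "real N \<le> t"
  shows "integrable rad_space (\<lambda>w. exp (- (\<theta> * mart y t N w)))
    \<and> (\<integral>w. exp (- (\<theta> * mart y t N w)) \<partial>rad_space) \<le> exp (\<theta>\<^sup>2 * (1 + ln t)\<^sup>2 * (\<Sum>q\<in>{y<..N}. 1 / (real q)\<^sup>2))"
proof -
  interpret P: prob_space rad_space by (rule prob_space_rad_space)
  define B where "B = 1 + ln t"
  show ?thesis using N unfolding B_def[symmetric]
  proof (induction N rule: dec_induct)
    case base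
    have "mart y t y w = 0" for w unfolding mart_def by (rule sum.neutral) auto
    then show ?case using P.prob_space by simp
  next
    case (step N)
    let ?q = "Suc N"
    have t: "t \<ge> 1" using step y by simp
    have B0: "B \<ge> 0" using t by (simp add: B_def)
    have IH: "integrable rad_space (\<lambda>w. exp (- (\<theta> * mart y t N w)))"
      "(\<integral>w. exp (- (\<theta> * mart y t N w)) \<partial>rad_space) \<le> exp (\<theta>\<^sup>2 * B\<^sup>2 * (\<Sum>q\<in>{y<..N}. 1 / (real q)\<^sup>2))"
      using step by auto
    have s1: "(\<Sum>q\<in>{y<..?q}. 1 / (real q)\<^sup>2) = 1 / (real ?q)\<^sup>2 + (\<Sum>q\<in>{y<..N}. 1 / (real q)\<^sup>2)"
    proof -
      have "{y<..?q} = insert ?q {y<..N}" using step by auto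
      then show ?thesis by simp
    qed
    show ?case
    proof (cases "prime ?q")
      case False
      have m: "mart y t ?q w = mart y t N w" for w using False step by (simp add: mart_Suc)
      have "exp (\<theta>\<^sup>2 * B\<^sup>2 * (\<Sum>q\<in>{y<..N}. 1 / (real q)\<^sup>2)) \<le> exp (\<theta>\<^sup>2 * B\<^sup>2 * (\<Sum>q\<in>{y<..?q}. 1 / (real q)\<^sup>2))"
        unfolding s1 by (simp add: mult_left_mono)
      then show ?thesis unfolding m using IH(1) order.trans[OF IH(2)] by blast
    next
      case q: True
      let ?A = "{p. prime p \<and> p \<le> N}"
      define Y where "Y = (\<lambda>w. \<theta> / real ?q * rsum (rcmf w) N (t / real ?q))"
      define E where "E = (\<lambda>w. exp (- (\<theta> * mart y t N w)))"
      have Yb: "\<bar>Y w\<bar> \<le> \<bar>\<theta>\<bar> * B / real ?q" if "unit_cm (rcmf w)" for w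
      proof -
        have t1: "t / real ?q \<ge> 1" using step by (simp add: le_divide_eq)
        have "t / real ?q \<le> t / 1" using t by (intro divide_left_mono) auto
        then have "ln (t / real ?q) \<le> ln t" using t1 by (intro ln_mono) auto
        then have "\<bar>rsum (rcmf w) N (t / real ?q)\<bar> \<le> B"
          using abs_rsum_le[OF that t1, of N] by (simp add: B_def)
        then have "\<bar>\<theta>\<bar> / real ?q * \<bar>rsum (rcmf w) N (t / real ?q)\<bar> \<le> \<bar>\<theta>\<bar> / real ?q * B" by (intro mult_left_mono) auto
        then show ?thesis by (simp add: Y_def abs_mult del: of_nat_Suc)
      qed
      have Ym: "Y \<in> borel_measurable (\<Pi>\<^sub>M p\<in>A. rademacher)" if "?A \<subseteq> A" for A
        unfolding Y_def using measurable_rsum_rcmf[OF that] by (intro borel_measurable_times) auto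
      have Em: "E \<in> borel_measurable (\<Pi>\<^sub>M p\<in>A. rademacher)" if "?A \<subseteq> A" for A
      proof -
        note [measurable] = measurable_mart[OF that]
        show ?thesis unfolding E_def by measurable
      qed
      have Ym': "Y \<in> borel_measurable rad_space" and Em': "E \<in> borel_measurable rad_space"
        unfolding rad_space_eq by (rule Ym Em, auto)+
      have Ei: "integrable rad_space E" using IH(1) by (simp add: E_def)
      define c where "c = exp ((\<bar>\<theta>\<bar> * B / real ?q)\<^sup>2)"
      define c' where "c' = cosh (\<bar>\<theta>\<bar> * B / real ?q)"
      have cosh_mono: "cosh a \<le> cosh b" if "\<bar>a\<bar> \<le> b" for a b :: real
        using cosh_real_nonneg_le_iff[of "\<bar>a\<bar>" b] that by simp
      have chb: "AE w in rad_space. \<bar>E w * cosh (Y w)\<bar> \<le> \<bar>c * E w\<bar>"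
        using AE_unit_cm_rcmf
      proof eventually_elim
        case (elim w)
        have "cosh (Y w) \<le> cosh (\<bar>\<theta>\<bar> * B / real ?q)" by (rule cosh_mono[OF Yb[OF elim]])
        also have "\<dots> \<le> c" unfolding c_def by (rule cosh_le_exp_square)
        finally show ?case by (simp add: E_def c_def mult.commute abs_mult)
      qed
      have Ci: "integrable rad_space (\<lambda>w. E w * cosh (Y w))"
      proof (rule Bochner_Integration.integrable_bound)
        show "integrable rad_space (\<lambda>w. c * E w)" using Ei by (rule integrable_mult_right)
        show "(\<lambda>w. E w * cosh (Y w)) \<in> borel_measurable rad_space"
          unfolding cosh_field_def using Ym' Em' by measurable
        show "AE w in rad_space. norm (E w * cosh (Y w)) \<le> norm (c * E w)" using chb by simp
      qed
      have Si: "integrable rad_space (\<lambda>w. E w * sinh (Y w))"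
      proof (rule Bochner_Integration.integrable_bound[OF Ci])
        show "(\<lambda>w. E w * sinh (Y w)) \<in> borel_measurable rad_space"
          unfolding sinh_field_def using Ym' Em' by measurable
        have "\<bar>sinh x\<bar> \<le> cosh x" for x :: real
          by (simp add: sinh_field_def cosh_field_def abs_le_iff)
        then show "AE w in rad_space. norm (E w * sinh (Y w)) \<le> norm (E w * cosh (Y w))"
          by (intro AE_I2) (auto simp: abs_mult intro!: mult_left_mono)
      qed
      have sub: "?A \<subseteq> primes" "?q \<notin> ?A" by auto
      have Gm: "(\<lambda>w. E w * sinh (Y w)) \<in> borel_measurable (\<Pi>\<^sub>M p\<in>?A. rademacher)"
        unfolding sinh_field_def using Ym[OF order_refl] Em[OF order_refl] by measurable
      have dep: "(\<lambda>w. E w * sinh (Y w)) (restrict w ?A) = (\<lambda>w. E w * sinh (Y w)) w" for w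
      proof -
        have "mart y t N (restrict w ?A) = mart y t N w" by (intro mart_cong) auto
        moreover have "rsum (rcmf (restrict w ?A)) N (t / real ?q) = rsum (rcmf w) N (t / real ?q)"
          by (intro rsum_rcmf_cong) auto
        ultimately show ?thesis by (simp add: E_def Y_def del: of_nat_Suc)
      qed
      note Z = expectation_times_rad_component[OF q sub Gm dep Si]
      have eq: "AE w in rad_space. exp (- (\<theta> * mart y t ?q w)) = E w * cosh (Y w) - E w * sinh (Y w) * w ?q"
        using AE_rad_space
      proof eventually_elim
        case (elim w)
        have w: "w ?q = 1 \<or> w ?q = - 1" using elim q by blast
        have "- (\<theta> * mart y t ?q w) = - (\<theta> * mart y t N w) + - (w ?q * Y w)"
          using q step by (simp add: mart_Suc Y_def algebra_simps del: of_nat_Suc)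
        then have "exp (- (\<theta> * mart y t ?q w)) = E w * exp (- (w ?q * Y w))" by (simp only: E_def exp_add)
        also have "exp (- (w ?q * Y w)) = cosh (Y w) - sinh (Y w) * w ?q"
          using w by (auto simp: cosh_field_def sinh_field_def field_simps)
        finally show ?case by (simp add: algebra_simps)
      qed
      have int: "integrable rad_space (\<lambda>w. E w * cosh (Y w) - E w * sinh (Y w) * w ?q)"
        by (rule Bochner_Integration.integrable_diff[OF Ci Z(2)])
      have meas: "(\<lambda>w. exp (- (\<theta> * mart y t ?q w))) \<in> borel_measurable rad_space"
      proof -
        have [measurable]: "mart y t ?q \<in> borel_measurable rad_space"
          unfolding rad_space_eq by (rule measurable_mart) auto
        show ?thesis by measurable
      qed
      have "integrable rad_space (\<lambda>w. exp (- (\<theta> * mart y t ?q w)))"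
        using int by (subst integrable_cong_AE[OF meas _ eq]) auto
      moreover have "(\<integral>w. exp (- (\<theta> * mart y t ?q w)) \<partial>rad_space) \<le> exp (\<theta>\<^sup>2 * B\<^sup>2 * (\<Sum>q\<in>{y<..?q}. 1 / (real q)\<^sup>2))"
      proof -
        have "(\<integral>w. exp (- (\<theta> * mart y t ?q w)) \<partial>rad_space) = (\<integral>w. E w * cosh (Y w) - E w * sinh (Y w) * w ?q \<partial>rad_space)"
          using int by (intro integral_cong_AE meas eq) auto
        also have "\<dots> = (\<integral>w. E w * cosh (Y w) \<partial>rad_space)"
          using Bochner_Integration.integral_diff[OF Ci Z(2)] Z(1) by simp
        also have "\<dots> \<le> (\<integral>w. c * E w \<partial>rad_space)"
        proof (rule integral_mono_AE[OF Ci integrable_mult_right[OF Ei]])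
          show "AE w in rad_space. E w * cosh (Y w) \<le> c * E w"
            using chb by eventually_elim (simp add: E_def c_def abs_mult)
        qed
        also have "\<dots> = c * (\<integral>w. E w \<partial>rad_space)" by simp
        also have "\<dots> \<le> c * exp (\<theta>\<^sup>2 * B\<^sup>2 * (\<Sum>q\<in>{y<..N}. 1 / (real q)\<^sup>2))"
          using IH(2) by (intro mult_left_mono) (auto simp: E_def c_def)
        also have "\<dots> = exp (\<theta>\<^sup>2 * B\<^sup>2 * (\<Sum>q\<in>{y<..?q}. 1 / (real q)\<^sup>2))"
          unfolding s1 c_def exp_add[symmetric] by (simp add: power_mult_distrib power_divide distrib_left del: of_nat_Suc)
        finally show ?thesis .
      qed
      ultimately show ?thesis by blast
    qed
  qed
qed


lemma mart_tail:
  assumes y: "1 \<le> y" "real y \<le> t" and l: "l > 0"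
  shows "measure rad_space {w \<in> space rad_space. mart y t (nat \<lfloor>t\<rfloor>) w \<le> - l} \<le> exp (- (l\<^sup>2 * real y / (4 * (1 + ln t)\<^sup>2)))"
proof -
  interpret P: prob_space rad_space by (rule prob_space_rad_space)
  define B where "B = 1 + ln t"
  define N where "N = nat \<lfloor>t\<rfloor>"
  have N: "y \<le> N" "real N \<le> t" unfolding N_def using y by linarith+
  have t: "t \<ge> 1" using y by linarith
  have B: "B \<ge> 1" using t by (simp add: B_def)
  \<comment> \<open>The minimiser of \<theta>^2 B^2 / y - \<theta> l, with minimum - l^2 y / (4
    B^2).\<close>
  define \<theta> where "\<theta> = l * real y / (2 * B\<^sup>2)"
  have \<theta>: "\<theta> > 0" using l y B by (simp add: \<theta>_def)
  let ?u = "\<lambda>w. exp (- (\<theta> * mart y t N w))"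
  note M = mart_exp_moment[OF y(1) N, of \<theta>, folded B_def]
  have "m \<le> - l \<longleftrightarrow> exp (\<theta> * l) \<le> exp (- (\<theta> * m))" for m
  proof -
    have "exp (\<theta> * l) \<le> exp (- (\<theta> * m)) \<longleftrightarrow> \<theta> * l \<le> \<theta> * (- m)" by simp
    also have "\<dots> \<longleftrightarrow> l \<le> - m" by (rule mult_le_cancel_left_pos[OF \<theta>])
    finally show ?thesis by auto
  qed
  then have "{w \<in> space rad_space. mart y t N w \<le> - l} = {w \<in> space rad_space. ?u w \<ge> exp (\<theta> * l)}"
    by (simp only:)
  then have "measure rad_space {w \<in> space rad_space. mart y t N w \<le> - l} \<le> (\<integral>w. ?u w \<partial>rad_space) / exp (\<theta> * l)"
    using integral_Markov_inequality_measure[of rad_space ?u "{}" "exp (\<theta> * l)"] M by simp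
  also have "\<dots> \<le> exp (\<theta>\<^sup>2 * B\<^sup>2 * (\<Sum>q\<in>{y<..N}. 1 / (real q)\<^sup>2)) / exp (\<theta> * l)"
    using M by (intro divide_right_mono) auto
  also have "\<dots> = exp (\<theta>\<^sup>2 * B\<^sup>2 * (\<Sum>q\<in>{y<..N}. 1 / (real q)\<^sup>2) - \<theta> * l)" by (simp add: exp_diff)
  also have "\<dots> \<le> exp (\<theta>\<^sup>2 * B\<^sup>2 * (1 / real y) - \<theta> * l)"
  proof -
    have "(\<Sum>q\<in>{y<..N}. 1 / (real q)\<^sup>2) \<le> 1 / real y"
    proof -
      have "0 \<le> 1 / real N" by simp
      then show ?thesis using sum_inverse_squares_le[OF y(1) N(1)] by linarith
    qed
    then have "\<theta>\<^sup>2 * B\<^sup>2 * (\<Sum>q\<in>{y<..N}. 1 / (real q)\<^sup>2) \<le> \<theta>\<^sup>2 * B\<^sup>2 * (1 / real y)" by (intro mult_left_mono) auto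
    then show ?thesis by simp
  qed
  also have "\<theta>\<^sup>2 * B\<^sup>2 * (1 / real y) - \<theta> * l = - (l\<^sup>2 * real y / (4 * B\<^sup>2))"
    using y B by (simp add: \<theta>_def field_simps power2_eq_square)
  finally show ?thesis by (simp add: N_def B_def)
qed

theorem theorem2p3:
  shows "\<exists>\<beta>>0. \<exists>C. \<exists>x0. \<forall>x::real\<ge>x0.
    measure rad_space {w \<in> space rad_space. (\<Sum>n\<in>{1..nat \<lfloor>x\<rfloor>}. rcmf w n / real n) < 0}
      \<le> C * exp (- (x powr \<beta>))"
proof -
  interpret P: prob_space rad_space by (rule prob_space_rad_space)
  obtain U c where U: "U \<ge> 1" and c: "c > 0" and low: "\<And>f y t. unit_cm f \<Longrightarrow> 2 \<le> y \<Longrightarrow> real y powr U \<le> t \<Longrightarrow> rsum f y t \<ge> c / ln t"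
    by (rule rsum_lower) blast
  \<comment> \<open>With y close to x^a the lower bound for smooth sums applies, since y^U \<le> x.
    The final \<beta> is a / 2: the other half of the exponent absorbs the powers of ln x.\<close>
  define a where "a = 1 / U"
  have a: "a > 0" "a \<le> 1" using U by (auto simp: a_def)
  \<comment> \<open>In turn: y is at least 2; the error from the terms 1/q^2 is at most
    \<open>l\<close>; the exponent of the tail bound is at least x^(a/2).\<close>
  have "eventually (\<lambda>x. x powr a \<ge> 2 \<and> 4 * (1 + ln x) * ln x \<le> c * x powr a \<and>
      x powr (a / 2) \<le> (c / (2 * ln x))\<^sup>2 * (x powr a / 2) / (4 * (1 + ln x)\<^sup>2)) at_top"
    using a c by (intro eventually_conj; real_asymp)
  then have "eventually (\<lambda>x. x \<ge> 3 \<and> x powr a \<ge> 2 \<and> 4 * (1 + ln x) * ln x \<le> c * x powr a \<and>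
      x powr (a / 2) \<le> (c / (2 * ln x))\<^sup>2 * (x powr a / 2) / (4 * (1 + ln x)\<^sup>2)) at_top"
    by (rule eventually_conj[OF eventually_ge_at_top])
  then obtain x0 where x0: "\<And>x. x \<ge> x0 \<Longrightarrow> x \<ge> 3 \<and> x powr a \<ge> 2 \<and> 4 * (1 + ln x) * ln x \<le> c * x powr a \<and>
      x powr (a / 2) \<le> (c / (2 * ln x))\<^sup>2 * (x powr a / 2) / (4 * (1 + ln x)\<^sup>2)"
    unfolding eventually_at_top_linorder by blast
  have "measure rad_space {w \<in> space rad_space. (\<Sum>n\<in>{1..nat \<lfloor>x\<rfloor>}. rcmf w n / real n) < 0} \<le> 1 * exp (- (x powr (a / 2)))"
    if "x \<ge> x0" for x
  proof -
    note x = x0[OF that]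
    have x3: "x \<ge> 3" and xa: "x powr a \<ge> 2" using x by auto
    have lx: "ln x > 0" using x3 by simp
    define y where "y = nat \<lfloor>x powr a\<rfloor>"
    define N where "N = nat \<lfloor>x\<rfloor>"
    \<comment> \<open>Half of the lower bound c / ln x for the smooth sum. The error from the terms
      1/q^2 takes away at most one \<open>l\<close>, so a negative sum forces the martingale below -
      l.\<close>
    define l where "l = c / (2 * ln x)"
    have l: "l > 0" using c lx by (simp add: l_def)
    have y: "2 \<le> y" "real y \<le> x powr a" "x powr a \<le> real y + 1" unfolding y_def using xa by linarith+
    have y2: "x powr a / 2 \<le> real y" using y by linarith
    have yU: "real y powr U \<le> x"
    proof -
      have "real y powr U \<le> (x powr a) powr U" using y U by (intro powr_mono2) auto
      also have "\<dots> = x" using x3 U by (simp add: powr_powr a_def)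
      finally show ?thesis .
    qed
    have "x powr a \<le> x powr 1" using x3 a by (intro powr_mono) auto
    then have yx: "real y \<le> x" using y x3 by simp
    have yN: "y \<le> N" unfolding N_def using yx by linarith
    have small: "(1 + ln x) * (1 / real y) \<le> l"
    proof -
      have "2 * (1 + ln x) * ln x \<le> c * real y"
      proof -
        have "4 * (1 + ln x) * ln x \<le> c * x powr a" using x by auto
        also have "\<dots> \<le> c * (2 * real y)" using y2 c by (intro mult_left_mono) auto
        finally show ?thesis by (simp add: algebra_simps)
      qed
      then show ?thesis using lx y by (simp add: l_def field_simps)
    qed
    have sets: "{w \<in> space rad_space. mart y x N w \<le> - l} \<in> sets rad_space"
    proof -
      have [measurable]: "mart y x N \<in> borel_measurable rad_space"
        unfolding rad_space_eq by (rule measurable_mart) auto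
      show ?thesis by measurable
    qed
    have "measure rad_space {w \<in> space rad_space. (\<Sum>n\<in>{1..nat \<lfloor>x\<rfloor>}. rcmf w n / real n) < 0}
       \<le> measure rad_space {w \<in> space rad_space. mart y x N w \<le> - l}"
    proof (rule P.finite_measure_mono_AE[OF _ sets])
      show "AE w in rad_space. w \<in> {w \<in> space rad_space. (\<Sum>n\<in>{1..nat \<lfloor>x\<rfloor>}. rcmf w n / real n) < 0} \<longrightarrow>
          w \<in> {w \<in> space rad_space. mart y x N w \<le> - l}"
        using AE_unit_cm_rcmf
      proof eventually_elim
        case (elim w)
        have "(\<Sum>q | prime q \<and> y < q \<and> q \<le> N. rcmf w q / real q * rsum (rcmf w) (q - 1) (x / real q)) = mart y x N w"
          unfolding mart_def by (intro sum.cong refl) (simp add: rcmf_prime)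
        then have "rsum (rcmf w) N x \<ge> rsum (rcmf w) y x + mart y x N w - (1 + ln x) * (\<Sum>q\<in>{y<..N}. 1 / (real q)\<^sup>2)"
          using rsum_ge_martingale[OF elim _ yN, of x] x3 by simp
        moreover have "(1 + ln x) * (\<Sum>q\<in>{y<..N}. 1 / (real q)\<^sup>2) \<le> (1 + ln x) * (1 / real y)"
        proof (rule mult_left_mono)
          have "0 \<le> 1 / real N" by simp
          then show "(\<Sum>q\<in>{y<..N}. 1 / (real q)\<^sup>2) \<le> 1 / real y"
            using sum_inverse_squares_le[of y N] y yN by linarith
        qed (use lx in simp)
        moreover have "rsum (rcmf w) y x \<ge> 2 * l" using low[OF elim y(1) yU] by (simp add: l_def)
        moreover have "(\<Sum>n\<in>{1..nat \<lfloor>x\<rfloor>}. rcmf w n / real n) = rsum (rcmf w) N x"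
          using Ssum_eq_rsum[of "rcmf w" x] by (simp add: Ssum_def N_def)
        ultimately have "(\<Sum>n\<in>{1..nat \<lfloor>x\<rfloor>}. rcmf w n / real n) \<ge> l + mart y x N w" using small by linarith
        then show ?case by auto
      qed
    qed
    also have "\<dots> \<le> exp (- (l\<^sup>2 * real y / (4 * (1 + ln x)\<^sup>2)))"
      unfolding N_def using y yx l by (intro mart_tail) auto
    also have "\<dots> \<le> exp (- (x powr (a / 2)))"
    proof -
      have "x powr (a / 2) \<le> l\<^sup>2 * (x powr a / 2) / (4 * (1 + ln x)\<^sup>2)" using x by (simp add: l_def)
      also have "\<dots> \<le> l\<^sup>2 * real y / (4 * (1 + ln x)\<^sup>2)"
        using y2 by (intro divide_right_mono mult_left_mono) auto
      finally show ?thesis by simp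
    qed
    finally show ?thesis by simp
  qed
  moreover have "a / 2 > 0" using a by simp
  ultimately show ?thesis by blast
qed

end
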